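(* Let $(\mathcal G,\Lambda)$ be a finite connected network, with exterior vertices split into a nonempty set $\mathcal V_{\mathrm d}$ of damped vertices and a nonempty set $\mathcal V_{\mathrm u}$ of undamped vertices. Let $d=\#\mathcal V_{\mathrm d}$, let $\mathfrak D$ be a nonempty bounded subset of $(\mathbb R_+)^d$, and let $\mathcal D=L^\infty(\mathbb R,\mathfrak D)$. Then the family of wave systems $\Sigma_\omega(\mathcal G,\Lambda,\mathcal D)$ is exponentially stable in $\mathsf X_p^\omega$ for some $p\in[1,+\infty]$ if and only if $\mathcal G$ is a tree, $\mathcal V_{\mathrm u}$ contains only one vertex, and $\overline{\mathfrak D}\subset(\mathbb R_+^\ast)^d$.
   Context: Notation: $\mathbb R_+=[0,+\infty)$, $\mathbb R_+^\ast=(0,+\infty)$; $\overline{\mathfrak D}$ is the closure of $\mathfrak D$; $e_1,e_2,\dots$ is the canonical basis. Graphs and networks. $\mathcal G=(\mathcal V,\mathcal E)$ is a finite connected graph, with $\mathcal E$ a set of unordered pairs $\{q,p\}$ of distinct vertices, endowed with an orientation $\alpha,\omega:\mathcal E\to\mathcal V$ such that $e=\{\alpha(e),\omega(e)\}$ for all $e\in\mathcal E$. We identify $\mathcal E$ with $\{1,\dots,N\}$. A tree is a (connected) graph without cycles, a cycle being a closed path with at least three distinct vertices and no repeated vertex except the endpoints. $\mathcal E_q$ is the set of edges having $q$ as an endpoint and $n_q=\#\mathcal E_q$. A vertex $q$ is exterior if $n_q\le1$ and interior otherwise; $\mathcal V_{\mathrm{ext}},\mathcal V_{\mathrm{int}}$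 are the corresponding sets. It is assumed that $\mathcal V_{\mathrm{ext}}$ has at least two elements, and that $\mathcal V_{\mathrm{ext}}$ is the disjoint union of two nonempty sets $\mathcal V_{\mathrm d}$ (damped vertices) and $\mathcal V_{\mathrm u}$ (undamped vertices). A network $(\mathcal G,L)$ is such a graph with a vector $L=(L_1,\dots,L_N)\in(\mathbb R_+^\ast)^N$ of edge lengths. For a function $u_j$ on $[0,L_j]$ write $u_j(\alpha(j))=u_j(0)$, $u_j(\omega(j))=u_j(L_j)$, and for the normal derivatives $\frac{du_j}{dn_j}(\alpha(j))=-u_j'(0)$, $\frac{du_j}{dn_j}(\omega(j))=u_j'(L_j)$. The wave system. For $\eta=(\eta_q)_{q\in\mathcal V_{\mathrm d}}$ measurable with nonnegative components, $\Sigma_\omega(\mathcal G,L,\eta)$ is, for $t\ge0$, $\partial_t^2u_j=\partial_x^2u_j$ on $[0,L_j]$ for $j\in\{1,\dots,N\}$; $u_j(t,q)=u_k(t,q)$ for $q\in\mathcal V$, $j,k\in\mathcal E_q$; $\sum_{j\in\mathcal E_q}\frac{\partial u_j}{\partial n_j}(t,q)=0$ for $q\in\mathcal V_{\mathrm{int}}$; $\frac{\partial u_j}{\partial t}(t,q)=-\eta_q(t)\frac{\partial u_j}{\partial n_j}(t,q)$ for $q\in\mathcal V_{\mathrm d}$, $j\in\mathcal E_q$; $u_j(t,q)=0$ for $q\in\mathcal V_{\mathrm u}$, $j\in\mathcal E_q$. State space. $W^{1,p}_0(\mathcal G,L)$ is the set of $(u_1,\dots,u_N)\in\prod_jW^{1,p}([0,L_j],\mathbb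 C)$ with $u_j(q)=u_k(q)$ for all $q\in\mathcal V$, $j,k\in\mathcal E_q$, and $u_j(q)=0$ for all $q\in\mathcal V_{\mathrm u}$, $j\in\mathcal E_q$; $L^p(\mathcal G,L)=\prod_jL^p([0,L_j],\mathbb C)$. $\mathsf X_p^\omega=W_0^{1,p}(\mathcal G,L)\times L^p(\mathcal G,L)$ with norm $\|(u,v)\|_p=\big(\sum_j\|u_j'\|_{L^p}^p+\sum_j\|v_j\|_{L^p}^p\big)^{1/p}$ for $p<\infty$ and $\max_j\max(\|u_j'\|_{L^\infty},\|v_j\|_{L^\infty})$ for $p=\infty$. Solutions. Put $L^\tau_{2j-1}=L^\tau_{2j}=L_j$ and $\mathsf X_p^\tau=\prod_{i=1}^{2N}L^p([0,L_i^\tau],\mathbb C)$. The d'Alembert operator $T:\mathsf X_p^\omega\to\mathsf X_p^\tau$ is $T(u,v)=f$ with $f_{2j-1}(x)=u_j'(L_j-x)+v_j(L_j-x)$, $f_{2j}(x)=u_j'(x)-v_j(x)$. For $q\in\mathcal V$, $\Pi^q_{\mathrm{in}}$ (resp. $\Pi^q_{\mathrm{out}}$) is the $n_q\times2N$ matrix whose rows, indexed by $j\in\mathcal E_q$ in increasing order, are $e_{2j}^{\mathrm T}$ if $\omega(j)=q$ and $e_{2j-1}^{\mathrm T}$ if $\alpha(j)=q$ (resp. $e_{2j}^{\mathrm T}$ if $\alpha(j)=q$ and $e_{2j-1}^{\mathrm T}$ if $\omega(j)=q$). With $J_n$ the $n\times n$ all-ones matrix and $D=\mathrm{diag}((-1)^j)_{j=1}^{2N}$,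 let $M^q(t)=(\Pi^q_{\mathrm{out}})^{\mathrm T}(\mathrm{Id}-\frac2{n_q}J_{n_q})\Pi^q_{\mathrm{in}}$ if $q\in\mathcal V_{\mathrm{int}}$, $(\Pi^q_{\mathrm{out}})^{\mathrm T}\Pi^q_{\mathrm{in}}$ if $q\in\mathcal V_{\mathrm u}$, $\frac{1-\eta_q(t)}{1+\eta_q(t)}(\Pi^q_{\mathrm{out}})^{\mathrm T}\Pi^q_{\mathrm{in}}$ if $q\in\mathcal V_{\mathrm d}$, and $M(t)=(m_{ik}(t))=-D\big(\sum_{q\in\mathcal V}M^q(t)\big)D$. The solution of the transport system $\partial_tf_i+\partial_xf_i=0$ on $[0,L_i^\tau]$, $f_i(t,0)=\sum_{k=1}^{2N}m_{ik}(t)f_k(t,L_k^\tau)$ with initial condition $f^0\in\mathsf X_p^\tau$ is understood along characteristics: $f_i(t,x)=g_i(t-x)$ where $g_i(s)=f^0_i(-s)$ for a.e. $s\in[-L_i^\tau,0)$ and $g_i(t)=\sum_km_{ik}(t)g_k(t-L_k^\tau)$ for a.e. $t\ge0$. A function $U:\mathbb R_+\to\mathsf X_p^\omega$ is the solution of $\Sigma_\omega(\mathcal G,L,\eta)$ with initial condition $U_0\in\mathsf X_p^\omega$ if $TU$ is the solution of this transport system with initial condition $TU_0$. Stability. $L^\infty(\mathbb R,\mathfrak D)$ is the set of (essentially bounded) measurable functions from $\mathbb R$ to $\mathfrak D$; $\Sigma_\omega(\mathcal G,L,\mathcal D)$ is the family of systems $\Sigma_\omega(\mathcal G,L,\eta)$,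 $\eta\in\mathcal D$. It is of exponential type $\gamma\in\mathbb R$ in $\mathsf X_p^\omega$ if for every $\varepsilon>0$ there is $K>0$ such that for all $\eta\in\mathcal D$ and $U_0\in\mathsf X_p^\omega$ the solution $U$ satisfies $\|U(t)\|_p\le Ke^{(\gamma+\varepsilon)t}\|U_0\|_p$ for all $t\ge0$. It is exponentially stable in $\mathsf X_p^\omega$ if it is of exponential type $\gamma$ for some $\gamma<0$. *)

theory Defs
  imports "HOL-Analysis.Analysis" "HOL-Probability.Essential_Supremum"
begin

section \<open>Networks\<close>

text \<open>Edges are the numbers \<open>1, \<dots>, nedges G\<close>; edge \<open>j\<close> is the unordered pair
  \<open>{src G j, tgt G j}\<close>, where \<open>src\<close> and \<open>tgt\<close> are the orientation maps
  (\<open>\<alpha>\<close> and \<open>\<omega>\<close>), and has length \<open>len G j\<close>.\<close>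

record 'v network =
  verts :: "'v set"
  nedges :: nat
  src :: "nat \<Rightarrow> 'v"
  tgt :: "nat \<Rightarrow> 'v"
  len :: "nat \<Rightarrow> real"
  damped :: "'v set"
  undamped :: "'v set"

definition edge_ends :: "'v network \<Rightarrow> nat \<Rightarrow> 'v set" where
  "edge_ends G j = {src G j, tgt G j}"

definition edge_pairs :: "'v network \<Rightarrow> 'v set set" where
  "edge_pairs G = edge_ends G ` {1..nedges G}"

definition edges_at :: "'v network \<Rightarrow> 'v \<Rightarrow> nat set" where
  "edges_at G q = {j \<in> {1..nedges G}. q \<in> edge_ends G j}"

definition vdegree :: "'v network \<Rightarrow> 'v \<Rightarrow> nat" where
  "vdegree G q = card (edges_at G q)"

definition ext_verts :: "'v network \<Rightarrow> 'v set" where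
  "ext_verts G = {q \<in> verts G. vdegree G q \<le> 1}"

definition int_verts :: "'v network \<Rightarrow> 'v set" where
  "int_verts G = verts G - ext_verts G"

definition graph_path :: "'v network \<Rightarrow> 'v list \<Rightarrow> bool" where
  "graph_path G ps \<longleftrightarrow>
     ps \<noteq> [] \<and> set ps \<subseteq> verts G \<and> successively (\<lambda>p q. {p, q} \<in> edge_pairs G) ps"

definition graph_connected :: "'v network \<Rightarrow> bool" where
  "graph_connected G \<longleftrightarrow>
     (\<forall>p\<in>verts G. \<forall>q\<in>verts G. \<exists>ps. graph_path G ps \<and> hd ps = p \<and> last ps = q)"

definition graph_cycle :: "'v network \<Rightarrow> 'v list \<Rightarrow> bool" where
  "graph_cycle G ps \<longleftrightarrow>
     graph_path G ps \<and> hd ps = last ps \<and> distinct (tl ps) \<and> card (set ps) \<ge> 3"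

definition graph_tree :: "'v network \<Rightarrow> bool" where
  "graph_tree G \<longleftrightarrow> graph_connected G \<and> \<not> (\<exists>ps. graph_cycle G ps)"

definition is_network :: "'v network \<Rightarrow> bool" where
  "is_network G \<longleftrightarrow>
     finite (verts G) \<and>
     (\<forall>j\<in>{1..nedges G}. src G j \<in> verts G \<and> tgt G j \<in> verts G \<and> src G j \<noteq> tgt G j) \<and>
     inj_on (edge_ends G) {1..nedges G} \<and>
     graph_connected G \<and>
     (\<forall>j\<in>{1..nedges G}. len G j > 0) \<and>
     card (ext_verts G) \<ge> 2 \<and>
     ext_verts G = damped G \<union> undamped G \<and> damped G \<inter> undamped G = {} \<and>
     damped G \<noteq> {} \<and> undamped G \<noteq> {}"

section \<open>Function spaces\<close>

text \<open>Elements of \<open>L\<^sup>p([0,l],\<complex>)\<close> are represented by functions on the real line; only their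
  almost-everywhere values on \<open>[0,l]\<close> matter.\<close>

definition Lp_norm :: "real \<Rightarrow> ereal \<Rightarrow> (real \<Rightarrow> complex) \<Rightarrow> real" where
  "Lp_norm l p f =
     (if p = \<infinity> then real_of_ereal (esssup (lebesgue_on {0..l}) (\<lambda>x. ereal (cmod (f x))))
      else (LINT x|lebesgue_on {0..l}. cmod (f x) powr real_of_ereal p) powr (1 / real_of_ereal p))"

definition Lp_space :: "real \<Rightarrow> ereal \<Rightarrow> (real \<Rightarrow> complex) set" where
  "Lp_space l p = {f. f \<in> borel_measurable (lebesgue_on {0..l}) \<and>
     (if p = \<infinity> then esssup (lebesgue_on {0..l}) (\<lambda>x. ereal (cmod (f x))) < \<infinity>
      else integrable (lebesgue_on {0..l}) (\<lambda>x. cmod (f x) powr real_of_ereal p))}"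

text \<open>Weak derivatives on \<open>(0,l)\<close>, tested against \<open>C\<^sup>1\<close> functions with compact support in
  \<open>(0,l)\<close>, as is customary in dimension one.\<close>

definition test_functions :: "real \<Rightarrow> (real \<Rightarrow> real) set" where
  "test_functions l = {\<phi>. \<phi> C1_differentiable_on UNIV \<and>
     compact (closure {x. \<phi> x \<noteq> 0}) \<and> closure {x. \<phi> x \<noteq> 0} \<subseteq> {0<..<l}}"

definition has_weak_deriv :: "real \<Rightarrow> (real \<Rightarrow> complex) \<Rightarrow> (real \<Rightarrow> complex) \<Rightarrow> bool" where
  "has_weak_deriv l u g \<longleftrightarrow>
     integrable (lebesgue_on {0..l}) u \<and> integrable (lebesgue_on {0..l}) g \<and>
     (\<forall>\<phi>\<in>test_functions l.
        (LINT x|lebesgue_on {0..l}. u x * of_real (deriv \<phi> x)) =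
        - (LINT x|lebesgue_on {0..l}. g x * of_real (\<phi> x)))"

text \<open>The weak derivative is unique up to a null set, and every use of \<open>weak_deriv\<close> below
  depends only on its class.\<close>

definition weak_deriv :: "real \<Rightarrow> (real \<Rightarrow> complex) \<Rightarrow> real \<Rightarrow> complex" where
  "weak_deriv l u = (SOME g. has_weak_deriv l u g)"

text \<open>Elements of \<open>W\<^sup>1\<^sup>,\<^sup>p([0,l],\<complex>)\<close> are represented by their continuous representative, so that
  the values at the endpoints make sense.\<close>

definition W1p_space :: "real \<Rightarrow> ereal \<Rightarrow> (real \<Rightarrow> complex) set" where
  "W1p_space l p = {u. continuous_on {0..l} u \<and> u \<in> Lp_space l p \<and>
     (\<exists>g\<in>Lp_space l p. has_weak_deriv l u g)}"

section \<open>The state space of the wave system\<close>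

type_synonym edge_funs = "nat \<Rightarrow> real \<Rightarrow> complex"

text \<open>The value at the endpoint \<open>q\<close> of edge \<open>j\<close> of a function on that edge.\<close>

definition end_val :: "'v network \<Rightarrow> nat \<Rightarrow> (real \<Rightarrow> complex) \<Rightarrow> 'v \<Rightarrow> complex" where
  "end_val G j w q = (if q = src G j then w 0 else w (len G j))"

definition W1p0 :: "'v network \<Rightarrow> ereal \<Rightarrow> edge_funs set" where
  "W1p0 G p = {u. (\<forall>j\<in>{1..nedges G}. u j \<in> W1p_space (len G j) p) \<and>
     (\<forall>q\<in>verts G. \<forall>j\<in>edges_at G q. \<forall>k\<in>edges_at G q.
        end_val G j (u j) q = end_val G k (u k) q) \<and>
     (\<forall>q\<in>undamped G. \<forall>j\<in>edges_at G q. end_val G j (u j) q = 0)}"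

definition Lp_net :: "'v network \<Rightarrow> ereal \<Rightarrow> edge_funs set" where
  "Lp_net G p = {v. \<forall>j\<in>{1..nedges G}. v j \<in> Lp_space (len G j) p}"

definition wave_space :: "'v network \<Rightarrow> ereal \<Rightarrow> (edge_funs \<times> edge_funs) set" where
  "wave_space G p = W1p0 G p \<times> Lp_net G p"

definition wave_norm :: "'v network \<Rightarrow> ereal \<Rightarrow> edge_funs \<times> edge_funs \<Rightarrow> real" where
  "wave_norm G p = (\<lambda>(u, v).
     if p = \<infinity> then
       (MAX j\<in>{1..nedges G}.
          max (Lp_norm (len G j) p (weak_deriv (len G j) (u j))) (Lp_norm (len G j) p (v j)))
     else
       ((\<Sum>j\<in>{1..nedges G}. Lp_norm (len G j) p (weak_deriv (len G j) (u j)) powr real_of_ereal p) +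
        (\<Sum>j\<in>{1..nedges G}. Lp_norm (len G j) p (v j) powr real_of_ereal p))
       powr (1 / real_of_ereal p))"

section \<open>Solutions\<close>

text \<open>Transport components are numbered \<open>1, \<dots>, 2 * nedges G\<close>; components \<open>2 * j - 1\<close> and
  \<open>2 * j\<close> live on edge \<open>j = (i + 1) div 2\<close>.\<close>

definition tlen :: "'v network \<Rightarrow> nat \<Rightarrow> real" where
  "tlen G i = len G ((i + 1) div 2)"

definition dAlembert :: "'v network \<Rightarrow> edge_funs \<times> edge_funs \<Rightarrow> edge_funs" where
  "dAlembert G = (\<lambda>(u, v) i x.
     let j = (i + 1) div 2; l = len G j; du = weak_deriv l (u j) in
       if odd i then du (l - x) + v j (l - x) else du x - v j x)"

text \<open>Entry \<open>(j, k)\<close> of the matrices \<open>\<Pi>\<^sub>i\<^sub>n\<close> and \<open>\<Pi>\<^sub>o\<^sub>u\<^sub>t\<close> at vertex \<open>q\<close>, with rows indexed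
  directly by the edges \<open>j \<in> edges_at G q\<close>.\<close>

definition Pi_in :: "'v network \<Rightarrow> 'v \<Rightarrow> nat \<Rightarrow> nat \<Rightarrow> real" where
  "Pi_in G q j k = of_bool (k = (if tgt G j = q then 2 * j else 2 * j - 1))"

definition Pi_out :: "'v network \<Rightarrow> 'v \<Rightarrow> nat \<Rightarrow> nat \<Rightarrow> real" where
  "Pi_out G q j k = of_bool (k = (if src G j = q then 2 * j else 2 * j - 1))"

definition vertex_mat :: "'v network \<Rightarrow> ('v \<Rightarrow> real) \<Rightarrow> 'v \<Rightarrow> nat \<Rightarrow> nat \<Rightarrow> real" where
  "vertex_mat G a q i k =
     (if q \<in> int_verts G then
        (\<Sum>j\<in>edges_at G q. \<Sum>l\<in>edges_at G q.
           Pi_out G q j i * (of_bool (j = l) - 2 / real (vdegree G q)) * Pi_in G q l k)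
      else if q \<in> undamped G then
        (\<Sum>j\<in>edges_at G q. Pi_out G q j i * Pi_in G q j k)
      else
        (1 - a q) / (1 + a q) * (\<Sum>j\<in>edges_at G q. Pi_out G q j i * Pi_in G q j k))"

definition trans_mat :: "'v network \<Rightarrow> ('v \<Rightarrow> real) \<Rightarrow> nat \<Rightarrow> nat \<Rightarrow> real" where
  "trans_mat G a i k = - ((- 1) ^ i * (\<Sum>q\<in>verts G. vertex_mat G a q i k) * (- 1) ^ k)"

text \<open>Here \<open>a t q\<close> is the damping coefficient \<open>\<eta>\<^sub>q(t)\<close>.\<close>

definition transport_solution ::
  "'v network \<Rightarrow> (real \<Rightarrow> 'v \<Rightarrow> real) \<Rightarrow> edge_funs \<Rightarrow> (real \<Rightarrow> edge_funs) \<Rightarrow> bool" where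
  "transport_solution G a f0 f \<longleftrightarrow>
     (\<exists>g :: edge_funs. \<forall>i\<in>{1..2 * nedges G}.
        (AE s in lebesgue. - tlen G i \<le> s \<and> s < 0 \<longrightarrow> g i s = f0 i (- s)) \<and>
        (AE t in lebesgue. t \<ge> 0 \<longrightarrow>
           g i t = (\<Sum>k\<in>{1..2 * nedges G}. of_real (trans_mat G (a t) i k) * g k (t - tlen G k))) \<and>
        (\<forall>t\<ge>0. AE x in lebesgue. 0 \<le> x \<and> x \<le> tlen G i \<longrightarrow> f t i x = g i (t - x)))"

definition wave_solution ::
  "'v network \<Rightarrow> ereal \<Rightarrow> (real \<Rightarrow> 'v \<Rightarrow> real) \<Rightarrow> edge_funs \<times> edge_funs
     \<Rightarrow> (real \<Rightarrow> edge_funs \<times> edge_funs) \<Rightarrow> bool" where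
  "wave_solution G p a U0 U \<longleftrightarrow>
     (\<forall>t\<ge>0. U t \<in> wave_space G p) \<and>
     transport_solution G a (dAlembert G U0) (\<lambda>t. dAlembert G (U t))"

section \<open>Stability\<close>

definition Linf_into :: "('a::euclidean_space) set \<Rightarrow> (real \<Rightarrow> 'a) set" where
  "Linf_into D = {h. h \<in> borel_measurable lebesgue \<and> (\<forall>t. h t \<in> D) \<and>
     esssup lebesgue (\<lambda>t. ereal (norm (h t))) < \<infinity>}"

text \<open>The map \<open>\<nu>\<close> enumerates the damped vertices by the coordinates of \<open>\<real>\<^sup>d\<close>.\<close>

definition wave_exp_type ::
  "'v network \<Rightarrow> ('d::finite \<Rightarrow> 'v) \<Rightarrow> (real \<Rightarrow> real ^ 'd) set \<Rightarrow> ereal \<Rightarrow> real \<Rightarrow> bool" where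
  "wave_exp_type G \<nu> \<D> p \<gamma> \<longleftrightarrow>
     (\<forall>\<epsilon>>0. \<exists>K>0. \<forall>\<eta>\<in>\<D>. \<forall>U0\<in>wave_space G p. \<forall>U.
        wave_solution G p (\<lambda>t q. \<eta> t $ inv \<nu> q) U0 U \<longrightarrow>
        (\<forall>t\<ge>0. wave_norm G p (U t) \<le> K * exp ((\<gamma> + \<epsilon>) * t) * wave_norm G p U0))"

definition wave_exp_stable ::
  "'v network \<Rightarrow> ('d::finite \<Rightarrow> 'v) \<Rightarrow> (real \<Rightarrow> real ^ 'd) set \<Rightarrow> ereal \<Rightarrow> bool" where
  "wave_exp_stable G \<nu> \<D> p \<longleftrightarrow> (\<exists>\<gamma><0. wave_exp_type G \<nu> \<D> p \<gamma>)"

end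

theory Submission
  imports Defs "HOL-Analysis.Kronecker_Approximation_Theorem"
begin

text \<open>
  In the d'Alembert variables a solution is a family \<open>g\<^sub>i\<close> with \<open>g\<^sub>i(t) = \<Sum>\<^sub>k m\<^sub>i\<^sub>k(t) g\<^sub>k(t - L\<^sub>k)\<close>, where
  the matrix scatters the waves arriving at a vertex into those leaving it.

  Necessity. A cycle, or a walk joining two exterior vertices that are undamped or have
  arbitrarily small damping, carries a nonzero flow \<open>s\<close> without sources inside the network. By
  Dirichlet's theorem on simultaneous approximation, eigenfrequencies \<open>\<omega>\<^sub>j \<in> 2\<pi>\<int>/L\<^sub>j\<close> of the edges can
  be chosen arbitrarily close to each other. The functions \<open>s\<^sub>j sin(\<omega>\<^sub>j x)/\<omega>\<^sub>j\<close> are then the initial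
  data of a solution which, for constant damping, stays close to
  \<open>s\<^sub>j cos(\<omega>\<^sub>j t) sin(\<omega>\<^sub>j x)/\<omega>\<^sub>j\<close> on any prescribed time interval; so no uniform decay is possible,
  in any \<open>L\<^sup>p\<close>.

  Sufficiency. Take \<open>p = 2\<close>. The scattering is isometric except at damped vertices, where a fixed
  fraction of the arriving energy is lost. On a tree whose only undamped end is the root, continuity
  and Kirchhoff's law determine all traces, going from the damped leaves towards the root, so the
  energy is bounded by the energy arriving at the damped vertices over a long enough time interval.
  Hence the energy decreases by a fixed factor over every such interval.
\<close>

section \<open>Scattering at the vertices\<close>

text \<open>An exact undamped standing wave along a walk would need one frequency fitting all its
  edges, which incommensurable lengths can forbid. The substitute is detuned by at most \<kappa>,
  and its defects (detuning and residual damping) grow at most fourfold per shortest travel time.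
  Hence the order of choices: the assumed decay fixes a horizon \<open>T\<close>, then
  \<open>T\<close> fixes the tolerance \<rho>, and only then come the damping and the frequencies.
  Frequencies enter neither the bound on the initial norm nor the lower bound at \<open>T\<close>;
  the latter passes through an L^1 mean, which serves every \<open>p\<close> at once. The reflection
  factor (1 - x)/(1 + x) has modulus near 1 both for small and for large x. Compactness of
  \<open>closure D\<close> keeps x between some \<mu> > 0 and \<open>B\<close>, so the absorbed
  fraction 4x/(1 + x)^2 is at least 4\<mu>/(1 + B)^2.\<close>

definition in_ix :: "'v network \<Rightarrow> 'v \<Rightarrow> nat \<Rightarrow> nat" where
  "in_ix G q j = (if tgt G j = q then 2 * j else 2 * j - 1)"

text \<open>Component \<open>2 * j\<close> travels from \<open>src\<close> to \<open>tgt\<close>,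
  component \<open>2 * j - 1\<close> travels back; so at each end of edge \<open>j\<close> one of
  them arrives (\<open>in_ix\<close>) and the other leaves (\<open>out_ix\<close>).\<close>

definition out_ix :: "'v network \<Rightarrow> 'v \<Rightarrow> nat \<Rightarrow> nat" where
  "out_ix G q j = (if src G j = q then 2 * j else 2 * j - 1)"

text \<open>The factor between \<open>u'\<close> and the outward normal derivative at the end
  \<open>q\<close>. It is also the parity sign of \<open>in_ix G q j\<close>, which is how it comes
  out of the alternating signs in \<open>trans_mat\<close>.\<close>

definition end_sign :: "'v network \<Rightarrow> 'v \<Rightarrow> nat \<Rightarrow> real" where
  "end_sign G q j = (if tgt G j = q then 1 else - 1)"

text \<open>A Dirichlet end reflects with factor 1, not -1, because the waves are
  \<open>u' + v\<close> and \<open>u' - v\<close>, which agree where \<open>v = 0\<close>.\<close>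

definition refl_coeff :: "'v network \<Rightarrow> ('v \<Rightarrow> real) \<Rightarrow> 'v \<Rightarrow> real" where
  "refl_coeff G a q = (if q \<in> undamped G then 1 else (1 - a q) / (1 + a q))"

lemma end_sign_square [simp]: "end_sign G q j * end_sign G q j = 1"
  by (simp add: end_sign_def)

lemma abs_end_sign [simp]: "\<bar>end_sign G q j\<bar> = 1"
  by (simp add: end_sign_def)

locale wave_net =
  fixes G :: "'v network"
  assumes network: "is_network G"
begin

abbreviation edges :: "nat set" where "edges \<equiv> {1..nedges G}"
abbreviation components :: "nat set" where "components \<equiv> {1..2 * nedges G}"

section \<open>Edge ends as indices of the transport components\<close>

lemma finite_verts: "finite (verts G)"
  using network by (auto simp: is_network_def)

lemma finite_edges_at [simp]: "finite (edges_at G q)"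
  by (auto simp: edges_at_def)

lemma edges_atD:
  assumes "j \<in> edges_at G q"
  shows "j \<ge> 1" "j \<le> nedges G" "q = src G j \<or> q = tgt G j" "src G j \<noteq> tgt G j"
    "src G j \<in> verts G" "tgt G j \<in> verts G" "q \<in> verts G" "len G j > 0"
  using assms network by (auto simp: is_network_def edges_at_def edge_ends_def)

lemma edge_at_ends:
  assumes "j \<in> edges"
  shows "j \<in> edges_at G (src G j)" "j \<in> edges_at G (tgt G j)"
  using assms by (auto simp: edges_at_def edge_ends_def)

lemma undamped_not_int: "q \<in> undamped G \<Longrightarrow> q \<notin> int_verts G"
  using network by (auto simp: is_network_def int_verts_def)

lemma damped_not_int: "q \<in> damped G \<Longrightarrow> q \<notin> int_verts G"
  using network by (auto simp: is_network_def int_verts_def)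

lemma not_int_cases:
  assumes "q \<in> verts G" "q \<notin> int_verts G"
  shows "q \<in> damped G \<or> q \<in> undamped G"
  using network assms by (auto simp: is_network_def int_verts_def)

lemma edges_at_not_int:
  assumes "q \<notin> int_verts G" "j \<in> edges_at G q"
  shows "edges_at G q = {j}"
proof -
  have "q \<in> ext_verts G"
    using assms edges_atD(7)[OF assms(2)] by (auto simp: int_verts_def)
  then have "card (edges_at G q) \<le> 1"
    by (auto simp: ext_verts_def vdegree_def)
  with assms(2) show ?thesis
    using card_le_Suc0_iff_eq[OF finite_edges_at, of q] by auto
qed

lemma vdegree_int: "q \<in> int_verts G \<Longrightarrow> vdegree G q \<ge> 2"
  by (auto simp: int_verts_def ext_verts_def)

lemma tlen_ix [simp]:
  assumes "j \<in> edges_at G q"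
  shows "tlen G (in_ix G q j) = len G j" "tlen G (out_ix G q j) = len G j"
  using edges_atD(1)[OF assms] by (auto simp: tlen_def in_ix_def out_ix_def)

lemma ix_range:
  assumes "j \<in> edges_at G q"
  shows "in_ix G q j \<in> components" "out_ix G q j \<in> components"
  using edges_atD(1,2)[OF assms] by (auto simp: in_ix_def out_ix_def)

lemma out_ix_inj:
  assumes "j \<in> edges_at G q" "j' \<in> edges_at G q'" "out_ix G q j = out_ix G q' j'"
  shows "j = j' \<and> q = q'"
proof -
  have "(out_ix G q j + 1) div 2 = j" "(out_ix G q' j' + 1) div 2 = j'"
    using edges_atD(1)[OF assms(1)] edges_atD(1)[OF assms(2)] by (auto simp: out_ix_def)
  then have "j = j'" using assms(3) by simp
  with assms edges_atD[OF assms(1)] edges_atD[OF assms(2)] show ?thesis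
    by (simp add: out_ix_def split: if_splits)
qed

lemma in_ix_inj:
  assumes "j \<in> edges_at G q" "j' \<in> edges_at G q'" "in_ix G q j = in_ix G q' j'"
  shows "j = j' \<and> q = q'"
proof -
  have "(in_ix G q j + 1) div 2 = j" "(in_ix G q' j' + 1) div 2 = j'"
    using edges_atD(1)[OF assms(1)] edges_atD(1)[OF assms(2)] by (auto simp: in_ix_def)
  then have "j = j'" using assms(3) by simp
  with assms edges_atD[OF assms(1)] edges_atD[OF assms(2)] show ?thesis
    by (simp add: in_ix_def split: if_splits)
qed

lemma ix_surj:
  assumes "i \<in> components"
  obtains j q q' where "j \<in> edges_at G q" "i = out_ix G q j" "j \<in> edges_at G q'" "i = in_ix G q' j"
proof (cases "even i")
  case True
  then obtain j where j: "i = 2 * j" by (auto elim: evenE)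
  with assms have "j \<in> edges" by auto
  from that[OF edge_at_ends(1)[OF this] _ edge_at_ends(2)[OF this]] j show ?thesis
    by (simp add: in_ix_def out_ix_def)
next
  case False
  then obtain m where m: "i = 2 * m + 1" by (auto elim: oddE)
  with assms have j: "Suc m \<in> edges" by auto
  with network have "src G (Suc m) \<noteq> tgt G (Suc m)" by (auto simp: is_network_def)
  with that[OF edge_at_ends(2)[OF j] _ edge_at_ends(1)[OF j]] m show ?thesis
    by (simp add: in_ix_def out_ix_def)
qed

lemma out_ix_surj: "i \<in> components \<Longrightarrow> \<exists>q j. j \<in> edges_at G q \<and> i = out_ix G q j"
  using ix_surj by metis

lemma in_ix_surj: "i \<in> components \<Longrightarrow> \<exists>q j. j \<in> edges_at G q \<and> i = in_ix G q j"
  using ix_surj by metis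

text \<open>Each component leaves exactly one vertex and arrives at exactly one, so a sum over
  components can be regrouped by vertices. This is the common argument for \<open>out_ix\<close> and
  \<open>in_ix\<close>.\<close>

lemma sum_ix:
  fixes F :: "nat \<Rightarrow> 'b::comm_monoid_add" and ix :: "'v \<Rightarrow> nat \<Rightarrow> nat"
  assumes inj: "\<And>q q' j j'. j \<in> edges_at G q \<Longrightarrow> j' \<in> edges_at G q' \<Longrightarrow> ix q j = ix q' j' \<Longrightarrow> j = j' \<and> q = q'"
    and range: "\<And>q j. j \<in> edges_at G q \<Longrightarrow> ix q j \<in> components"
    and surj: "\<And>i. i \<in> components \<Longrightarrow> \<exists>q j. j \<in> edges_at G q \<and> i = ix q j"
  shows "(\<Sum>i\<in>components. F i) = (\<Sum>q\<in>verts G. \<Sum>j\<in>edges_at G q. F (ix q j))"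
proof -
  have "(\<Sum>q\<in>verts G. \<Sum>j\<in>edges_at G q. F (ix q j)) = (\<Sum>(q, j)\<in>Sigma (verts G) (edges_at G). F (ix q j))"
    by (rule sum.Sigma) (auto simp: finite_verts)
  also have "\<dots> = sum F components"
  proof (rule sum.reindex_cong[symmetric, where l = "\<lambda>(q, j). ix q j"])
    show "inj_on (\<lambda>(q, j). ix q j) (Sigma (verts G) (edges_at G))"
      using inj by (auto simp: inj_on_def)
    show "components = (\<lambda>(q, j). ix q j) ` Sigma (verts G) (edges_at G)"
    proof (intro subset_antisym subsetI)
      fix i assume "i \<in> components"
      then obtain j q where "j \<in> edges_at G q" "i = ix q j" using surj by metis
      then show "i \<in> (\<lambda>(q, j). ix q j) ` Sigma (verts G) (edges_at G)"
        using edges_atD(7) by (auto intro!: image_eqI[where x = "(q, j)"])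
    qed (use range in auto)
  qed auto
  finally show ?thesis by simp
qed

lemma sum_out_ix: "(\<Sum>i\<in>components. F i) = (\<Sum>q\<in>verts G. \<Sum>j\<in>edges_at G q. F (out_ix G q j))"
  by (rule sum_ix) (rule out_ix_inj ix_range(2) out_ix_surj; assumption)+

lemma sum_in_ix: "(\<Sum>i\<in>components. F i) = (\<Sum>q\<in>verts G. \<Sum>j\<in>edges_at G q. F (in_ix G q j))"
  by (rule sum_ix) (rule in_ix_inj ix_range(1) in_ix_surj; assumption)+

text \<open>Polymorphic because it acts on real waves when test solutions are built and on complex
  waves in the energy estimate.\<close>

definition scatter :: "('v \<Rightarrow> real) \<Rightarrow> nat \<Rightarrow> (nat \<Rightarrow> 'b::real_vector) \<Rightarrow> 'b" where
  "scatter a i x = (\<Sum>k\<in>components. trans_mat G a i k *\<^sub>R x k)"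

text \<open>Since \<open>out_ix\<close> is injective on edge ends, every vertex other than
  \<open>q\<close> has a zero row here.\<close>

lemma vertex_sum_eq:
  assumes j: "j \<in> edges_at G q"
  shows "(\<Sum>q'\<in>verts G. vertex_mat G a q' (out_ix G q j) k) =
    (if q \<in> int_verts G then
        (\<Sum>l\<in>edges_at G q. (of_bool (j = l) - 2 / real (vdegree G q)) * Pi_in G q l k)
      else refl_coeff G a q * Pi_in G q j k)"
proof -
  have P: "Pi_out G q' j' (out_ix G q j) = of_bool (q' = q \<and> j' = j)" if "j' \<in> edges_at G q'" for q' j'
    using out_ix_inj[OF j that] by (auto simp: Pi_out_def out_ix_def)
  have z: "vertex_mat G a q' (out_ix G q j) k = 0" if "q' \<noteq> q" for q'
    using that by (auto simp: vertex_mat_def P)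
  have Pq: "(\<Sum>j'\<in>edges_at G q. Pi_out G q j' (out_ix G q j) * h j') = h j" for h :: "nat \<Rightarrow> real"
  proof -
    have "(\<Sum>j'\<in>edges_at G q. Pi_out G q j' (out_ix G q j) * h j') = (\<Sum>j'\<in>edges_at G q. if j' = j then h j' else 0)"
      by (intro sum.cong) (auto simp: P)
    then show ?thesis using j by simp
  qed
  have "(\<Sum>q'\<in>verts G. vertex_mat G a q' (out_ix G q j) k) = vertex_mat G a q (out_ix G q j) k"
    using z edges_atD(7)[OF j] finite_verts
    by (subst sum.remove[where x = q]) auto
  also have "\<dots> = (if q \<in> int_verts G then
        (\<Sum>l\<in>edges_at G q. (of_bool (j = l) - 2 / real (vdegree G q)) * Pi_in G q l k)
      else refl_coeff G a q * Pi_in G q j k)"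
    unfolding vertex_mat_def refl_coeff_def
    by (simp add: Pq mult.assoc flip: sum_distrib_left)
  finally show ?thesis .
qed

text \<open>Conjugation by the alternating signs turns the all-ones matrix of an interior vertex
  into the rank-one matrix of the vector \<open>end_sign\<close>, so scattering there is the
  reflection in the hyperplane orthogonal to that vector. At an exterior vertex the signs cancel and
  only the reflection factor remains.\<close>

lemma scatter_out:
  fixes x :: "nat \<Rightarrow> 'b::real_vector"
  assumes j: "j \<in> edges_at G q"
  shows "scatter a (out_ix G q j) x =
    (if q \<in> int_verts G then x (in_ix G q j) -
        (end_sign G q j * (2 / real (vdegree G q))) *\<^sub>R (\<Sum>l\<in>edges_at G q. end_sign G q l *\<^sub>R x (in_ix G q l))
      else refl_coeff G a q *\<^sub>R x (in_ix G q j))"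
proof -
  \<comment> \<open>The outgoing index has the parity opposite to that of the incoming one; this
    cancels the minus sign in front of \<open>trans_mat\<close>.\<close>
  have so: "(-1) ^ out_ix G q j = - end_sign G q j" 
    using edges_atD[OF j] by (auto simp: out_ix_def end_sign_def)
  have si: "(-1) ^ in_ix G q l = end_sign G q l" if "l \<in> edges_at G q" for l
    using edges_atD[OF that] by (auto simp: in_ix_def end_sign_def)
  have P: "(\<Sum>k\<in>components. (Pi_in G q l k * (-1) ^ k) *\<^sub>R x k) = end_sign G q l *\<^sub>R x (in_ix G q l)"
    if l: "l \<in> edges_at G q" for l
  proof -
    have "(\<Sum>k\<in>components. (Pi_in G q l k * (-1) ^ k) *\<^sub>R x k) =
          (\<Sum>k\<in>components. if k = in_ix G q l then (-1) ^ k *\<^sub>R x k else 0)"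
      by (intro sum.cong) (auto simp: Pi_in_def in_ix_def)
    also have "\<dots> = end_sign G q l *\<^sub>R x (in_ix G q l)"
      using ix_range(1)[OF l] si[OF l] by (simp add: sum.delta)
    finally show ?thesis .
  qed
  have "scatter a (out_ix G q j) x = end_sign G q j *\<^sub>R
      (\<Sum>k\<in>components. ((\<Sum>q'\<in>verts G. vertex_mat G a q' (out_ix G q j) k) * (-1) ^ k) *\<^sub>R x k)"
    unfolding scatter_def trans_mat_def so by (simp add: scaleR_sum_right mult_ac)
  also have "\<dots> = (if q \<in> int_verts G then x (in_ix G q j) -
        (end_sign G q j * (2 / real (vdegree G q))) *\<^sub>R (\<Sum>l\<in>edges_at G q. end_sign G q l *\<^sub>R x (in_ix G q l))
      else refl_coeff G a q *\<^sub>R x (in_ix G q j))"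
  proof (cases "q \<in> int_verts G")
    case False
    have "(\<Sum>k\<in>components. ((refl_coeff G a q * Pi_in G q j k) * (-1) ^ k) *\<^sub>R x k) =
        refl_coeff G a q *\<^sub>R (\<Sum>k\<in>components. (Pi_in G q j k * (-1) ^ k) *\<^sub>R x k)"
      by (simp add: scaleR_sum_right mult_ac)
    also have "\<dots> = (refl_coeff G a q * end_sign G q j) *\<^sub>R x (in_ix G q j)"
      unfolding P[OF j] by simp
    finally have "(\<Sum>k\<in>components. ((refl_coeff G a q * Pi_in G q j k) * (-1) ^ k) *\<^sub>R x k) =
        (refl_coeff G a q * end_sign G q j) *\<^sub>R x (in_ix G q j)" .
    moreover have "end_sign G q j * (refl_coeff G a q * end_sign G q j) = refl_coeff G a q"
      by (metis end_sign_square mult.left_commute mult.right_neutral)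
    ultimately show ?thesis
      using False by (simp add: vertex_sum_eq[OF j])
  next
    case True
    have "(\<Sum>k\<in>components. ((\<Sum>l\<in>edges_at G q. (of_bool (j = l) - 2 / real (vdegree G q)) * Pi_in G q l k) * (-1) ^ k) *\<^sub>R x k)
       = (\<Sum>k\<in>components. \<Sum>l\<in>edges_at G q. (of_bool (j = l) - 2 / real (vdegree G q)) *\<^sub>R (Pi_in G q l k * (-1) ^ k) *\<^sub>R x k)"
      by (simp add: sum_distrib_right scaleR_sum_left mult.assoc)
    also have "\<dots> = (\<Sum>l\<in>edges_at G q. (of_bool (j = l) - 2 / real (vdegree G q)) *\<^sub>R
          (\<Sum>k\<in>components. (Pi_in G q l k * (-1) ^ k) *\<^sub>R x k))"
      by (subst sum.swap) (simp only: scaleR_sum_right)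
    also have "\<dots> = (\<Sum>l\<in>edges_at G q. (of_bool (j = l) - 2 / real (vdegree G q)) *\<^sub>R end_sign G q l *\<^sub>R x (in_ix G q l))"
      by (intro sum.cong) (simp_all only: P)
    also have "\<dots> = (\<Sum>l\<in>edges_at G q. (if j = l then end_sign G q l *\<^sub>R x (in_ix G q l) else 0) - 
          (2 / real (vdegree G q)) *\<^sub>R end_sign G q l *\<^sub>R x (in_ix G q l))"
      by (intro sum.cong) (auto simp: left_diff_distrib scaleR_left_diff_distrib)
    also have "\<dots> = end_sign G q j *\<^sub>R x (in_ix G q j) - (2 / real (vdegree G q)) *\<^sub>R (\<Sum>l\<in>edges_at G q. end_sign G q l *\<^sub>R x (in_ix G q l))"
      using j by (simp add: sum_subtractf scaleR_sum_right sum.delta)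
    finally have *: "(\<Sum>k\<in>components. ((\<Sum>l\<in>edges_at G q. (of_bool (j = l) - 2 / real (vdegree G q)) * Pi_in G q l k) * (-1) ^ k) *\<^sub>R x k)
       = end_sign G q j *\<^sub>R x (in_ix G q j) - (2 / real (vdegree G q)) *\<^sub>R (\<Sum>l\<in>edges_at G q. end_sign G q l *\<^sub>R x (in_ix G q l))" .
    show ?thesis
      using True by (simp only: vertex_sum_eq[OF j] if_True *) (simp add: scaleR_right_diff_distrib)
  qed
  finally show ?thesis .
qed

text \<open>The 3 is 1 for the edge itself plus 2/n for each of the n edges at the vertex. This
  crude sup-norm bound is enough because it is iterated a fixed number of times only.\<close>

lemma scatter_norm_le:
  fixes x :: "nat \<Rightarrow> 'b::real_normed_vector"
  assumes i: "i \<in> components" and a: "\<And>q. q \<in> damped G \<Longrightarrow> a q \<ge> 0"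
    and x: "\<And>k. k \<in> components \<Longrightarrow> norm (x k) \<le> B"
  shows "norm (scatter a i x) \<le> 3 * B"
proof -
  obtain j q where j: "j \<in> edges_at G q" and i': "i = out_ix G q j" using ix_surj[OF i] by metis
  have xj: "norm (x (in_ix G q l)) \<le> B" if "l \<in> edges_at G q" for l
    using x ix_range(1)[OF that] by blast
  have B: "B \<ge> 0" using xj[OF j] norm_ge_zero order_trans by blast
  show ?thesis
  proof (cases "q \<in> int_verts G")
    case True
    let ?n = "real (vdegree G q)"
    let ?S = "\<Sum>l\<in>edges_at G q. end_sign G q l *\<^sub>R x (in_ix G q l)"
    have n: "?n > 0" using vdegree_int[OF True] by simp
    have "norm ?S \<le> (\<Sum>l\<in>edges_at G q. B)"
      by (rule sum_norm_le) (use xj in auto)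
    then have S: "norm ?S \<le> ?n * B" by (simp add: vdegree_def)
    have "norm (scatter a i x) \<le> norm (x (in_ix G q j)) + norm ((end_sign G q j * (2 / ?n)) *\<^sub>R ?S)"
      unfolding i' scatter_out[OF j] using True by (simp only: if_True norm_triangle_ineq4)
    also have "norm ((end_sign G q j * (2 / ?n)) *\<^sub>R ?S) = (2 / ?n) * norm ?S"
      using n by (simp add: abs_mult)
    also have "\<dots> \<le> (2 / ?n) * (?n * B)"
      by (rule mult_left_mono[OF S]) (use n in auto)
    also have "\<dots> = 2 * B" using n by simp
    finally show ?thesis using xj[OF j] by simp
  next
    case False
    have "\<bar>refl_coeff G a q\<bar> \<le> 1"
      using a[of q] not_int_cases[OF edges_atD(7)[OF j] False]
      by (auto simp: refl_coeff_def abs_le_iff field_simps)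
    then have "\<bar>refl_coeff G a q\<bar> * norm (x (in_ix G q j)) \<le> 1 * B"
      by (intro mult_mono) (use xj[OF j] in auto)
    then show ?thesis
      unfolding i' scatter_out[OF j] using False B by simp
  qed
qed

end

section \<open>Weak derivatives and norms\<close>

text \<open>The squared positive part is the C^1 building block of the bump functions below.\<close>

lemma has_real_derivative_max0_square:
  "((\<lambda>y::real. (max 0 y)\<^sup>2) has_real_derivative 2 * max 0 y) (at y)"
proof (cases y "0::real" rule: linorder_cases)
  case less
  have "((\<lambda>y::real. 0) has_real_derivative 2 * max 0 y) (at y)" using less by auto
  then show ?thesis
    by (rule has_field_derivative_transform_within_open[where S = "{..<0}"]) (use less in auto)
next
  case greater
  have "((\<lambda>y::real. y\<^sup>2) has_real_derivative 2 * max 0 y) (at y)" 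
    using greater by (auto intro!: derivative_eq_intros)
  then show ?thesis
    by (rule has_field_derivative_transform_within_open[where S = "{0<..}"]) (use greater in auto)
next
  case equal
  have "((\<lambda>h::real. (max 0 h)\<^sup>2 / h) \<longlongrightarrow> 0) (at 0)"
  proof (rule Lim_null_comparison)
    show "\<forall>\<^sub>F h in at (0::real). norm ((max 0 h)\<^sup>2 / h) \<le> \<bar>h\<bar>"
      by (rule always_eventually) (auto simp: max_def power2_eq_square)
  qed (auto intro!: tendsto_eq_intros)
  then show ?thesis
    using equal by (simp add: DERIV_def)
qed

text \<open>\<open>\<psi>\<close> is positive exactly on the interval, and
  \<open>n \<psi> / (1 + n \<psi>)\<close> pushes its positive values to 1 while zeros stay zeros;
  squares of positive parts keep everything C^1.\<close>

lemma test_function_sequence: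
  fixes a b l :: real
  assumes "0 < a" "a < b" "b < l"
  obtains \<phi> :: "nat \<Rightarrow> real \<Rightarrow> real"
  where "\<And>n. \<phi> n \<in> test_functions l" "\<And>n x. 0 \<le> \<phi> n x" "\<And>n x. \<phi> n x \<le> 1"
    "\<And>x. (\<lambda>n. \<phi> n x) \<longlonglongrightarrow> indicator {a<..<b} x"
proof -
  define \<psi> where "\<psi> = (\<lambda>x. (max 0 (x - a))\<^sup>2 * (max 0 (b - x))\<^sup>2)"
  define \<phi> where "\<phi> = (\<lambda>(n::nat) x. real n * \<psi> x / (1 + real n * \<psi> x))"
  define \<psi>' where "\<psi>' = (\<lambda>x. 2 * max 0 (x - a) * (max 0 (b - x))\<^sup>2 - (max 0 (x - a))\<^sup>2 * (2 * max 0 (b - x)))"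
  have psi0: "\<psi> x \<ge> 0" for x by (simp add: \<psi>_def)
  have pos: "1 + real n * \<psi> x > 0" for n x using psi0[of x] by (simp add: add_pos_nonneg)
  have out: "\<psi> x = 0" if "x \<notin> {a<..<b}" for x using that by (auto simp: \<psi>_def max_def)
  have ins: "\<psi> x > 0" if "x \<in> {a<..<b}" for x using that by (auto simp: \<psi>_def max_def)
  have d1: "((\<lambda>x. (max 0 (x - a))\<^sup>2) has_real_derivative 2 * max 0 (x - a)) (at x)" for x
    using DERIV_chain'[OF DERIV_diff[OF DERIV_ident DERIV_const] has_real_derivative_max0_square, of a x] by simp
  have d2: "((\<lambda>x. (max 0 (b - x))\<^sup>2) has_real_derivative - (2 * max 0 (b - x))) (at x)" for x
    using DERIV_chain'[OF DERIV_diff[OF DERIV_const DERIV_ident] has_real_derivative_max0_square, of b x] by simp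
  have dpsi: "(\<psi> has_real_derivative \<psi>' x) (at x)" for x
    unfolding \<psi>_def \<psi>'_def by (rule DERIV_cong[OF DERIV_mult[OF d1 d2]]) simp
  have dphi: "(\<phi> n has_real_derivative (real n * \<psi>' x) / (1 + real n * \<psi> x)\<^sup>2) (at x)" for n x
  proof -
    have p: "1 + real n * \<psi> x \<noteq> 0" using pos[of n x] by simp
    show ?thesis
      unfolding \<phi>_def using p
      by (auto intro!: derivative_eq_intros dpsi simp: power2_eq_square field_simps)
  qed
  have cpsi': "continuous_on UNIV \<psi>'" unfolding \<psi>'_def by (intro continuous_intros)
  have cpsi: "continuous_on UNIV \<psi>" unfolding \<psi>_def by (intro continuous_intros)
  have C1: "\<phi> n C1_differentiable_on UNIV" for n
    unfolding C1_differentiable_on_def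
  proof (intro exI conjI ballI)
    show "(\<phi> n has_vector_derivative (real n * \<psi>' x) / (1 + real n * \<psi> x)\<^sup>2) (at x)" for x
      using dphi by (simp add: has_real_derivative_iff_has_vector_derivative)
    have "1 + real n * \<psi> x \<noteq> 0" for x using pos[of n x] by simp
    then show "continuous_on UNIV (\<lambda>x. (real n * \<psi>' x) / (1 + real n * \<psi> x)\<^sup>2)"
      by (intro continuous_intros cpsi cpsi') auto
  qed
  have supp: "{x. \<phi> n x \<noteq> 0} \<subseteq> {a..b}" for n
  proof
    fix x assume "x \<in> {x. \<phi> n x \<noteq> 0}"
    then have "\<psi> x \<noteq> 0" by (auto simp: \<phi>_def)
    then show "x \<in> {a..b}" using out[of x] by force
  qed
  then have cl: "closure {x. \<phi> n x \<noteq> 0} \<subseteq> {a..b}" for n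
    by (rule closure_minimal) auto
  then have "compact (closure {x. \<phi> n x \<noteq> 0})" for n
    using compact_Icc closed_closure by (metis compact_Int_closed inf.absorb_iff2)
  then have test: "\<phi> n \<in> test_functions l" for n
    using C1 cl[of n] assms by (force simp: test_functions_def)
  have lim: "(\<lambda>n. \<phi> n x) \<longlonglongrightarrow> indicator {a<..<b} x" for x
  proof (cases "x \<in> {a<..<b}")
    case True
    have "(\<lambda>n. 1 - 1 / (1 + real n * \<psi> x)) \<longlonglongrightarrow> 1 - 0"
    proof (intro tendsto_diff tendsto_const tendsto_divide_0[OF tendsto_const])
      have "filterlim (\<lambda>n. 1 + \<psi> x * real n) at_top sequentially"
        by (intro filterlim_tendsto_add_at_top[OF tendsto_const]
            filterlim_tendsto_pos_mult_at_top[OF tendsto_const] ins[OF True] filterlim_real_sequentially)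
      then show "filterlim (\<lambda>n. 1 + real n * \<psi> x) at_infinity sequentially"
        by (simp add: filterlim_at_top_imp_at_infinity mult.commute)
    qed
    moreover have "1 - 1 / (1 + real n * \<psi> x) = \<phi> n x" for n
      using pos[of n x] by (simp add: \<phi>_def field_simps)
    ultimately show ?thesis using True by simp
  next
    case False
    then show ?thesis using out[OF False] by (simp add: \<phi>_def)
  qed
  show ?thesis
  proof (rule that[OF test _ _ lim])
    show "0 \<le> \<phi> n x" for n x
      using psi0[of x] pos[of n x] by (auto simp: \<phi>_def)
    show "\<phi> n x \<le> 1" for n x
      using psi0[of x] pos[of n x] by (auto simp: \<phi>_def)
  qed
qed

lemma test_function_continuous:
  assumes "\<phi> \<in> test_functions l"
  shows "continuous_on UNIV \<phi>"
  using assms C1_differentiable_imp_continuous_on by (auto simp: test_functions_def)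

abbreviation leb :: "real \<Rightarrow> real measure" where "leb l \<equiv> lebesgue_on {0..l}"

lemma AE_lebesgue_on_iff:
  "(AE x in lebesgue_on {0..l::real}. P x) \<longleftrightarrow> (AE x in lebesgue. 0 \<le> x \<and> x \<le> l \<longrightarrow> P x)"
  by (subst AE_restrict_space_iff) auto

text \<open>The fundamental lemma of the calculus of variations. Dominated convergence replaces test
  functions by indicators, so the integrals over all inner intervals vanish, and Lebesgue
  differentiation recovers \<open>h\<close> from them.\<close>

lemma AE_eq_0_if_orthogonal_to_tests:
  fixes h :: "real \<Rightarrow> complex"
  assumes h: "integrable (leb l) h"
    and 0: "\<And>\<phi>. \<phi> \<in> test_functions l \<Longrightarrow> (LINT x|leb l. h x * of_real (\<phi> x)) = 0"
  shows "AE x in leb l. h x = 0"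
proof -
  have m[measurable]: "h \<in> borel_measurable (leb l)" using h by auto
  have int0: "integral {a..b} h = 0" if ab: "0 < a" "a < b" "b < l" for a b
  proof -
    obtain \<phi> where test: "\<And>n. \<phi> n \<in> test_functions l" and p0: "\<And>n x. 0 \<le> \<phi> n x"
      and p1: "\<And>n x. \<phi> n x \<le> 1" and lim: "\<And>x. (\<lambda>n. \<phi> n x) \<longlonglongrightarrow> indicator {a<..<b} x"
      using test_function_sequence[OF ab] by metis
    have "(\<lambda>n. LINT x|leb l. h x * of_real (\<phi> n x))
        \<longlonglongrightarrow> (LINT x|leb l. h x * of_real (indicator {a<..<b} x))"
    proof (rule integral_dominated_convergence[where w = "\<lambda>x. norm (h x)"])
      show "(\<lambda>x. h x * of_real (\<phi> n x)) \<in> borel_measurable (leb l)" for n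
      proof -
        have "\<phi> n \<in> borel_measurable (leb l)"
          by (intro continuous_imp_measurable_on_sets_lebesgue continuous_on_subset[OF test_function_continuous[OF test]]) auto
        then show ?thesis by measurable
      qed
      show "(\<lambda>x. h x * of_real (indicator {a<..<b} x)) \<in> borel_measurable (leb l)"
      proof -
        have "(indicator {a<..<b} :: real \<Rightarrow> real) \<in> borel_measurable (leb l)"
          by (intro borel_measurable_if_I measurable_restrict_space1 borel_measurable_indicator) auto
        then show ?thesis by measurable
      qed
      show "integrable (leb l) (\<lambda>x. norm (h x))" using h by simp
      show "AE x in leb l. (\<lambda>n. h x * of_real (\<phi> n x)) \<longlonglongrightarrow> h x * of_real (indicator {a<..<b} x)"
        by (intro AE_I2 tendsto_intros lim)
      show "AE x in leb l. norm (h x * of_real (\<phi> n x)) \<le> norm (h x)" for n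
        using p0 p1 by (intro AE_I2) (auto simp: norm_mult mult_left_le)
    qed
    then have "(LINT x|leb l. h x * of_real (indicator {a<..<b} x)) = 0"
      using 0[OF test] by (simp add: LIMSEQ_const_iff)
    moreover have "(LINT x|leb l. h x * of_real (indicator {a<..<b} x)) = integral {a<..<b} h"
    proof -
      have "(LINT x|leb l. h x * of_real (indicator {a<..<b} x)) =
            (LINT x|leb l. indicator {a<..<b} x *\<^sub>R h x)"
        by (intro Bochner_Integration.integral_cong) (auto simp: indicator_def)
      also have "\<dots> = (LINT x|lebesgue_on {a<..<b}. h x)"
        using ab by (subst (1 2) integral_restrict_space) (auto intro!: Bochner_Integration.integral_cong simp: indicator_def)
      also have "\<dots> = integral {a<..<b} h"
      proof (rule lebesgue_integral_eq_integral)
        show "integrable (lebesgue_on {a<..<b}) h"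
        proof -
          have "set_integrable lebesgue {0..l} h"
            using h by (simp add: set_integrable_def integrable_restrict_space)
          moreover have "{a<..<b} \<subseteq> {0..l}" using ab by auto
          ultimately have "set_integrable lebesgue {a<..<b} h"
            using set_integrable_subset[of lebesgue "{0..l}" h "{a<..<b}"] by auto
          then show ?thesis by (simp add: set_integrable_def integrable_restrict_space)
        qed
      qed auto
      finally show ?thesis .
    qed
    ultimately show ?thesis
      by (simp add: integral_open_interval_real)
  qed
  define f where "f = (\<lambda>x. if x \<in> {0..l} then h x else 0)"
  have "h integrable_on {0..l}" using integrable_on_lebesgue_on[OF h] by auto
  then have fi: "f integrable_on cbox a b" for a b
    unfolding f_def by (metis integrable_restrict_UNIV integrable_on_subcbox subset_UNIV)
  obtain N where N: "negligible N" and
    lim: "\<And>x e. \<lbrakk>x \<notin> N; 0 < e\<rbrakk> \<Longrightarrow> \<exists>d>0. \<forall>t. 0 < t \<and> t < d \<longrightarrow>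
        norm (integral (cbox x (x + t *\<^sub>R One)) f /\<^sub>R t ^ DIM(real) - f x) < e"
    using integrable_ccontinuous_explicit[OF fi] by metis
  have f0: "f x = 0" if x: "x \<notin> N" "0 < x" "x < l" for x
  proof (rule ccontr)
    assume "f x \<noteq> 0"
    then have "norm (f x) > 0" by simp
    from lim[OF x(1) this] obtain d where d: "d > 0" and
      dd: "\<And>t. 0 < t \<Longrightarrow> t < d \<Longrightarrow> norm (integral (cbox x (x + t *\<^sub>R One)) f /\<^sub>R t ^ DIM(real) - f x) < norm (f x)"
      by blast
    \<comment> \<open>Small enough for \<open>t < d\<close> and for \<open>{x..x + t}\<close> to
      stay where \<open>int0\<close> applies.\<close>
    define t where "t = min d (l - x) / 2"
    have t: "0 < t" "t < d" "x + t < l" using d x by (auto simp: t_def min_def field_simps)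
    have "integral {x..x + t} f = integral {x..x + t} h"
      by (rule integral_cong) (use x t in \<open>auto simp: f_def\<close>)
    also have "\<dots> = 0" using int0 x t by simp
    finally show False using dd[OF t(1,2)] by simp
  qed
  have "negligible (N \<union> {0, l})" using N by (simp add: negligible_Un)
  then have "AE x in lebesgue. x \<notin> N \<union> {0, l}"
    by (intro AE_not_in) (simp only: negligible_iff_null_sets)
  then show ?thesis
    unfolding AE_lebesgue_on_iff
  proof eventually_elim
    fix x assume "x \<notin> N \<union> {0, l}"
    then show "0 \<le> x \<and> x \<le> l \<longrightarrow> h x = 0" using f0[of x] by (auto simp: f_def)
  qed
qed

lemma has_weak_deriv_unique:
  assumes "has_weak_deriv l u g" "has_weak_deriv l u g'"
  shows "AE x in leb l. g x = g' x"
proof -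
  have "AE x in leb l. g x - g' x = 0"
  proof (rule AE_eq_0_if_orthogonal_to_tests)
    show "integrable (leb l) (\<lambda>x. g x - g' x)"
      using assms by (auto simp: has_weak_deriv_def)
    fix \<phi> assume t: "\<phi> \<in> test_functions l"
    have c: "continuous_on {0..l} \<phi>"
      using test_function_continuous[OF t] continuous_on_subset by blast
    then have "bounded (\<phi> ` {0..l})" by (intro compact_imp_bounded compact_continuous_image) auto
    then obtain B where B: "\<And>x. x \<in> {0..l} \<Longrightarrow> norm (\<phi> x) \<le> B"
      unfolding bounded_iff by blast
    have m: "\<phi> \<in> borel_measurable (leb l)"
      by (intro continuous_imp_measurable_on_sets_lebesgue c) auto
    have i: "integrable (leb l) (\<lambda>x. k x * of_real (\<phi> x))" 
      if "integrable (leb l) k" for k :: "real \<Rightarrow> complex"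
    proof (rule Bochner_Integration.integrable_bound[where f = "\<lambda>x. B * norm (k x)"])
      show "integrable (leb l) (\<lambda>x. B * norm (k x))" using that by simp
      show "(\<lambda>x. k x * of_real (\<phi> x)) \<in> borel_measurable (leb l)"
        using m that by measurable
      show "AE x in leb l. norm (k x * of_real (\<phi> x)) \<le> norm (B * norm (k x))"
      proof (rule AE_I2)
        fix x assume "x \<in> space (leb l)"
        then have "norm (\<phi> x) \<le> \<bar>B\<bar>" using B[of x] by auto
        then show "norm (k x * of_real (\<phi> x)) \<le> norm (B * norm (k x))"
          by (simp add: norm_mult abs_mult mult.commute mult_right_mono)
      qed
    qed
    show "(LINT x|leb l. (g x - g' x) * of_real (\<phi> x)) = 0"
      using assms t i by (simp add: has_weak_deriv_def left_diff_distrib Bochner_Integration.integral_diff)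
  qed
  then show ?thesis by eventually_elim simp
qed

lemma has_weak_deriv_weak_deriv:
  "has_weak_deriv l u g \<Longrightarrow> has_weak_deriv l u (weak_deriv l u)"
  unfolding weak_deriv_def by (rule someI[where P = "has_weak_deriv l u"])

lemma weak_deriv_AE:
  "has_weak_deriv l u g \<Longrightarrow> AE x in leb l. weak_deriv l u x = g x"
  by (rule has_weak_deriv_unique[OF has_weak_deriv_weak_deriv])

text \<open>Integration by parts; the boundary terms vanish because a test function is supported
  inside the open interval.\<close>

lemma has_weak_deriv_C1:
  fixes u :: "real \<Rightarrow> complex"
  assumes du: "continuous_on {0..l} du" and l: "l > 0"
    and u: "\<And>x. x \<in> {0..l} \<Longrightarrow> (u has_vector_derivative du x) (at x within {0..l})"
  shows "has_weak_deriv l u du"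
proof -
  have cu: "continuous_on {0..l} u"
    using u by (meson continuous_on_eq_continuous_within has_vector_derivative_continuous)
  have ci: "integrable (leb l) f" if "continuous_on {0..l} f" for f :: "real \<Rightarrow> complex"
    using that by (rule continuous_imp_integrable_real)
  have "(LINT x|leb l. u x * of_real (deriv \<phi> x)) = - (LINT x|leb l. du x * of_real (\<phi> x))"
    if t: "\<phi> \<in> test_functions l" for \<phi>
  proof -
    obtain D where D: "\<And>x. (\<phi> has_vector_derivative D x) (at x)" and cD: "continuous_on UNIV D"
      using t by (auto simp: test_functions_def C1_differentiable_on_def)
    have dD: "deriv \<phi> = D"
      using D by (auto intro!: DERIV_imp_deriv simp: has_real_derivative_iff_has_vector_derivative)
    have c: "continuous_on {0..l} \<phi>" "continuous_on {0..l} D"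
      using test_function_continuous[OF t] cD continuous_on_subset by blast+
    have z: "\<phi> 0 = 0" "\<phi> l = 0"
      using t closure_subset[of "{x. \<phi> x \<noteq> 0}"] by (force simp: test_functions_def)+
    have "((\<lambda>x. u x * of_real (D x) + du x * of_real (\<phi> x)) has_integral
        (u l * of_real (\<phi> l) - u 0 * of_real (\<phi> 0))) {0..l}"
    proof (rule fundamental_theorem_of_calculus)
      fix x assume x: "x \<in> {0..l}"
      have "((\<lambda>x. of_real (\<phi> x) :: complex) has_vector_derivative of_real (D x)) (at x within {0..l})"
        using has_vector_derivative_at_within[OF D]
        by (intro has_vector_derivative_of_real) (auto simp: has_real_derivative_iff_has_vector_derivative)
      from has_vector_derivative_mult[OF u[OF x] this]
      show "((\<lambda>x. u x * of_real (\<phi> x)) has_vector_derivative (u x * of_real (D x) + du x * of_real (\<phi> x))) (at x within {0..l})" .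
    qed (use l in simp)
    then have "integral {0..l} (\<lambda>x. u x * of_real (D x) + du x * of_real (\<phi> x)) = 0"
      using z by (simp add: integral_unique)
    moreover have "integral {0..l} (\<lambda>x. u x * of_real (D x) + du x * of_real (\<phi> x)) =
        (LINT x|leb l. u x * of_real (D x) + du x * of_real (\<phi> x))"
      by (intro lebesgue_integral_eq_integral[symmetric] ci continuous_intros cu c du) auto
    moreover have "(LINT x|leb l. u x * of_real (D x) + du x * of_real (\<phi> x)) =
       (LINT x|leb l. u x * of_real (D x)) + (LINT x|leb l. du x * of_real (\<phi> x))"
      by (intro Bochner_Integration.integral_add ci continuous_intros cu c du)
    ultimately show ?thesis by (simp add: dD eq_neg_iff_add_eq_0)
  qed
  then show ?thesis using ci[OF cu] ci[OF du] by (simp add: has_weak_deriv_def)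
qed


section \<open>Upper and lower estimates of L^p norms\<close>

lemma ereal_ge_1_cases:
  fixes p :: ereal
  assumes "1 \<le> p"
  obtains "p = \<infinity>" | r where "p = ereal r" "r \<ge> 1"
  using assms by (cases p) (auto simp: one_ereal_def)

lemma Lp_norm_AE_cong:
  assumes "f \<in> borel_measurable (leb l)" "g \<in> borel_measurable (leb l)"
    and "AE x in leb l. f x = g x"
  shows "Lp_norm l p f = Lp_norm l p g"
proof -
  have "esssup (leb l) (\<lambda>x. ereal (cmod (f x))) = esssup (leb l) (\<lambda>x. ereal (cmod (g x)))"
    by (rule esssup_AE_cong) (use assms in \<open>measurable, auto\<close>)
  moreover have "(LINT x|leb l. cmod (f x) powr real_of_ereal p) = (LINT x|leb l. cmod (g x) powr real_of_ereal p)"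
    by (rule integral_cong_AE) (use assms in \<open>measurable, auto\<close>)
  ultimately show ?thesis by (simp add: Lp_norm_def)
qed

lemma Lp_space_AE_cong:
  assumes f: "f \<in> Lp_space l p" and g: "g \<in> borel_measurable (leb l)"
    and eq: "AE x in leb l. f x = g x"
  shows "g \<in> Lp_space l p"
proof -
  have fm: "f \<in> borel_measurable (leb l)" using f by (auto simp: Lp_space_def)
  have "esssup (leb l) (\<lambda>x. ereal (cmod (f x))) = esssup (leb l) (\<lambda>x. ereal (cmod (g x)))"
    by (rule esssup_AE_cong) (use g fm eq in \<open>measurable, auto\<close>)
  moreover have "integrable (leb l) (\<lambda>x. cmod (f x) powr real_of_ereal p) = integrable (leb l) (\<lambda>x. cmod (g x) powr real_of_ereal p)"
    by (rule integrable_cong_AE) (use g fm eq in \<open>measurable, auto\<close>)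
  ultimately show ?thesis using f g by (auto simp: Lp_space_def)
qed

lemma weak_deriv_in_Lp:
  assumes "u \<in> W1p_space l p"
  shows "weak_deriv l u \<in> Lp_space l p"
proof -
  obtain g where g: "g \<in> Lp_space l p" "has_weak_deriv l u g" using assms by (auto simp: W1p_space_def)
  have "weak_deriv l u \<in> borel_measurable (leb l)"
    using has_weak_deriv_weak_deriv[OF g(2)] by (auto simp: has_weak_deriv_def)
  with g(1) show ?thesis
    by (rule Lp_space_AE_cong) (use weak_deriv_AE[OF g(2)] in auto)
qed

lemma Lp_norm_nonneg: 
  assumes "l > 0"
  shows "Lp_norm l p f \<ge> 0"
proof -
  have "0 \<le> esssup (leb l) (\<lambda>x. ereal (cmod (f x)))"
  proof -
    have "emeasure (leb l) (space (leb l)) \<noteq> 0"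
      using assms by (simp add: emeasure_restrict_space)
    from esssup_const[OF this, of 0]
    have "0 = esssup (leb l) (\<lambda>x. 0 :: ereal)" by simp
    also have "\<dots> \<le> esssup (leb l) (\<lambda>x. ereal (cmod (f x)))"
      by (rule esssup_mono) auto
    finally show ?thesis .
  qed
  then show ?thesis by (simp add: Lp_norm_def real_of_ereal_pos)
qed

text \<open>The L^p norm of the constant \<open>M\<close> on an interval of length
  \<open>l\<close>.\<close>

definition Lp_upper :: "real \<Rightarrow> ereal \<Rightarrow> real \<Rightarrow> real" where
  "Lp_upper l p M = (if p = \<infinity> then M else (l * M powr real_of_ereal p) powr (1 / real_of_ereal p))"

lemma bounded_in_Lp:
  assumes p: "1 \<le> p" and l: "l > 0" and f: "f \<in> borel_measurable (leb l)"
    and M: "\<And>x. x \<in> {0..l} \<Longrightarrow> cmod (f x) \<le> M"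
  shows "f \<in> Lp_space l p" "Lp_norm l p f \<le> Lp_upper l p M"
proof -
  have M0: "M \<ge> 0" using order_trans[OF norm_ge_zero M[of 0]] l by simp
  have es: "esssup (leb l) (\<lambda>x. ereal (cmod (f x))) \<le> ereal M"
    by (rule esssup_I) (use f M in \<open>auto intro!: AE_I2\<close>)
  have int: "integrable (leb l) (\<lambda>x. cmod (f x) powr r)" if "r \<ge> 1" for r
  proof (rule Bochner_Integration.integrable_bound[where f = "\<lambda>x. M powr r"])
    show "integrable (leb l) (\<lambda>x. M powr r)"
      by (rule continuous_imp_integrable_real) auto
    show "(\<lambda>x. cmod (f x) powr r) \<in> borel_measurable (leb l)" using f by measurable
    show "AE x in leb l. norm (cmod (f x) powr r) \<le> norm (M powr r)"
      using M that by (intro AE_I2) (auto intro!: powr_mono2)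
  qed
  have le: "(LINT x|leb l. cmod (f x) powr r) \<le> l * M powr r" if "r \<ge> 1" for r
  proof -
    have "(LINT x|leb l. cmod (f x) powr r) \<le> (LINT x|leb l. M powr r)"
    proof (rule integral_mono[OF int[OF that]])
      show "integrable (leb l) (\<lambda>x. M powr r)"
        by (rule continuous_imp_integrable_real) auto
    qed (use M that in \<open>auto intro!: powr_mono2\<close>)
    also have "\<dots> = l * M powr r" using l by (simp add: measure_restrict_space)
    finally show ?thesis .
  qed
  show "f \<in> Lp_space l p"
    using p int es f by (cases rule: ereal_ge_1_cases) (auto simp: Lp_space_def)
  show "Lp_norm l p f \<le> Lp_upper l p M"
    using p
  proof (cases rule: ereal_ge_1_cases)
    case 1
    have "real_of_ereal (esssup (leb l) (\<lambda>x. ereal (cmod (f x)))) \<le> M"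
      using es M0 by (cases "esssup (leb l) (\<lambda>x. ereal (cmod (f x)))") auto
    then show ?thesis using 1 by (simp add: Lp_norm_def Lp_upper_def)
  next
    case (2 r)
    then show ?thesis using le[of r]
      by (simp add: Lp_norm_def Lp_upper_def) (intro powr_mono2, auto)
  qed
qed

text \<open>For finite \<open>p\<close>, the L^p norm of the constant \<open>\<alpha>\<close> on
  half of the interval.\<close>

definition Lp_lower :: "real \<Rightarrow> ereal \<Rightarrow> real \<Rightarrow> real" where
  "Lp_lower l p \<alpha> = (if p = \<infinity> then \<alpha> else (\<alpha> powr real_of_ereal p * l / 2) powr (1 / real_of_ereal p))"

text \<open>The mean of \<open>cmod (f x)\<close> exceeds \<alpha> by half of \<alpha>. For infinite
  \<open>p\<close> this keeps the essential supremum from falling below \<alpha>; for a finite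
  exponent the excess must come from the power of \<open>f\<close>, by the pointwise bound
  \<open>pt\<close>, which takes the place of Hoelder's inequality.\<close>

lemma Lp_norm_lower:
  assumes p: "1 \<le> p" and l: "l > 0" and f: "f \<in> Lp_space l p" and f1: "integrable (leb l) f"
    and \<alpha>: "\<alpha> > 0" and I: "(LINT x|leb l. cmod (f x)) \<ge> 3 / 2 * \<alpha> * l"
  shows "Lp_norm l p f \<ge> Lp_lower l p \<alpha>"
  using p
proof (cases rule: ereal_ge_1_cases)
  case 1
  let ?e = "esssup (leb l) (\<lambda>x. ereal (cmod (f x)))"
  have "?e < \<infinity>" using f 1 by (auto simp: Lp_space_def)
  have "?e \<ge> ereal \<alpha>"
  proof (rule ccontr)
    assume "\<not> ?e \<ge> ereal \<alpha>"
    then have "?e \<le> ereal \<alpha>" by simp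
    with esssup_AE[of "\<lambda>x. ereal (cmod (f x))" "leb l"]
    have "AE x in leb l. cmod (f x) \<le> \<alpha>"
      by (auto elim!: eventually_mono dest: order_trans)
    moreover have "integrable (leb l) (\<lambda>x. \<alpha>)"
      by (rule continuous_imp_integrable_real) auto
    ultimately have "(LINT x|leb l. cmod (f x)) \<le> (LINT x|leb l. \<alpha>)"
      using f1 by (intro integral_mono_AE) auto
    also have "\<dots> = \<alpha> * l" using l by (simp add: measure_restrict_space)
    finally have "3 / 2 * \<alpha> * l \<le> \<alpha> * l" using I by simp
    moreover have "\<alpha> * l > 0" using \<alpha> l by simp
    ultimately show False by (simp add: mult.assoc)
  qed
  with \<open>?e < \<infinity>\<close> show ?thesis
    using 1 by (cases ?e) (auto simp: Lp_norm_def Lp_lower_def)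
next
  case (2 r)
  have int: "integrable (leb l) (\<lambda>x. cmod (f x) powr r)"
    using f 2 by (auto simp: Lp_space_def)
  have pt: "y \<le> \<alpha> + \<alpha> powr (1 - r) * y powr r" if "y \<ge> 0" for y :: real
  proof (cases "y \<le> \<alpha>")
    case True
    then show ?thesis by (simp add: add_increasing2)
  next
    case False
    then have "\<alpha> powr (1 - r) * y powr r = (y / \<alpha>) powr (r - 1) * y"
      using \<alpha> by (simp add: powr_divide powr_diff powr_one field_simps)
    moreover have "(y / \<alpha>) powr (r - 1) \<ge> 1"
      using False \<alpha> 2 by (intro ge_one_powr_ge_zero) auto
    ultimately have "\<alpha> powr (1 - r) * y powr r \<ge> 1 * y"
      using that by (metis mult_right_mono)
    then show ?thesis using \<alpha> by simp
  qed
  have ic: "integrable (leb l) (\<lambda>x. \<alpha>)"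
    by (rule continuous_imp_integrable_real) auto
  have "(LINT x|leb l. cmod (f x)) \<le> (LINT x|leb l. \<alpha> + \<alpha> powr (1 - r) * cmod (f x) powr r)"
    using int f1 ic by (intro integral_mono) (auto intro: pt)
  also have "\<dots> = \<alpha> * l + \<alpha> powr (1 - r) * (LINT x|leb l. cmod (f x) powr r)"
    using int ic l by (subst Bochner_Integration.integral_add) (auto simp: measure_restrict_space)
  finally have "\<alpha> powr (1 - r) * (LINT x|leb l. cmod (f x) powr r) \<ge> \<alpha> * l / 2"
    using I by simp
  then have "\<alpha> powr (r - 1) * (\<alpha> powr (1 - r) * (LINT x|leb l. cmod (f x) powr r)) \<ge> \<alpha> powr (r - 1) * (\<alpha> * l / 2)"
    by (intro mult_left_mono) auto
  moreover have "\<alpha> powr (r - 1) * (\<alpha> powr (1 - r) * X) = X" for X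
    using \<alpha> by (simp add: powr_diff)
  moreover have "\<alpha> powr (r - 1) * (\<alpha> * l / 2) = \<alpha> powr r * l / 2"
    using \<alpha> by (simp add: powr_diff)
  ultimately have "\<alpha> powr r * l / 2 \<le> (LINT x|leb l. cmod (f x) powr r)" by metis
  then show ?thesis
    using 2 \<alpha> l by (simp add: Lp_norm_def Lp_lower_def) (intro powr_mono2, auto)
qed

lemma Lp_lower_pos: "\<alpha> > 0 \<Longrightarrow> l > 0 \<Longrightarrow> Lp_lower l p \<alpha> > 0"
  by (simp add: Lp_lower_def)

section \<open>Trajectories and the waves they generate\<close>

lemma AE_lebesgue_reflect:
  fixes c :: real
  assumes "AE x in lebesgue. P x"
  shows "AE x in lebesgue. P (c - x)"
proof -
  obtain N where N: "{x. \<not> P x} \<subseteq> N" "N \<in> null_sets lebesgue"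
    using assms by (auto simp: eventually_ae_filter)
  have "negligible N" using N(2) by (simp add: negligible_iff_null_sets)
  then have "negligible ((\<lambda>x. c - x) ` N)"
    by (intro negligible_differentiable_image_negligible) (auto intro!: derivative_intros simp: differentiable_on_def)
  then have "(\<lambda>x. c - x) ` N \<in> null_sets lebesgue" by (simp add: negligible_iff_null_sets)
  moreover have "{x. \<not> P (c - x)} \<subseteq> (\<lambda>x. c - x) ` N"
  proof
    fix x assume "x \<in> {x. \<not> P (c - x)}"
    then have "c - x \<in> N" using N(1) by auto
    then show "x \<in> (\<lambda>x. c - x) ` N" by (intro image_eqI[where x = "c - x"]) auto
  qed
  ultimately show ?thesis by (auto simp: eventually_ae_filter)
qed

lemma continuous_antiderivative:
  fixes f :: "real \<Rightarrow> real"
  assumes "continuous_on UNIV f"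
  obtains F where "\<And>x. (F has_real_derivative f x) (at x)"
proof -
  have "\<exists>F. \<forall>x. -\<infinity> < ereal x \<longrightarrow> ereal x < \<infinity> \<longrightarrow> (F has_vector_derivative f x) (at x)"
    using assms by (intro einterval_antiderivative) (auto simp: continuous_on_eq_continuous_at)
  then show ?thesis using that by (auto simp: has_real_derivative_iff_has_vector_derivative)
qed

lemma integral_eq_diff:
  fixes F :: "real \<Rightarrow> real"
  assumes "a \<le> b" "\<And>x. (F has_real_derivative f x) (at x)"
  shows "integral {a..b} f = F b - F a"
  using assms by (intro integral_unique fundamental_theorem_of_calculus)
    (auto simp: has_real_derivative_iff_has_vector_derivative intro: has_vector_derivative_at_within)

context wave_net
begin

lemma scatter_cong:
  "(\<And>k. k \<in> components \<Longrightarrow> x k = y k) \<Longrightarrow> scatter a i x = scatter a i y"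
  unfolding scatter_def by (intro sum.cong) auto

lemma tlen_pos: "i \<in> components \<Longrightarrow> tlen G i > 0"
  using ix_surj tlen_ix(2) edges_atD(8) by metis

lemma min_tlen:
  obtains \<delta> where "\<delta> > 0" "\<And>i. i \<in> components \<Longrightarrow> \<delta> \<le> tlen G i"
proof -
  let ?A = "insert 1 (tlen G ` components)"
  have "finite ?A" by simp
  then have "Min ?A > 0" using tlen_pos by (subst Min_gr_iff) auto
  moreover have "Min ?A \<le> tlen G i" if "i \<in> components" for i
    by (rule Min_le) (use that in auto)
  ultimately show ?thesis by (rule that)
qed

text \<open>Method of steps: a wave needs at least the time \<delta> to cross an edge, so the values
  up to \<open>n * \<delta>\<close> determine those up to \<open>(n + 1) * \<delta>\<close>. The
  compatibility condition makes the extension continuous at 0.\<close>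

lemma trajectory_exists:
  fixes I :: "nat \<Rightarrow> real \<Rightarrow> real"
  assumes cont: "\<And>i. i \<in> components \<Longrightarrow> continuous_on UNIV (I i)"
    and compat: "\<And>i. i \<in> components \<Longrightarrow> I i 0 = scatter a i (\<lambda>k. I k (- tlen G k))"
  obtains g where "\<And>i. i \<in> components \<Longrightarrow> continuous_on UNIV (g i)"
    "\<And>i t. i \<in> components \<Longrightarrow> t \<le> 0 \<Longrightarrow> g i t = I i t"
    "\<And>i t. i \<in> components \<Longrightarrow> t \<ge> 0 \<Longrightarrow> g i t = scatter a i (\<lambda>k. g k (t - tlen G k))"
proof -
  let ?R = "components"
  obtain \<delta> where \<delta>: "\<delta> > 0" "\<And>i. i \<in> ?R \<Longrightarrow> \<delta> \<le> tlen G i" using min_tlen by metis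
  \<comment> \<open>\<open>W n\<close> is the solution up to time \<open>n * \<delta>\<close> and
    not necessarily later; \<open>g\<close> reads each time off a stage that has already become
    stable there.\<close>
  define W where "W = rec_nat I (\<lambda>n w i t. if t \<le> 0 then I i t else scatter a i (\<lambda>k. w k (t - tlen G k)))"
  have W0: "W 0 = I" by (simp add: W_def)
  have WS: "W (Suc n) i t = (if t \<le> 0 then I i t else scatter a i (\<lambda>k. W n k (t - tlen G k)))" for n i t
    by (simp add: W_def)
  have Wneg: "W n i t = I i t" if "t \<le> 0" for n i t
    using that by (cases n) (auto simp: W0 WS)
  have Wcont: "continuous_on UNIV (W n i)" if "i \<in> ?R" for n i
    using that
  proof (induction n arbitrary: i)
    case 0
    then show ?case using cont by (simp add: W0)
  next
    case (Suc n)
    have "continuous_on UNIV (\<lambda>t. if t \<le> 0 then I i t else scatter a i (\<lambda>k. W n k (t - tlen G k)))"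
    proof (rule continuous_on_cases_le)
      show "continuous_on {t \<in> UNIV. t \<le> 0} (I i)"
        using cont[OF Suc.prems] continuous_on_subset by blast
      show "continuous_on {t \<in> UNIV. 0 \<le> t} (\<lambda>t. scatter a i (\<lambda>k. W n k (t - tlen G k)))"
        unfolding scatter_def
        by (intro continuous_intros continuous_on_compose2[OF Suc.IH]) auto
      fix t :: real assume "t = 0"
      then show "I i t = scatter a i (\<lambda>k. W n k (t - tlen G k))"
        using compat[OF Suc.prems] tlen_pos by (auto intro!: scatter_cong simp: Wneg order_less_imp_le)
    qed (auto intro: continuous_intros)
    then show ?case by (simp add: WS[abs_def])
  qed
  have step: "W (Suc n) i t = W n i t" if "i \<in> ?R" "t \<le> real n * \<delta>" for n i t
    using that
  proof (induction n arbitrary: i t)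
    case 0
    then show ?case by (simp add: Wneg)
  next
    case (Suc n)
    show ?case
    proof (cases "t \<le> 0")
      case False
      have "W (Suc n) k (t - tlen G k) = W n k (t - tlen G k)" if "k \<in> ?R" for k
        using Suc.prems \<delta>(2)[OF that] that by (intro Suc.IH) (auto simp: algebra_simps)
      then have "scatter a i (\<lambda>k. W (Suc n) k (t - tlen G k)) = scatter a i (\<lambda>k. W n k (t - tlen G k))"
        by (rule scatter_cong)
      then show ?thesis using False unfolding WS[of "Suc n"] WS[of n] by simp
    qed (simp add: Wneg)
  qed
  have stab: "W m i t = W n i t" if "i \<in> ?R" "t \<le> real n * \<delta>" "n \<le> m" for m n i t
    using that(3)
  proof (induction rule: dec_induct)
    case (step k)
    have "t \<le> real k * \<delta>" using that(2) step.hyps \<delta>(1) by (meson mult_right_mono of_nat_mono order_trans order_less_imp_le)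
    with \<open>\<And>n i t. i \<in> ?R \<Longrightarrow> t \<le> real n * \<delta> \<Longrightarrow> W (Suc n) i t = W n i t\<close> that(1) step show ?case by simp
  qed simp
  define g where "g = (\<lambda>i t. W (nat \<lceil>t / \<delta>\<rceil>) i t)"
  have gW: "g i t = W n i t" if "i \<in> ?R" "t \<le> real n * \<delta>" for i n t
  proof -
    have "t / \<delta> \<le> real (nat \<lceil>t / \<delta>\<rceil>)" by linarith
    then have "t \<le> real (nat \<lceil>t / \<delta>\<rceil>) * \<delta>" using \<delta>(1) by (simp add: field_simps)
    moreover have "t / \<delta> \<le> real n" using that \<delta>(1) by (simp add: field_simps)
    then have "nat \<lceil>t / \<delta>\<rceil> \<le> n" by (simp add: ceiling_le_iff nat_le_iff)
    ultimately show ?thesis unfolding g_def using stab[OF that(1)] by metis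
  qed
  show ?thesis
  proof (rule that[of g])
    fix i assume i: "i \<in> ?R"
    show "g i t = I i t" if "t \<le> 0" for t
      using gW[OF i, of t 0] that by (simp add: W0)
    show "continuous_on UNIV (g i)"
      unfolding continuous_on_eq_continuous_at[OF open_UNIV]
    proof
      fix t :: real
      obtain n where n: "t / \<delta> < real n" using reals_Archimedean2 by blast
      then have "t < real n * \<delta>" using \<delta>(1) by (simp add: field_simps)
      then have "\<forall>\<^sub>F s in nhds t. s < real n * \<delta>"
        using eventually_nhds_in_open[of "{..<real n * \<delta>}" t] by simp
      then have "\<forall>\<^sub>F s in nhds t. g i s = W n i s"
        by eventually_elim (simp add: gW[OF i])
      moreover have "isCont (W n i) t" using Wcont[OF i] continuous_on_eq_continuous_at by blast
      ultimately show "isCont (g i) t" by (simp add: isCont_cong)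
    qed
    show "g i t = scatter a i (\<lambda>k. g k (t - tlen G k))" if "t \<ge> 0" for t
    proof (cases "t = 0")
      case True
      have "g i 0 = I i 0" using gW[OF i, of 0 0] by (simp add: W0)
      also have "\<dots> = scatter a i (\<lambda>k. g k (0 - tlen G k))"
        unfolding compat[OF i]
        by (rule scatter_cong) (use gW[of _ "- tlen G _" 0] tlen_pos in \<open>auto simp: W0 order_less_imp_le\<close>)
      finally show ?thesis using True by simp
    next
      case False
      obtain n where n: "t / \<delta> < real n" using reals_Archimedean2 by blast
      then have n: "t \<le> real n * \<delta>" using \<delta>(1) by (simp add: field_simps)
      have "g i t = W (Suc n) i t" by (rule gW[OF i]) (use n \<delta>(1) in \<open>simp add: algebra_simps\<close>)
      also have "\<dots> = scatter a i (\<lambda>k. W n k (t - tlen G k))" using False that by (simp add: WS)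
      also have "\<dots> = scatter a i (\<lambda>k. g k (t - tlen G k))"
      proof (rule scatter_cong, rule gW[symmetric])
        show "t - tlen G k \<le> real n * \<delta>" if "k \<in> ?R" for k
          using n tlen_pos[OF that] by linarith
      qed
      finally show ?thesis .
    qed
  qed
qed


text \<open>\<open>A\<close> and \<open>B\<close> are the two waves on an edge. On the left is the
  displacement at the far end, found by integrating the velocity at the near end over time and then
  the slope along the edge; on the right is the time integral of the far-end velocity. They agree
  because the zero means make the initial displacement vanish at the far end too.\<close>

lemma end_value_integral:
  fixes A B :: "real \<Rightarrow> real"
  assumes A: "continuous_on UNIV A" and B: "continuous_on UNIV B" and l: "l > 0" and t: "t \<ge> 0"
    and zA: "integral {-l..0} A = 0" and zB: "integral {-l..0} B = 0"
  shows "integral {0..t} (\<lambda>\<tau>. (A (\<tau> - l) - B \<tau>) / 2) + integral {0..l} (\<lambda>y. (A (t - l + y) + B (t - y)) / 2)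
     = integral {0..t} (\<lambda>\<tau>. (A \<tau> - B (\<tau> - l)) / 2)"
proof -
  obtain FA where FA: "\<And>x. (FA has_real_derivative A x) (at x)" using continuous_antiderivative[OF A] by metis
  obtain FB where FB: "\<And>x. (FB has_real_derivative B x) (at x)" using continuous_antiderivative[OF B] by metis
  have sh: "((\<lambda>x. F (x + c)) has_real_derivative f (x + c)) (at x)" 
    if "\<And>x. (F has_real_derivative f x) (at x)" for F f :: "real \<Rightarrow> real" and c x
    using that[of "x + c"] by (simp add: DERIV_shift)
  have rf: "((\<lambda>x. - F (c - x)) has_real_derivative f (c - x)) (at x)" 
    if "\<And>x. (F has_real_derivative f x) (at x)" for F f :: "real \<Rightarrow> real" and c x
    by (auto intro!: derivative_eq_intros DERIV_chain'[OF _ that])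
  have shm: "((\<lambda>x. F (x - c)) has_real_derivative f (x - c)) (at x)" 
    if "\<And>x. (F has_real_derivative f x) (at x)" for F f :: "real \<Rightarrow> real" and c x
    using sh[OF that, of "- c"] by simp
  have 1: "integral {0..t} (\<lambda>\<tau>. (A (\<tau> - l) - B \<tau>) / 2) = (FA (t - l) - FB t) / 2 - (FA (0 - l) - FB 0) / 2"
    by (rule integral_eq_diff[OF t]) (intro DERIV_cdivide DERIV_diff shm FA FB)
  have 2: "integral {0..t} (\<lambda>\<tau>. (A \<tau> - B (\<tau> - l)) / 2) = (FA t - FB (t - l)) / 2 - (FA 0 - FB (0 - l)) / 2"
    by (rule integral_eq_diff[OF t]) (intro DERIV_cdivide DERIV_diff shm FA FB)
  have "((\<lambda>y. (FA (y + (t - l)) + - FB (t - y)) / 2) has_real_derivative (A (y + (t - l)) + B (t - y)) / 2) (at y)" for y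
    by (intro DERIV_cdivide DERIV_add sh rf FA FB)
  then have 3: "integral {0..l} (\<lambda>y. (A (t - l + y) + B (t - y)) / 2) = (FA t - FB (t - l)) / 2 - (FA (t - l) - FB t) / 2"
    using l by (subst integral_eq_diff[where F = "\<lambda>y. (FA (y + (t - l)) + - FB (t - y)) / 2"]) (auto simp: algebra_simps)
  have "FA 0 - FA (- l) = 0" "FB 0 - FB (- l) = 0"
    using zA zB integral_eq_diff[OF _ FA, of "-l" 0] integral_eq_diff[OF _ FB, of "-l" 0] l by auto
  then show ?thesis unfolding 1 2 3 by (simp add: field_simps)
qed

text \<open>The d'Alembert formulas return slope and velocity, and integration returns the
  displacement. The zero means let every displacement start from 0 at all vertices, so that
  continuity and the Dirichlet condition reduce to statements about end velocities, and those follow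
  from the scattering law.\<close>

lemma wave_from_trajectory:
  fixes g :: "nat \<Rightarrow> real \<Rightarrow> real"
  assumes p: "1 \<le> p"
    and cont: "\<And>i. i \<in> components \<Longrightarrow> continuous_on UNIV (g i)"
    and law: "\<And>i t. i \<in> components \<Longrightarrow> t \<ge> 0 \<Longrightarrow> g i t = scatter a i (\<lambda>k. g k (t - tlen G k))"
    and mean: "\<And>i. i \<in> components \<Longrightarrow> integral {- tlen G i..0} (g i) = 0"
  obtains U where "wave_solution G p (\<lambda>t. a) (U 0) U"
    "\<And>t j. t \<ge> 0 \<Longrightarrow> j \<in> edges \<Longrightarrow> has_weak_deriv (len G j) (fst (U t) j)
        (\<lambda>x. of_real ((g (2 * j - 1) (t - len G j + x) + g (2 * j) (t - x)) / 2))"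
    "\<And>t j. snd (U t) j = (\<lambda>x. of_real ((g (2 * j - 1) (t - len G j + x) - g (2 * j) (t - x)) / 2))"
proof -
  let ?R = "components"
  define du where "du = (\<lambda>t j x. (g (2 * j - 1) (t - len G j + x) + g (2 * j) (t - x)) / 2)"
  define v where "v = (\<lambda>t j x. (g (2 * j - 1) (t - len G j + x) - g (2 * j) (t - x)) / 2)"
  define u where "u = (\<lambda>t j x. integral {0..t} (\<lambda>\<tau>. v \<tau> j 0) + integral {0..x} (du t j))"
  define U where "U = (\<lambda>t. ((\<lambda>j x. complex_of_real (u t j x)), (\<lambda>j x. complex_of_real (v t j x))))"
  have jR: "2 * j - 1 \<in> ?R" "2 * j \<in> ?R" if "j \<in> edges" for j using that by auto
  have lpos: "len G j > 0" if "j \<in> edges" for j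
    using network that by (auto simp: is_network_def)
  have c: "continuous_on S (\<lambda>x. g (2 * j - 1) (h x))" "continuous_on S (\<lambda>x. g (2 * j) (h x))"
    if "j \<in> edges" "continuous_on S h" for j S and h :: "real \<Rightarrow> real"
    using continuous_on_compose2[OF cont[OF jR(1)[OF that(1)]] that(2)]
      continuous_on_compose2[OF cont[OF jR(2)[OF that(1)]] that(2)] by auto
  have cdu: "continuous_on S (du t j)" and cv: "continuous_on S (v t j)" if "j \<in> edges" for j t S
    unfolding du_def v_def using that by (auto intro!: continuous_intros c simp del: One_nat_def)
  have wd: "has_weak_deriv (len G j) (\<lambda>x. complex_of_real (u t j x)) (\<lambda>x. of_real (du t j x))"
    and cu: "continuous_on {0..len G j} (\<lambda>x. complex_of_real (u t j x))"
    if j: "j \<in> edges" for j t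
  proof -
    have d: "((\<lambda>x. complex_of_real (u t j x)) has_vector_derivative of_real (du t j x)) (at x within {0..len G j})"
      if "x \<in> {0..len G j}" for x
    proof (rule has_vector_derivative_of_real)
      have "((\<lambda>x. integral {0..x} (du t j)) has_vector_derivative du t j x) (at x within {0..len G j})"
        by (rule integral_has_vector_derivative[OF cdu[OF j] that])
      then show "(u t j has_real_derivative du t j x) (at x within {0..len G j})"
        unfolding u_def has_real_derivative_iff_has_vector_derivative
        by (auto intro!: derivative_eq_intros)
    qed
    show "has_weak_deriv (len G j) (\<lambda>x. complex_of_real (u t j x)) (\<lambda>x. of_real (du t j x))"
      by (rule has_weak_deriv_C1[OF _ lpos[OF j] d]) (auto intro!: continuous_intros cdu[OF j])
    show "continuous_on {0..len G j} (\<lambda>x. complex_of_real (u t j x))"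
      using d by (meson continuous_on_eq_continuous_within has_vector_derivative_continuous)
  qed
  have Lp: "f \<in> Lp_space l p" if f: "continuous_on {0..l} f" and l: "l > 0" for f l
  proof -
    have "bounded (f ` {0..l})" using f by (intro compact_imp_bounded compact_continuous_image) auto
    then obtain M where "\<And>x. x \<in> {0..l} \<Longrightarrow> cmod (f x) \<le> M" unfolding bounded_iff by blast
    then show ?thesis using p l
      by (intro bounded_in_Lp(1)[where M = M] continuous_imp_measurable_on_sets_lebesgue f) auto
  qed
  \<comment> \<open>The velocity at the end \<open>q\<close> of edge \<open>j\<close>, expressed by
    the leaving and the arriving wave.\<close>
  define vend where "vend = (\<lambda>q j \<tau>. end_sign G q j * (g (out_ix G q j) \<tau> - g (in_ix G q j) (\<tau> - len G j)) / 2)"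
  have ev: "end_val G j (\<lambda>x. complex_of_real (u t j x)) q = of_real (integral {0..t} (vend q j))"
    if j: "j \<in> edges_at G q" and t: "t \<ge> 0" for q j t
  proof (cases "q = src G j")
    case True
    have "vend q j \<tau> = v \<tau> j 0" for \<tau>
      using True edges_atD[OF j] by (auto simp: vend_def v_def end_sign_def out_ix_def in_ix_def field_simps)
    then have "vend q j = (\<lambda>\<tau>. v \<tau> j 0)" by auto
    then show ?thesis using True by (simp add: end_val_def u_def)
  next
    case False
    then have q: "q = tgt G j" using edges_atD(3)[OF j] by simp
    have jj: "j \<in> edges" using j by (auto simp: edges_at_def)
    have tl: "tlen G (2 * j - 1) = len G j" "tlen G (2 * j) = len G j"
      using jj by (auto simp: tlen_def)
    have "vend q j = (\<lambda>\<tau>. (g (2 * j - 1) \<tau> - g (2 * j) (\<tau> - len G j)) / 2)"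
      using q edges_atD(4)[OF j] by (auto simp: vend_def end_sign_def out_ix_def in_ix_def)
    then have "integral {0..t} (vend q j) = u t j (len G j)"
      unfolding u_def du_def v_def
      using end_value_integral[OF cont[OF jR(1)[OF jj]] cont[OF jR(2)[OF jj]] lpos[OF jj] t]
        mean[OF jR(1)[OF jj]] mean[OF jR(2)[OF jj]] tl by simp
    then show ?thesis using False by (simp add: end_val_def)
  qed
  have vend_eq: "vend q j \<tau> = vend q k \<tau>" if j: "j \<in> edges_at G q" and k: "k \<in> edges_at G q" and \<tau>: "\<tau> \<ge> 0" for q j k \<tau>
  proof (cases "q \<in> int_verts G")
    case True
    \<comment> \<open>The arriving wave of \<open>j\<close> itself cancels in \<open>vend\<close>;
      what remains depends on the vertex only.\<close>
    have "vend q j \<tau> = - (1 / real (vdegree G q)) * (\<Sum>l\<in>edges_at G q. end_sign G q l * g (in_ix G q l) (\<tau> - len G l))"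
      if j: "j \<in> edges_at G q" for j
    proof -
      have "(\<Sum>l\<in>edges_at G q. end_sign G q l *\<^sub>R g (in_ix G q l) (\<tau> - tlen G (in_ix G q l))) =
         (\<Sum>l\<in>edges_at G q. end_sign G q l * g (in_ix G q l) (\<tau> - len G l))"
        by (intro sum.cong) auto
      then show ?thesis
        unfolding vend_def law[OF ix_range(2)[OF j] \<tau>] scatter_out[OF j]
        using True tlen_ix(1)[OF j] by (simp add: field_simps)
    qed
    then show ?thesis using j k by simp
  next
    case False
    then show ?thesis using edges_at_not_int[OF False j] k by simp
  qed
  have vend_0: "vend q j \<tau> = 0" if j: "j \<in> edges_at G q" and q: "q \<in> undamped G" and \<tau>: "\<tau> \<ge> 0" for q j \<tau>
    unfolding vend_def law[OF ix_range(2)[OF j] \<tau>] scatter_out[OF j]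
    using undamped_not_int[OF q] q tlen_ix(1)[OF j] by (simp add: refl_coeff_def)
  have space: "U t \<in> wave_space G p" if t: "t \<ge> 0" for t
  proof -
    have "(\<lambda>j x. complex_of_real (u t j x)) \<in> W1p0 G p"
      unfolding W1p0_def mem_Collect_eq
    proof (intro conjI ballI)
      fix j assume j: "j \<in> edges"
      have "(\<lambda>x. complex_of_real (du t j x)) \<in> Lp_space (len G j) p"
        by (intro Lp lpos j continuous_intros cdu)
      then show "(\<lambda>x. complex_of_real (u t j x)) \<in> W1p_space (len G j) p"
        unfolding W1p_space_def using cu[OF j] wd[OF j] Lp[OF cu[OF j] lpos[OF j]] by blast
    next
      fix q j k assume "q \<in> verts G" "j \<in> edges_at G q" "k \<in> edges_at G q"
      moreover from this have "integral {0..t} (vend q j) = integral {0..t} (vend q k)"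
        by (intro integral_cong vend_eq) auto
      ultimately show "end_val G j (\<lambda>x. complex_of_real (u t j x)) q = end_val G k (\<lambda>x. complex_of_real (u t k x)) q"
        using ev t by simp
    next
      fix q j assume qj: "q \<in> undamped G" "j \<in> edges_at G q"
      then have "integral {0..t} (vend q j) = integral {0..t} (\<lambda>_. 0)"
        by (intro integral_cong vend_0) auto
      then show "end_val G j (\<lambda>x. complex_of_real (u t j x)) q = 0"
        using ev[OF qj(2) t] by simp
    qed
    moreover have "(\<lambda>j x. complex_of_real (v t j x)) \<in> Lp_net G p"
      unfolding Lp_net_def using lpos by (auto intro!: Lp continuous_intros cv)
    ultimately show ?thesis by (simp add: wave_space_def U_def)
  qed
  have dA: "AE x in lebesgue. 0 \<le> x \<and> x \<le> tlen G i \<longrightarrow> dAlembert G (U t) i x = of_real (g i (t - x))"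
    if i: "i \<in> ?R" and t: "t \<ge> 0" for i t
  proof -
    define j where "j = (i + 1) div 2"
    have j: "j \<in> edges" using i by (auto simp: j_def)
    have i': "i = 2 * j - 1 \<and> odd i \<or> i = 2 * j \<and> even i" unfolding j_def by presburger
    have tl: "tlen G i = len G j" by (simp add: tlen_def j_def)
    have w: "AE x in lebesgue. 0 \<le> x \<and> x \<le> len G j \<longrightarrow> weak_deriv (len G j) (\<lambda>x. complex_of_real (u t j x)) x = of_real (du t j x)"
      using weak_deriv_AE[OF wd[OF j]] unfolding AE_lebesgue_on_iff .
    show ?thesis
    proof (cases "odd i")
      case True
      from AE_lebesgue_reflect[OF w, of "len G j"] show ?thesis
      proof eventually_elim
        case (elim x)
        then show ?case using True i' tl
          by (auto simp: dAlembert_def U_def j_def[symmetric] Let_def du_def v_def simp flip: of_real_add)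
             (simp add: field_simps)
      qed
    next
      case False
      from w show ?thesis
      proof eventually_elim
        case (elim x)
        then show ?case using False i' tl
          by (auto simp: dAlembert_def U_def j_def[symmetric] Let_def du_def v_def simp flip: of_real_diff)
             (simp add: field_simps)
      qed
    qed
  qed
  have "transport_solution G (\<lambda>t. a) (dAlembert G (U 0)) (\<lambda>t. dAlembert G (U t))"
    unfolding transport_solution_def
  proof (intro exI[where x = "\<lambda>i s. complex_of_real (g i s)"] ballI conjI allI impI)
    fix i assume i: "i \<in> ?R"
    from AE_lebesgue_reflect[OF dA[OF i order_refl], of 0]
    show "AE s in lebesgue. - tlen G i \<le> s \<and> s < 0 \<longrightarrow> complex_of_real (g i s) = dAlembert G (U 0) i (- s)"
      by eventually_elim auto
    show "AE t in lebesgue. t \<ge> 0 \<longrightarrow> complex_of_real (g i t) =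
        (\<Sum>k\<in>?R. of_real (trans_mat G a i k) * of_real (g k (t - tlen G k)))"
      using law[OF i] by (intro always_eventually) (auto simp: scatter_def)
    show "AE x in lebesgue. 0 \<le> x \<and> x \<le> tlen G i \<longrightarrow> dAlembert G (U t) i x = complex_of_real (g i (t - x))" if "t \<ge> 0" for t
      by (rule dA[OF i that])
  qed
  then have "wave_solution G p (\<lambda>t. a) (U 0) U" by (simp add: wave_solution_def space)
  then show ?thesis
    by (rule that) (use wd in \<open>auto simp: U_def du_def v_def\<close>)
qed

end

section \<open>Almost standing waves\<close>

lemma abs_cos_diff_le: "\<bar>cos x - cos y\<bar> \<le> \<bar>x - y :: real\<bar>"
proof -
  have "\<bar>cos x - cos y\<bar> = 2 * (\<bar>sin ((x + y) / 2)\<bar> * \<bar>sin ((y - x) / 2)\<bar>)"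
    by (simp add: cos_diff_cos abs_mult)
  also have "\<dots> \<le> 2 * (1 * \<bar>(y - x) / 2\<bar>)"
    by (intro mult_left_mono mult_mono abs_sin_x_le_abs_x abs_sin_le_one) auto
  finally show ?thesis by (simp add: abs_minus_commute)
qed

lemma Lp_upper_nonneg: "M \<ge> 0 \<Longrightarrow> Lp_upper l p M \<ge> 0"
  by (simp add: Lp_upper_def)

context wave_net
begin

lemma len_pos: "j \<in> edges \<Longrightarrow> len G j > 0"
  using network by (auto simp: is_network_def)

text \<open>One integer \<open>q\<close> makes all the numbers \<open>q * len G j\<close> nearly
  integers \<open>k j\<close>; then each \<open>2 * pi * k j / len G j\<close> is near the common
  value \<open>2 * pi * q\<close>.\<close>

lemma close_frequencies:
  assumes "\<kappa> > 0"
  obtains w :: "nat \<Rightarrow> real" and k :: "nat \<Rightarrow> int"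
  where "\<And>j. j \<in> edges \<Longrightarrow> w j > 0"
    "\<And>j. j \<in> edges \<Longrightarrow> w j * len G j = 2 * pi * of_int (k j)"
    "\<And>i j. i \<in> edges \<Longrightarrow> j \<in> edges \<Longrightarrow> \<bar>w i - w j\<bar> \<le> \<kappa>"
proof -
  let ?A = "insert 1 (len G ` edges)"
  define \<delta> where "\<delta> = Min ?A"
  have \<delta>: "\<delta> > 0" unfolding \<delta>_def using len_pos by (subst Min_gr_iff) auto
  have \<delta>l: "\<delta> \<le> len G j" if "j \<in> edges" for j
    unfolding \<delta>_def by (rule Min_le) (use that in auto)
  \<comment> \<open>The first summand brings every \<open>w j\<close> within
    \<open>\<kappa> / 2\<close> of \<open>2 * pi * q\<close>; the second makes \<open>1 / N\<close>
    smaller than all lengths, which keeps \<open>k j\<close> positive.\<close>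
  obtain N :: nat where N: "real N > 4 * pi / (\<kappa> * \<delta>) + 1 / \<delta>" using reals_Archimedean2 by blast
  have "4 * pi / (\<kappa> * \<delta>) > 0" "1 / \<delta> > 0" using assms \<delta> by auto
  then have N': "real N > 4 * pi / (\<kappa> * \<delta>)" "real N > 1 / \<delta>" "real N > 0" using N by linarith+
  then have "N > 0" by simp
  obtain q p where q: "0 < q" and qp: "\<And>i. i < nedges G \<Longrightarrow> \<bar>of_int q * len G (Suc i) - of_int (p i)\<bar> < 1 / real N"
    using Dirichlet_approx_simult[OF \<open>N > 0\<close>, where n = "nedges G" and \<theta> = "\<lambda>i. len G (Suc i)"] by metis
  define k where "k = (\<lambda>j. p (j - 1))"
  define w where "w = (\<lambda>j. 2 * pi * of_int (k j) / len G j)"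
  have qk: "\<bar>of_int q * len G j - of_int (k j)\<bar> < 1 / real N" if "j \<in> edges" for j
    using qp[of "j - 1"] that by (auto simp: k_def)
  show ?thesis
  proof (rule that[of w k])
    fix j assume j: "j \<in> edges"
    have "1 / real N < \<delta>" using N'(2,3) \<delta> by (simp add: field_simps)
    moreover have "len G j \<le> of_int q * len G j" using q len_pos[OF j] by simp
    ultimately have "of_int (k j) > (0::real)" using qk[OF j] \<delta>l[OF j] by linarith
    then show "w j > 0" using len_pos[OF j] by (simp add: w_def)
    show "w j * len G j = 2 * pi * of_int (k j)" using len_pos[OF j] by (simp add: w_def)
  next
    have c: "\<bar>w j - 2 * pi * of_int q\<bar> \<le> \<kappa> / 2" if j: "j \<in> edges" for j
    proof -
      have "w j - 2 * pi * of_int q = 2 * pi * (of_int (k j) - of_int q * len G j) / len G j"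
        using len_pos[OF j] by (simp add: w_def field_simps)
      then have "\<bar>w j - 2 * pi * of_int q\<bar> = 2 * pi * \<bar>of_int q * len G j - of_int (k j)\<bar> / len G j"
        using len_pos[OF j] by (simp add: abs_mult abs_minus_commute)
      also have "\<dots> \<le> 2 * pi * (1 / real N) / \<delta>"
        using qk[OF j] \<delta>l[OF j] \<delta> by (intro frac_le mult_left_mono) auto
      also have "\<dots> \<le> \<kappa> / 2"
        using N'(1,3) assms \<delta> by (simp add: field_simps)
      finally show ?thesis .
    qed
    fix i j assume "i \<in> edges" "j \<in> edges"
    then show "\<bar>w i - w j\<bar> \<le> \<kappa>" using c[of i] c[of j] by linarith
  qed
qed

lemma wave_norm_ge:
  assumes p: "1 \<le> p" and j: "j \<in> edges"
  shows "Lp_norm (len G j) p (weak_deriv (len G j) (fst U j)) \<le> wave_norm G p U"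
proof -
  obtain u v where U: "U = (u, v)" by (cases U)
  let ?X = "\<lambda>j. Lp_norm (len G j) p (weak_deriv (len G j) (u j))"
  let ?Y = "\<lambda>j. Lp_norm (len G j) p (v j)"
  show ?thesis
    using p
  proof (cases rule: ereal_ge_1_cases)
    case 1
    have "max (?X j) (?Y j) \<le> (MAX j\<in>edges. max (?X j) (?Y j))"
      by (rule Max_ge) (use j in auto)
    then show ?thesis using 1 by (simp add: wave_norm_def U)
  next
    case (2 r)
    have "?X j powr r \<le> (\<Sum>j\<in>edges. ?X j powr r)"
      by (rule member_le_sum[OF j]) auto
    also have "\<dots> \<le> (\<Sum>j\<in>edges. ?X j powr r) + (\<Sum>j\<in>edges. ?Y j powr r)"
      by (simp add: sum_nonneg)
    finally have "(?X j powr r) powr (1 / r) \<le> ((\<Sum>j\<in>edges. ?X j powr r) + (\<Sum>j\<in>edges. ?Y j powr r)) powr (1 / r)"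
      using 2 by (intro powr_mono2) auto
    moreover have "(?X j powr r) powr (1 / r) = ?X j"
      using 2 Lp_norm_nonneg[OF len_pos[OF j]] by (simp add: powr_powr)
    ultimately show ?thesis using 2 by (simp add: wave_norm_def U)
  qed
qed

lemma wave_norm_le:
  assumes p: "1 \<le> p" and n: "nedges G \<ge> 1"
    and X: "\<And>j. j \<in> edges \<Longrightarrow> Lp_norm (len G j) p (weak_deriv (len G j) (fst U j)) \<le> B"
    and Y: "\<And>j. j \<in> edges \<Longrightarrow> Lp_norm (len G j) p (snd U j) \<le> B"
  shows "wave_norm G p U \<le> (if p = \<infinity> then B else (2 * real (nedges G) * B powr real_of_ereal p) powr (1 / real_of_ereal p))"
proof -
  obtain u v where U: "U = (u, v)" by (cases U)
  let ?X = "\<lambda>j. Lp_norm (len G j) p (weak_deriv (len G j) (u j))"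
  let ?Y = "\<lambda>j. Lp_norm (len G j) p (v j)"
  show ?thesis
    using p
  proof (cases rule: ereal_ge_1_cases)
    case 1
    have "(MAX j\<in>edges. max (?X j) (?Y j)) \<le> B"
      using X Y n by (subst Max_le_iff) (auto simp: U)
    then show ?thesis using 1 by (simp add: wave_norm_def U)
  next
    case (2 r)
    have "(\<Sum>j\<in>edges. ?X j powr r) + (\<Sum>j\<in>edges. ?Y j powr r) \<le>
        (\<Sum>j\<in>edges. B powr r) + (\<Sum>j\<in>edges. B powr r)"
      using X Y 2 len_pos by (intro add_mono sum_mono powr_mono2) (auto simp: U intro!: Lp_norm_nonneg)
    then have "((\<Sum>j\<in>edges. ?X j powr r) + (\<Sum>j\<in>edges. ?Y j powr r)) powr (1 / r) \<le>
        (2 * real (nedges G) * B powr r) powr (1 / r)"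
      using 2 by (intro powr_mono2) (auto intro!: add_nonneg_nonneg sum_nonneg)
    then show ?thesis using 2 by (simp add: wave_norm_def U)
  qed
qed

text \<open>Both components of edge \<open>j\<close> get an amplitude near \<open>s j\<close>. The
  flow condition says that this amplitude vector is orthogonal to the sign vector at each interior
  vertex, hence unchanged by scattering; at a damped vertex it changes by at most
  \<open>2 * S * e\<close>. Each time step \<delta> multiplies the error by at most 3 and adds at
  most \<rho>, whence the factor 4.\<close>

lemma near_standing_trajectory:
  fixes s :: "nat \<Rightarrow> real" and a :: "'v \<Rightarrow> real"
  assumes a: "\<And>q. q \<in> damped G \<Longrightarrow> a q \<ge> 0"
    and S: "\<And>j. j \<in> edges \<Longrightarrow> \<bar>s j\<bar> \<le> S"
    and flow: "\<And>q. q \<in> int_verts G \<Longrightarrow> (\<Sum>j\<in>edges_at G q. end_sign G q j * s j) = 0"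
    and small: "\<And>q j. q \<in> damped G \<Longrightarrow> j \<in> edges_at G q \<Longrightarrow> s j = 0 \<or> a q \<le> e"
    and e: "4 * S * e \<le> \<rho>" and \<kappa>: "6 * S * \<kappa> * T \<le> \<rho>" "\<kappa> > 0" and \<rho>: "\<rho> > 0" "\<rho> \<le> 1"
    and \<delta>: "\<delta> > 0" "\<And>i. i \<in> components \<Longrightarrow> \<delta> \<le> tlen G i"
    and T: "0 \<le> T" "T \<le> real n * \<delta>"
  obtains g :: "nat \<Rightarrow> real \<Rightarrow> real" and w :: "nat \<Rightarrow> real" and k :: "nat \<Rightarrow> int"
  where "\<And>i. i \<in> components \<Longrightarrow> continuous_on UNIV (g i)"
    "\<And>i t. i \<in> components \<Longrightarrow> t \<ge> 0 \<Longrightarrow> g i t = scatter a i (\<lambda>k. g k (t - tlen G k))"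
    "\<And>i. i \<in> components \<Longrightarrow> integral {- tlen G i..0} (g i) = 0"
    "\<And>i t. i \<in> components \<Longrightarrow> - tlen G i \<le> t \<Longrightarrow> t \<le> 0 \<Longrightarrow> \<bar>g i t\<bar> \<le> S + 1"
    "\<And>i t. i \<in> components \<Longrightarrow> - tlen G i \<le> t \<Longrightarrow> t \<le> T \<Longrightarrow>
       \<bar>g i t - s ((i + 1) div 2) * cos (w ((i + 1) div 2) * t)\<bar> \<le> 4 ^ n * \<rho>"
    "\<And>j. j \<in> edges \<Longrightarrow> w j > 0 \<and> w j * len G j = 2 * pi * of_int (k j)"
proof -
  let ?R = "components"
  obtain w k where w: "\<And>j. j \<in> edges \<Longrightarrow> w j > 0"
    and wk: "\<And>j. j \<in> edges \<Longrightarrow> w j * len G j = 2 * pi * of_int (k j)"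
    and wc: "\<And>i j. i \<in> edges \<Longrightarrow> j \<in> edges \<Longrightarrow> \<bar>w i - w j\<bar> \<le> \<kappa>"
    using close_frequencies[OF \<kappa>(2)] by metis
  have ed: "(i + 1) div 2 \<in> edges" if "i \<in> ?R" for i using that by auto
  define c where "c = (\<lambda>i. s ((i + 1) div 2))"
  define \<omega> where "\<omega> = (\<lambda>i. w ((i + 1) div 2))"
  define c' where "c' = (\<lambda>i. scatter a i c)"
  \<comment> \<open>The amplitude runs from \<open>c i\<close> at \<open>- tlen G i\<close> to \<open>c' i\<close> at \<open>0\<close>: this makes \<open>g\<close> continuous although
    \<open>c\<close> is not exactly invariant under scattering.\<close>
  define I where "I = (\<lambda>i t. (c i + (c' i - c i) * (1 + t / tlen G i)) * cos (\<omega> i * t))"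
  have \<omega>: "\<omega> i > 0" "\<omega> i * tlen G i = 2 * pi * of_int (k ((i + 1) div 2))" if "i \<in> ?R" for i
    using w[OF ed[OF that]] wk[OF ed[OF that]] by (auto simp: \<omega>_def tlen_def)
  have cosper: "cos (\<omega> i * (t - tlen G i)) = cos (\<omega> i * t)" if "i \<in> ?R" for i t
  proof -
    have "\<omega> i * (t - tlen G i) = \<omega> i * t - 2 * pi * of_int (k ((i + 1) div 2))"
      using \<omega>(2)[OF that] by (simp add: right_diff_distrib)
    also have "cos \<dots> = cos (\<omega> i * t)"
      by (simp add: cos_diff cos_int_2pin sin_int_2pin)
    finally show ?thesis .
  qed
  have cix: "c (in_ix G q j) = s j" "c (out_ix G q j) = s j" if "j \<in> edges_at G q" for q j
    using edges_atD(1)[OF that] by (auto simp: c_def in_ix_def out_ix_def)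
  have cS: "\<bar>c i\<bar> \<le> S" if "i \<in> ?R" for i unfolding c_def by (rule S[OF ed[OF that]])
  have cc: "\<bar>c' i - c i\<bar> \<le> \<rho> / 2" if i: "i \<in> ?R" for i
  proof -
    obtain j q where j: "j \<in> edges_at G q" and i': "i = out_ix G q j" using ix_surj[OF i] by metis
    have js: "\<bar>s j\<bar> \<le> S" using S j by (auto simp: edges_at_def)
    have "(\<Sum>l\<in>edges_at G q. end_sign G q l *\<^sub>R c (in_ix G q l)) = (\<Sum>l\<in>edges_at G q. end_sign G q l * s l)"
      by (intro sum.cong) (auto simp: cix)
    note * = this scatter_out[OF j, of a c]
    consider "q \<in> int_verts G" | "q \<in> undamped G" "q \<notin> int_verts G" | "q \<in> damped G" "q \<notin> int_verts G" "q \<notin> undamped G"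
      using not_int_cases[OF edges_atD(7)[OF j]] by blast
    then show ?thesis
    proof cases
      case 1
      then show ?thesis using * flow[OF 1] \<rho> by (simp add: c'_def i' cix[OF j])
    next
      case 2
      then show ?thesis using * \<rho> by (simp add: c'_def i' cix[OF j] refl_coeff_def)
    next
      case 3
      have eq: "c' i - c i = (refl_coeff G a q - 1) * s j"
        using 3 * by (simp add: c'_def i' cix[OF j] algebra_simps)
      show ?thesis
      proof (cases "s j = 0")
        case False
        then have aq: "0 \<le> a q" "a q \<le> e" using small[OF 3(1) j] a[OF 3(1)] by auto
        have "refl_coeff G a q - 1 = - (2 * a q / (1 + a q))"
          using aq 3 by (simp add: refl_coeff_def field_simps)
        moreover have "2 * a q / (1 + a q) \<le> 2 * e" "0 \<le> 2 * a q / (1 + a q)"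
          using aq by (auto simp: divide_le_eq intro!: mult_mono[of _ _ 1, simplified] add_increasing2 mult_nonneg_nonneg)
             (simp add: algebra_simps add_increasing2 mult_nonneg_nonneg)?
        ultimately have "\<bar>refl_coeff G a q - 1\<bar> \<le> 2 * e" by linarith
        then have "\<bar>c' i - c i\<bar> \<le> 2 * e * S"
          unfolding eq abs_mult using js aq by (intro mult_mono) auto
        then show ?thesis using e by (simp add: mult_ac)
      qed (use eq \<rho> in simp)
    qed
  qed
  have Icont: "continuous_on UNIV (I i)" if "i \<in> ?R" for i
    unfolding I_def using tlen_pos[OF that] by (intro continuous_intros) auto
  have I0: "I i 0 = c' i" for i by (simp add: I_def)
  have Il: "I i (- tlen G i) = c i" if "i \<in> ?R" for i
    using cosper[OF that, of 0] tlen_pos[OF that] by (simp add: I_def)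
  have compat: "I i 0 = scatter a i (\<lambda>k. I k (- tlen G k))" if "i \<in> ?R" for i
    unfolding I0 c'_def by (rule scatter_cong) (simp add: Il)
  obtain g where gc: "\<And>i. i \<in> ?R \<Longrightarrow> continuous_on UNIV (g i)"
    and gI: "\<And>i t. i \<in> ?R \<Longrightarrow> t \<le> 0 \<Longrightarrow> g i t = I i t"
    and gl: "\<And>i t. i \<in> ?R \<Longrightarrow> t \<ge> 0 \<Longrightarrow> g i t = scatter a i (\<lambda>k. g k (t - tlen G k))"
    using trajectory_exists[OF Icont compat] by blast
  have Ierr: "\<bar>I i t - c i * cos (\<omega> i * t)\<bar> \<le> \<rho> / 2" if i: "i \<in> ?R" and t: "- tlen G i \<le> t" "t \<le> 0" for i t
  proof -
    have th: "0 \<le> 1 + t / tlen G i" "1 + t / tlen G i \<le> 1" using t tlen_pos[OF i] by (auto simp: field_simps)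
    have "\<bar>I i t - c i * cos (\<omega> i * t)\<bar> = \<bar>c' i - c i\<bar> * (\<bar>1 + t / tlen G i\<bar> * \<bar>cos (\<omega> i * t)\<bar>)"
      unfolding I_def abs_mult[symmetric] by (simp add: algebra_simps)
    also have "\<dots> \<le> \<rho> / 2 * (1 * 1)"
      using th \<rho> by (intro mult_mono cc i abs_cos_le_one) auto
    finally show ?thesis by simp
  qed
  have bd: "\<bar>g i t\<bar> \<le> S + 1" if i: "i \<in> ?R" and t: "- tlen G i \<le> t" "t \<le> 0" for i t
  proof -
    have "\<bar>c i * cos (\<omega> i * t)\<bar> \<le> S * 1"
      unfolding abs_mult using cS[OF i] by (intro mult_mono abs_cos_le_one) auto
    then show ?thesis using Ierr[OF i t] gI[OF i t(2)] \<rho> by linarith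
  qed
  \<comment> \<open>Over whole periods even a linear amplitude times the cosine has integral zero:
    the sine boundary terms vanish and the cosine ones agree.\<close>
  have mean: "integral {- tlen G i..0} (g i) = 0" if i: "i \<in> ?R" for i
  proof -
    define A where "A = c' i"
    define B where "B = (c' i - c i) / tlen G i"
    have "integral {- tlen G i..0} (g i) = integral {- tlen G i..0} (\<lambda>t. (A + B * t) * cos (\<omega> i * t))"
      using tlen_pos[OF i] by (intro integral_cong) (auto simp: gI[OF i] I_def A_def B_def field_simps)
    also have "\<dots> = ((A + B * 0) * sin (\<omega> i * 0) / \<omega> i + B * cos (\<omega> i * 0) / (\<omega> i)\<^sup>2)
       - ((A + B * (- tlen G i)) * sin (\<omega> i * (- tlen G i)) / \<omega> i + B * cos (\<omega> i * (- tlen G i)) / (\<omega> i)\<^sup>2)"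
      using tlen_pos[OF i] \<omega>(1)[OF i]
      by (intro integral_eq_diff) (auto intro!: derivative_eq_intros simp: field_simps power2_eq_square)
    also have "\<dots> = 0"
      using \<omega>(2)[OF i] by (simp add: cos_int_2pin sin_int_2pin)
    finally show ?thesis .
  qed
  have err: "\<bar>g i t - c i * cos (\<omega> i * t)\<bar> \<le> 4 ^ m * \<rho>"
    if "i \<in> ?R" "- tlen G i \<le> t" "t \<le> real m * \<delta>" "t \<le> T" for i t m
    using that
  proof (induction m arbitrary: i t)
    case 0
    then show ?case using Ierr[of i t] gI[of i t] \<rho> by simp
  next
    case (Suc m)
    show ?case
    proof (cases "t \<le> 0")
      case True
      have "\<rho> / 2 \<le> 4 ^ Suc m * \<rho>" using \<rho> one_le_power[of "4::real" "Suc m"] mult_right_mono[of 1 "4 ^ Suc m" \<rho>] by simp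
      then show ?thesis using Ierr[of i t] gI[of i t] Suc.prems True by simp
    next
      case False
      note i = Suc.prems(1)
      have "\<bar>scatter a i (\<lambda>k. g k (t - tlen G k) - c k * cos (\<omega> k * (t - tlen G k)))\<bar> \<le> 3 * (4 ^ m * \<rho>)"
        unfolding real_norm_def[symmetric]
      proof (rule scatter_norm_le[OF i a])
        fix k assume k: "k \<in> ?R"
        show "norm (g k (t - tlen G k) - c k * cos (\<omega> k * (t - tlen G k))) \<le> 4 ^ m * \<rho>"
          unfolding real_norm_def
          using Suc.prems False \<delta>(2)[OF k] tlen_pos[OF k] by (intro Suc.IH k) (auto simp: algebra_simps)
      qed
      moreover have "\<bar>scatter a i (\<lambda>k. c k * (cos (\<omega> k * t) - cos (\<omega> i * t)))\<bar> \<le> 3 * (S * (\<kappa> * T))"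
        unfolding real_norm_def[symmetric]
      proof (rule scatter_norm_le[OF i a])
        fix k assume k: "k \<in> ?R"
        have "\<bar>cos (\<omega> k * t) - cos (\<omega> i * t)\<bar> \<le> \<bar>\<omega> k * t - \<omega> i * t\<bar>" by (rule abs_cos_diff_le)
        also have "\<dots> = \<bar>\<omega> k - \<omega> i\<bar> * t" using False by (simp add: abs_mult left_diff_distrib[symmetric])
        also have "\<dots> \<le> \<kappa> * T"
          unfolding \<omega>_def using False Suc.prems \<kappa>(2) by (intro mult_mono wc ed k i) auto
        finally show "norm (c k * (cos (\<omega> k * t) - cos (\<omega> i * t))) \<le> S * (\<kappa> * T)"
          unfolding real_norm_def abs_mult using cS[OF k] by (intro mult_mono) auto
      qed
      \<comment> \<open>The three defects are the error of the arriving waves, the mismatch of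
        frequencies between edges, and the failure of \<open>c\<close> to be invariant. The last two
        contribute at most \<open>\<rho> / 2\<close> each.\<close>
      moreover have "g i t - c i * cos (\<omega> i * t) =
          scatter a i (\<lambda>k. g k (t - tlen G k) - c k * cos (\<omega> k * (t - tlen G k))) +
          scatter a i (\<lambda>k. c k * (cos (\<omega> k * t) - cos (\<omega> i * t))) + (c' i - c i) * cos (\<omega> i * t)"
      proof -
        have "g i t = scatter a i (\<lambda>k. g k (t - tlen G k))" using gl i False by simp
        also have "\<dots> = scatter a i (\<lambda>k. (g k (t - tlen G k) - c k * cos (\<omega> k * (t - tlen G k))) + c k * (cos (\<omega> k * t) - cos (\<omega> i * t)) + c k * cos (\<omega> i * t))"
          by (rule scatter_cong) (simp only: cosper, simp add: algebra_simps)
        also have "\<dots> = scatter a i (\<lambda>k. g k (t - tlen G k) - c k * cos (\<omega> k * (t - tlen G k))) +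
          scatter a i (\<lambda>k. c k * (cos (\<omega> k * t) - cos (\<omega> i * t))) + scatter a i c * cos (\<omega> i * t)"
          unfolding scatter_def by (simp add: sum.distrib distrib_left sum_distrib_right mult.assoc)
        finally show ?thesis by (simp add: c'_def algebra_simps)
      qed
      moreover have "\<bar>(c' i - c i) * cos (\<omega> i * t)\<bar> \<le> \<rho> / 2 * 1"
        unfolding abs_mult using \<rho> by (intro mult_mono cc i abs_cos_le_one) auto
      moreover have "3 * (S * (\<kappa> * T)) \<le> \<rho> / 2" using \<kappa>(1) by (simp add: mult_ac)
      moreover have "\<rho> \<le> 4 ^ m * \<rho>"
        using \<rho> one_le_power[of "4::real" m] mult_right_mono[of 1 "4 ^ m" \<rho>] by simp
      ultimately show ?thesis by simp
    qed
  qed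
  show ?thesis
  proof (rule that[of g w k, OF gc gl mean bd])
    fix i t assume "i \<in> ?R" "- tlen G i \<le> t" "t \<le> T"
    with err[of i t n] T(2) show "\<bar>g i t - s ((i + 1) div 2) * cos (w ((i + 1) div 2) * t)\<bar> \<le> 4 ^ n * \<rho>"
      by (simp add: c_def \<omega>_def)
  qed (use w wk in auto)
qed

end

lemma const_in_Linf_into:
  assumes "d \<in> D"
  shows "(\<lambda>_. d) \<in> Linf_into D"
proof -
  have "esssup lebesgue (\<lambda>t::real. ereal (norm d)) = ereal (norm d)"
    by (rule esssup_const) simp
  then show ?thesis using assms by (simp add: Linf_into_def)
qed

lemma abs_half_sum_le:
  fixes x y z :: real
  shows "\<bar>x\<bar> \<le> M \<Longrightarrow> \<bar>y\<bar> \<le> M \<Longrightarrow> \<bar>(x + y) / 2\<bar> \<le> M"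
    "\<bar>x\<bar> \<le> M \<Longrightarrow> \<bar>y\<bar> \<le> M \<Longrightarrow> \<bar>(x - y) / 2\<bar> \<le> M"
    "\<bar>x - z\<bar> \<le> M \<Longrightarrow> \<bar>y - z\<bar> \<le> M \<Longrightarrow> \<bar>(x + y) / 2 - z\<bar> \<le> M"
  by (auto simp: abs_le_iff field_simps)

context wave_net
begin

text \<open>Decay at rate \<open>\<gamma> / 2\<close> would push the norm below \<open>b\<close> at
  a late time \<open>T\<close>, while the almost standing wave keeps it above. \<open>B'\<close> and
  \<open>b\<close> depend on \<open>s\<close>, \<open>p\<close> and the network only, so
  \<open>T\<close> can be fixed before the damping and the frequencies.\<close>

lemma not_exp_stable_if_flow:
  fixes \<nu> :: "'d::finite \<Rightarrow> 'v" and D :: "(real ^ 'd) set" and s :: "nat \<Rightarrow> real"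
  assumes p: "1 \<le> p" and D0: "D \<subseteq> {x. \<forall>i. 0 \<le> x $ i}"
    and j0: "j0 \<in> edges" "s j0 \<noteq> 0"
    and flow: "\<And>q. q \<in> int_verts G \<Longrightarrow> (\<Sum>j\<in>edges_at G q. end_sign G q j * s j) = 0"
    and small: "\<And>e. e > 0 \<Longrightarrow> \<exists>d\<in>D. \<forall>q\<in>damped G. \<forall>j\<in>edges_at G q. s j = 0 \<or> d $ inv \<nu> q \<le> e"
  shows "\<not> wave_exp_stable G \<nu> (Linf_into D) p"
proof
  assume "wave_exp_stable G \<nu> (Linf_into D) p"
  then obtain \<gamma> where \<gamma>: "\<gamma> < 0" and ty: "wave_exp_type G \<nu> (Linf_into D) p \<gamma>"
    by (auto simp: wave_exp_stable_def)
  from ty[unfolded wave_exp_type_def, rule_format, of "- \<gamma> / 2"] \<gamma> obtain K where K: "K > 0"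
    and stab: "\<And>\<eta> U0 U t. \<lbrakk>\<eta> \<in> Linf_into D; U0 \<in> wave_space G p; wave_solution G p (\<lambda>t q. \<eta> t $ inv \<nu> q) U0 U; t \<ge> 0\<rbrakk>
       \<Longrightarrow> wave_norm G p (U t) \<le> K * exp (\<gamma> / 2 * t) * wave_norm G p U0"
    by (auto simp: field_simps)
  let ?R = "components"
  let ?L = "len G j0"
  define S where "S = (\<Sum>j\<in>edges. \<bar>s j\<bar>)"
  have S: "\<bar>s j\<bar> \<le> S" if "j \<in> edges" for j
    unfolding S_def by (rule member_le_sum[OF that]) auto
  have S0: "S > 0" using S[OF j0(1)] j0(2) by linarith
  define B where "B = (\<Sum>j\<in>edges. Lp_upper (len G j) p (S + 1))"
  have B: "Lp_upper (len G j) p (S + 1) \<le> B" if "j \<in> edges" for j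
    unfolding B_def by (rule member_le_sum[OF that]) (use S0 in \<open>auto intro!: Lp_upper_nonneg\<close>)
  define B' where "B' = (if p = \<infinity> then B else (2 * real (nedges G) * B powr real_of_ereal p) powr (1 / real_of_ereal p))"
  \<comment> \<open>The slope on \<open>j0\<close> will have mean modulus at least |s j0| (1/2 -
    1/4), the mean of a squared cosine minus the error. This equals \<open>3 / 2 * \<alpha>\<close>,
    the form needed for \<open>Lp_norm_lower\<close>.\<close>
  define \<alpha> where "\<alpha> = \<bar>s j0\<bar> / 6"
  have \<alpha>: "\<alpha> > 0" using j0 by (simp add: \<alpha>_def)
  define b where "b = Lp_lower ?L p \<alpha>"
  have L: "?L > 0" using len_pos[OF j0(1)] .
  have b: "b > 0" unfolding b_def using \<alpha> L by (rule Lp_lower_pos)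
  have "(\<lambda>m. K * exp (\<gamma> / 2 * (real m * ?L)) * B') \<longlonglongrightarrow> K * 0 * B'"
  proof (intro tendsto_intros)
    have "exp (\<gamma> / 2 * (real m * ?L)) = exp (\<gamma> / 2 * ?L) ^ m" for m
      by (simp add: exp_of_nat_mult[symmetric] mult_ac)
    moreover have "\<gamma> / 2 * ?L < 0" using \<gamma> L by (simp add: mult_neg_pos)
    then have "(\<lambda>m. exp (\<gamma> / 2 * ?L) ^ m) \<longlonglongrightarrow> 0"
      by (intro LIMSEQ_power_zero) auto
    ultimately show "(\<lambda>m. exp (\<gamma> / 2 * (real m * ?L))) \<longlonglongrightarrow> 0" by simp
  qed
  then have "\<forall>\<^sub>F m in sequentially. K * exp (\<gamma> / 2 * (real m * ?L)) * B' < b"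
    using b by (intro order_tendstoD(2)) auto
  then obtain m where m: "K * exp (\<gamma> / 2 * (real m * ?L)) * B' < b"
    using eventually_happens'[OF sequentially_bot] by blast
  \<comment> \<open>At a multiple of the length of \<open>j0\<close> both waves on this edge are in
    phase with \<open>cos (w j0 * x)\<close>, so the slope has full amplitude.\<close>
  define T where "T = real m * ?L"
  have T: "T \<ge> 0" using L by (simp add: T_def)
  obtain \<delta> where \<delta>: "\<delta> > 0" "\<And>i. i \<in> ?R \<Longrightarrow> \<delta> \<le> tlen G i" using min_tlen by metis
  obtain n where "T / \<delta> < real n" using reals_Archimedean2 by blast
  then have n: "T \<le> real n * \<delta>" using \<delta>(1) by (simp add: field_simps)
  \<comment> \<open>Absorbs the growth \<open>4 ^ n\<close> of the error up to time \<open>T\<close>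
    and leaves at most a quarter of the amplitude.\<close>
  define \<rho> where "\<rho> = min 1 (\<bar>s j0\<bar> / 4) / 4 ^ n"
  have \<rho>: "\<rho> > 0" "4 ^ n * \<rho> \<le> \<bar>s j0\<bar> / 4" using j0 by (auto simp: \<rho>_def)
  have "min 1 (\<bar>s j0\<bar> / 4) \<le> 4 ^ n" using one_le_power[of "4::real" n] by linarith
  then have \<rho>1: "\<rho> \<le> 1" by (simp add: \<rho>_def)
  define e where "e = \<rho> / (4 * S)"
  have e: "e > 0" "4 * S * e \<le> \<rho>" using \<rho> S0 by (auto simp: e_def)
  define \<kappa> where "\<kappa> = \<rho> / (6 * S * (T + 1))"
  have \<kappa>: "\<kappa> > 0" using \<rho> S0 T by (simp add: \<kappa>_def)
  have "6 * S * \<kappa> * T = \<rho> * (T / (T + 1))" using S0 by (simp add: \<kappa>_def)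
  also have "\<dots> \<le> \<rho> * 1" using T \<rho> by (intro mult_left_mono) auto
  finally have \<kappa>': "6 * S * \<kappa> * T \<le> \<rho>" by simp
  obtain d where d: "d \<in> D" and dsmall: "\<And>q j. q \<in> damped G \<Longrightarrow> j \<in> edges_at G q \<Longrightarrow> s j = 0 \<or> d $ inv \<nu> q \<le> e"
    using small[OF e(1)] by blast
  define a where "a = (\<lambda>q. d $ inv \<nu> q)"
  have a: "a q \<ge> 0" for q using d D0 by (auto simp: a_def)
  have asmall: "s j = 0 \<or> a q \<le> e" if "q \<in> damped G" "j \<in> edges_at G q" for q j
    using dsmall[OF that] by (simp add: a_def)
  obtain g w k where gc: "\<And>i. i \<in> ?R \<Longrightarrow> continuous_on UNIV (g i)"
    and gl: "\<And>i t. i \<in> ?R \<Longrightarrow> t \<ge> 0 \<Longrightarrow> g i t = scatter a i (\<lambda>k. g k (t - tlen G k))"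
    and mean: "\<And>i. i \<in> ?R \<Longrightarrow> integral {- tlen G i..0} (g i) = 0"
    and bd: "\<And>i t. i \<in> ?R \<Longrightarrow> - tlen G i \<le> t \<Longrightarrow> t \<le> 0 \<Longrightarrow> \<bar>g i t\<bar> \<le> S + 1"
    and err: "\<And>i t. i \<in> ?R \<Longrightarrow> - tlen G i \<le> t \<Longrightarrow> t \<le> T \<Longrightarrow>
       \<bar>g i t - s ((i + 1) div 2) * cos (w ((i + 1) div 2) * t)\<bar> \<le> 4 ^ n * \<rho>"
    and w: "\<And>j. j \<in> edges \<Longrightarrow> w j > 0 \<and> w j * len G j = 2 * pi * of_int (k j)"
    using near_standing_trajectory[of a s S e \<rho> \<kappa> T \<delta> n, OF a S flow asmall e(2) \<kappa>' \<kappa> \<rho>(1) \<rho>1 \<delta> T n] by blast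
  obtain U where sol: "wave_solution G p (\<lambda>t. a) (U 0) U"
    and wd: "\<And>t j. t \<ge> 0 \<Longrightarrow> j \<in> edges \<Longrightarrow> has_weak_deriv (len G j) (fst (U t) j)
        (\<lambda>x. of_real ((g (2 * j - 1) (t - len G j + x) + g (2 * j) (t - x)) / 2))"
    and v: "\<And>t j. snd (U t) j = (\<lambda>x. of_real ((g (2 * j - 1) (t - len G j + x) - g (2 * j) (t - x)) / 2))"
    using wave_from_trajectory[OF p gc gl mean] by blast
  have jR: "2 * j - 1 \<in> ?R" "2 * j \<in> ?R" "tlen G (2 * j - 1) = len G j" "tlen G (2 * j) = len G j"
    if "j \<in> edges" for j using that by (auto simp: tlen_def)
  have sp: "U t \<in> wave_space G p" if "t \<ge> 0" for t using sol that by (auto simp: wave_solution_def)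
  have cg: "continuous_on X (\<lambda>x. g (2 * j - 1) (h x))" "continuous_on X (\<lambda>x. g (2 * j) (h x))"
    if "j \<in> edges" "continuous_on X h" for j X and h :: "real \<Rightarrow> real"
    using continuous_on_compose2[OF gc[OF jR(1)[OF that(1)]] that(2)]
      continuous_on_compose2[OF gc[OF jR(2)[OF that(1)]] that(2)] by auto
  define du where "du = (\<lambda>t j x. complex_of_real ((g (2 * j - 1) (t - len G j + x) + g (2 * j) (t - x)) / 2))"
  have cdu: "continuous_on {0..len G j} (du t j)" and cv: "continuous_on {0..len G j} (snd (U t) j)"
    if "j \<in> edges" for j t
    unfolding du_def v using that by (auto intro!: continuous_intros cg simp del: One_nat_def)
  have mdu: "du t j \<in> borel_measurable (leb (len G j))" and mv: "snd (U t) j \<in> borel_measurable (leb (len G j))"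
    if "j \<in> edges" for j t
    using cdu[OF that] cv[OF that] by (auto intro!: continuous_imp_measurable_on_sets_lebesgue)
  have wn: "Lp_norm (len G j) p (weak_deriv (len G j) (fst (U t) j)) = Lp_norm (len G j) p (du t j)"
    if "j \<in> edges" "t \<ge> 0" for j t
  proof (rule Lp_norm_AE_cong[OF _ mdu[OF that(1)]])
    have h: "has_weak_deriv (len G j) (fst (U t) j) (du t j)" using wd[OF that(2,1)] by (simp add: du_def)
    show "weak_deriv (len G j) (fst (U t) j) \<in> borel_measurable (leb (len G j))"
      using has_weak_deriv_weak_deriv[OF h] by (auto simp: has_weak_deriv_def)
    show "AE x in leb (len G j). weak_deriv (len G j) (fst (U t) j) x = du t j x"
      by (rule weak_deriv_AE[OF h])
  qed
  have up: "wave_norm G p (U 0) \<le> B'"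
    unfolding B'_def
  proof (rule wave_norm_le[OF p])
    show "nedges G \<ge> 1" using j0 by auto
    fix j assume j: "j \<in> edges"
    have bg: "\<bar>g (2 * j - 1) (0 - len G j + x)\<bar> \<le> S + 1" "\<bar>g (2 * j) (0 - x)\<bar> \<le> S + 1" if "x \<in> {0..len G j}" for x
      using bd[OF jR(1)[OF j], of "0 - len G j + x"] bd[OF jR(2)[OF j], of "0 - x"] jR(3,4)[OF j] that by auto
    have "Lp_norm (len G j) p (du 0 j) \<le> Lp_upper (len G j) p (S + 1)"
    proof (rule bounded_in_Lp(2)[OF p len_pos[OF j] mdu[OF j]])
      fix x assume "x \<in> {0..len G j}"
      from bg[OF this] show "cmod (du 0 j x) \<le> S + 1"
        unfolding du_def norm_of_real by (rule abs_half_sum_le)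
    qed
    then show "Lp_norm (len G j) p (weak_deriv (len G j) (fst (U 0) j)) \<le> B"
      using B[OF j] wn[OF j, of 0] by simp
    have "Lp_norm (len G j) p (snd (U 0) j) \<le> Lp_upper (len G j) p (S + 1)"
    proof (rule bounded_in_Lp(2)[OF p len_pos[OF j] mv[OF j]])
      fix x assume "x \<in> {0..len G j}"
      from bg[OF this] show "cmod (snd (U 0) j x) \<le> S + 1"
        unfolding v norm_of_real by (rule abs_half_sum_le)
    qed
    then show "Lp_norm (len G j) p (snd (U 0) j) \<le> B" using B[OF j] by simp
  qed
  have low: "b \<le> wave_norm G p (U T)"
  proof -
    let ?w = "w j0"
    have w0: "?w > 0" "?w * ?L = 2 * pi * of_int (k j0)" using w[OF j0(1)] by auto
    have per: "cos (?w * (T - x)) = cos (?w * x)" "cos (?w * (T - ?L + x)) = cos (?w * x)" for x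
    proof -
      have c1: "cos (2 * pi * of_int i + y) = cos y" "cos (2 * pi * of_int i - y) = cos y" for i :: int and y
        by (simp_all add: cos_add cos_diff cos_int_2pin sin_int_2pin)
      have "?w * (T - x) = 2 * pi * of_int (int m * k j0) - ?w * x"
        using w0(2) by (simp add: T_def algebra_simps)
      moreover have "?w * (T - ?L + x) = 2 * pi * of_int ((int m - 1) * k j0) + ?w * x"
        using w0(2) by (simp add: T_def algebra_simps)
      ultimately show "cos (?w * (T - x)) = cos (?w * x)" "cos (?w * (T - ?L + x)) = cos (?w * x)"
        using c1 by presburger+
    qed
    have er: "cmod (du T j0 x - of_real (s j0 * cos (?w * x))) \<le> \<bar>s j0\<bar> / 4" if x: "x \<in> {0..?L}" for x
    proof -
      have "\<bar>g (2 * j0 - 1) (T - ?L + x) - s j0 * cos (?w * x)\<bar> \<le> 4 ^ n * \<rho>"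
        "\<bar>g (2 * j0) (T - x) - s j0 * cos (?w * x)\<bar> \<le> 4 ^ n * \<rho>"
        using err[OF jR(1)[OF j0(1)], of "T - ?L + x"] err[OF jR(2)[OF j0(1)], of "T - x"] x T jR(3,4)[OF j0(1)] j0(1)
        by (auto simp: per)
      then have "\<bar>(g (2 * j0 - 1) (T - ?L + x) + g (2 * j0) (T - x)) / 2 - s j0 * cos (?w * x)\<bar> \<le> \<bar>s j0\<bar> / 4"
        using \<rho>(2) by (intro abs_half_sum_le(3)) (auto intro: order_trans)
      then show ?thesis unfolding du_def of_real_diff[symmetric] norm_of_real .
    qed
    \<comment> \<open>Replacing the modulus of the cosine by its smaller square makes the integral
      explicit.\<close>
    have "(LINT x|leb ?L. \<bar>s j0\<bar> * (cos (?w * x))\<^sup>2 - \<bar>s j0\<bar> / 4) \<le> (LINT x|leb ?L. cmod (du T j0 x))"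
    proof (rule integral_mono)
      show "integrable (leb ?L) (\<lambda>x. \<bar>s j0\<bar> * (cos (?w * x))\<^sup>2 - \<bar>s j0\<bar> / 4)"
        by (intro continuous_imp_integrable_real continuous_intros)
      show "integrable (leb ?L) (\<lambda>x. cmod (du T j0 x))"
        by (intro continuous_imp_integrable_real continuous_intros cdu j0)
      fix x assume "x \<in> space (leb ?L)"
      then have x: "x \<in> {0..?L}" by simp
      have "\<bar>cos (?w * x)\<bar> * \<bar>cos (?w * x)\<bar> \<le> 1 * \<bar>cos (?w * x)\<bar>"
        by (rule mult_right_mono) auto
      then have "(cos (?w * x))\<^sup>2 \<le> \<bar>cos (?w * x)\<bar>" by (simp add: power2_eq_square)
      then have "\<bar>s j0\<bar> * (cos (?w * x))\<^sup>2 \<le> \<bar>s j0 * cos (?w * x)\<bar>" by (simp add: abs_mult mult_left_mono)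
      also have "\<dots> = cmod (of_real (s j0 * cos (?w * x)))" by (simp only: norm_of_real)
      also have "\<dots> \<le> cmod (du T j0 x) + \<bar>s j0\<bar> / 4"
        using er[OF x] norm_triangle_ineq2[of "of_real (s j0 * cos (?w * x))" "du T j0 x"]
        by (simp add: norm_minus_commute)
      finally show "\<bar>s j0\<bar> * (cos (?w * x))\<^sup>2 - \<bar>s j0\<bar> / 4 \<le> cmod (du T j0 x)" by simp
    qed
    moreover have "(LINT x|leb ?L. \<bar>s j0\<bar> * (cos (?w * x))\<^sup>2 - \<bar>s j0\<bar> / 4) = 3 / 2 * \<alpha> * ?L"
    proof -
      have "(LINT x|leb ?L. \<bar>s j0\<bar> * (cos (?w * x))\<^sup>2 - \<bar>s j0\<bar> / 4) =
            integral {0..?L} (\<lambda>x. \<bar>s j0\<bar> * (cos (?w * x))\<^sup>2 - \<bar>s j0\<bar> / 4)"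
        by (intro lebesgue_integral_eq_integral continuous_imp_integrable_real continuous_intros) auto
      also have "\<dots> = (\<bar>s j0\<bar> * (?L / 2 + sin (?w * ?L) * cos (?w * ?L) / (2 * ?w)) - \<bar>s j0\<bar> / 4 * ?L) - 
          (\<bar>s j0\<bar> * (0 / 2 + sin (?w * 0) * cos (?w * 0) / (2 * ?w)) - \<bar>s j0\<bar> / 4 * 0)"
      proof (rule integral_eq_diff)
        fix x
        have "\<bar>s j0\<bar> * (1 / 2 + (cos (?w * x) * ?w * cos (?w * x) + (- sin (?w * x) * ?w) * sin (?w * x)) / (2 * ?w)) - \<bar>s j0\<bar> / 4
           = \<bar>s j0\<bar> * (cos (?w * x))\<^sup>2 - \<bar>s j0\<bar> / 4"
        proof -
          have "(cos (?w * x) * ?w * cos (?w * x) + (- sin (?w * x) * ?w) * sin (?w * x)) / (2 * ?w) = ((cos (?w * x))\<^sup>2 - (sin (?w * x))\<^sup>2) / 2"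
            using w0(1) by (simp add: field_simps power2_eq_square)
          also have "\<dots> = (cos (?w * x))\<^sup>2 - 1 / 2" unfolding sin_squared_eq by (simp add: field_simps)
          finally show ?thesis by simp
        qed
        then show "((\<lambda>x. \<bar>s j0\<bar> * (x / 2 + sin (?w * x) * cos (?w * x) / (2 * ?w)) - \<bar>s j0\<bar> / 4 * x) has_real_derivative
            \<bar>s j0\<bar> * (cos (?w * x))\<^sup>2 - \<bar>s j0\<bar> / 4) (at x)"
        proof (rule DERIV_cong[rotated])
          have d: "((\<lambda>x. sin (?w * x)) has_real_derivative cos (?w * x) * ?w) (at x)"
            "((\<lambda>x. cos (?w * x)) has_real_derivative - sin (?w * x) * ?w) (at x)"
            by (auto intro!: derivative_eq_intros)
          show "((\<lambda>x. \<bar>s j0\<bar> * (x / 2 + sin (?w * x) * cos (?w * x) / (2 * ?w)) - \<bar>s j0\<bar> / 4 * x) has_real_derivative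
            \<bar>s j0\<bar> * (1 / 2 + (cos (?w * x) * ?w * cos (?w * x) + (- sin (?w * x) * ?w) * sin (?w * x)) / (2 * ?w)) - \<bar>s j0\<bar> / 4) (at x)"
            by (intro DERIV_diff DERIV_cmult DERIV_add DERIV_cdivide DERIV_mult d DERIV_ident DERIV_cmult_Id)
        qed
      qed (use L in simp)
      also have "\<dots> = 3 / 2 * \<alpha> * ?L" proof -
        have "sin (?w * ?L) = 0" unfolding w0(2) by (rule sin_int_2pin)
        then show ?thesis by (simp add: \<alpha>_def field_simps)
      qed
      finally show ?thesis .
    qed
    ultimately have "3 / 2 * \<alpha> * ?L \<le> (LINT x|leb ?L. cmod (du T j0 x))" by simp
    moreover have "du T j0 \<in> Lp_space ?L p"
    proof -
      have "weak_deriv ?L (fst (U T) j0) \<in> Lp_space ?L p"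
        using sp[OF T] j0(1) by (intro weak_deriv_in_Lp) (auto simp: wave_space_def W1p0_def)
      then show ?thesis
        by (rule Lp_space_AE_cong[OF _ mdu[OF j0(1)]]) (use weak_deriv_AE[OF wd[OF T j0(1)]] in \<open>simp add: du_def\<close>)
    qed
    ultimately have "b \<le> Lp_norm ?L p (du T j0)"
      unfolding b_def by (intro Lp_norm_lower p L \<alpha> continuous_imp_integrable_real cdu j0)
    also have "\<dots> \<le> wave_norm G p (U T)"
      using wave_norm_ge[OF p j0(1), of "U T"] wn[OF j0(1) T] by simp
    finally show ?thesis .
  qed
  have "wave_norm G p (U T) \<le> K * exp (\<gamma> / 2 * T) * wave_norm G p (U 0)"
    using stab[OF const_in_Linf_into[OF d] sp, of 0 U T] sol T by (simp add: a_def)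
  also have "\<dots> \<le> K * exp (\<gamma> / 2 * T) * B'"
    using up K by (intro mult_left_mono) auto
  also have "\<dots> < b" using m by (simp add: T_def)
  finally show False using low by simp
qed

end

section \<open>Flows along walks\<close>

definition step_flow :: "'v network \<Rightarrow> 'v \<Rightarrow> 'v \<Rightarrow> nat \<Rightarrow> real" where
  "step_flow G p q j =
     (if src G j = p \<and> tgt G j = q then 1 else if src G j = q \<and> tgt G j = p then - 1 else 0)"

text \<open>A signed count of traversals: going back and forth along an edge cancels, so a walk can
  have zero flow, and nonvanishing needs an argument of its own.\<close>

fun walk_flow :: "'v network \<Rightarrow> 'v list \<Rightarrow> nat \<Rightarrow> real" where
  "walk_flow G (p # q # ps) j = step_flow G p q j + walk_flow G (q # ps) j"
| "walk_flow G _ j = 0"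

lemma walk_flow_avoid:
  "src G j \<notin> set ps \<or> tgt G j \<notin> set ps \<Longrightarrow> walk_flow G ps j = 0"
proof (induction ps rule: induct_list012)
  case (3 p q ps)
  then have "walk_flow G (q # ps) j = 0" by auto
  moreover have "step_flow G p q j = 0" using 3(3) by (auto simp: step_flow_def)
  ultimately show ?case by simp
qed simp_all

context wave_net
begin

text \<open>\<open>end_sign\<close> is the incidence matrix, so the sum is the net inflow into
  \<open>r\<close>. Only one edge contributes, because distinct edges join distinct pairs.\<close>

lemma step_flow_div:
  assumes "{p, q} \<in> edge_pairs G"
  shows "(\<Sum>j\<in>edges_at G r. end_sign G r j * step_flow G p q j) = of_bool (r = q) - of_bool (r = p)"
proof -
  obtain i where i: "i \<in> edges" "edge_ends G i = {p, q}"
    using assms by (auto simp: edge_pairs_def)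
  have ne: "src G i \<noteq> tgt G i" using edges_atD(4)[OF edge_at_ends(1)[OF i(1)]] .
  have z: "step_flow G p q j = 0" if "j \<in> edges_at G r" "j \<noteq> i" for j
  proof -
    have "inj_on (edge_ends G) edges" using network by (simp add: is_network_def)
    moreover have "j \<in> edges" using that by (simp add: edges_at_def)
    ultimately have "edge_ends G j \<noteq> {p, q}" using inj_onD[of "edge_ends G"] that(2) i by metis
    then show ?thesis by (auto simp: step_flow_def edge_ends_def doubleton_eq_iff)
  qed
  show ?thesis
  proof (cases "i \<in> edges_at G r")
    case True
    then have "(\<Sum>j\<in>edges_at G r. end_sign G r j * step_flow G p q j) = end_sign G r i * step_flow G p q i"
      using z by (subst sum.remove[where x = i]) (auto intro!: sum.neutral)
    moreover have "src G i = p \<and> tgt G i = q \<or> src G i = q \<and> tgt G i = p"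
      using i(2) by (auto simp: edge_ends_def doubleton_eq_iff)
    moreover have "p \<noteq> q" using calculation(2) ne by auto
    moreover have "r = p \<or> r = q" using calculation(2) edges_atD(3)[OF True] by auto
    ultimately show ?thesis by (elim disjE) (simp_all add: step_flow_def end_sign_def)
  next
    case False
    then have "(\<Sum>j\<in>edges_at G r. end_sign G r j * step_flow G p q j) = 0"
      using z by (intro sum.neutral) auto
    moreover have "r \<noteq> p" "r \<noteq> q" using False i by (auto simp: edges_at_def)
    ultimately show ?thesis by simp
  qed
qed

lemma walk_flow_div:
  assumes "graph_path G ps"
  shows "(\<Sum>j\<in>edges_at G r. end_sign G r j * walk_flow G ps j) = of_bool (r = last ps) - of_bool (r = hd ps)"
  using assms
proof (induction ps rule: induct_list012)
  case (3 p q ps)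
  then have "{p, q} \<in> edge_pairs G" "graph_path G (q # ps)" by (auto simp: graph_path_def)
  then show ?case using 3 by (simp add: distrib_left sum.distrib step_flow_div)
qed (auto simp: graph_path_def)

text \<open>The first edge \<open>{p, q}\<close> is used only once: \<open>q\<close> does not recur,
  and the step leaving \<open>q\<close> does not go back to \<open>p\<close>, because the cycle has
  at least three vertices.\<close>

lemma cycle_flow_nonzero:
  assumes "graph_cycle G ps"
  shows "\<exists>j\<in>edges. walk_flow G ps j \<noteq> 0"
proof -
  obtain p qs where ps: "ps = p # qs" using assms by (cases ps) (auto simp: graph_cycle_def graph_path_def)
  have c3: "card (set ps) \<ge> 3" and pl: "last ps = p" and d: "distinct qs" and gp: "graph_path G ps"
    using assms ps by (auto simp: graph_cycle_def)
  obtain q rs where qs: "qs = q # rs" using c3 ps by (cases qs) auto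
  obtain y zs where rs: "rs = y # zs" using c3 ps qs pl by (cases rs) auto
  have "zs \<noteq> []"
  proof
    assume "zs = []"
    then have "set ps = {q, p}" using ps qs rs pl by auto
    then have "card (set ps) \<le> 2" using card_length[of "[q, p]"] by simp
    then show False using c3 by simp
  qed
  then have "last zs = p" using pl ps qs rs by simp
  then have pz: "p \<in> set zs" using \<open>zs \<noteq> []\<close> last_in_set by blast
  have pq: "{p, q} \<in> edge_pairs G" using gp ps qs by (simp add: graph_path_def)
  then obtain i where i: "i \<in> edges" "edge_ends G i = {p, q}" by (auto simp: edge_pairs_def)
  have ne: "src G i \<noteq> tgt G i" using edges_atD(4)[OF edge_at_ends(1)[OF i(1)]] .
  have "q \<notin> set rs" "y \<noteq> p" using d qs rs pz by auto
  then have "walk_flow G rs i = 0" "step_flow G q y i = 0"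
    using i(2) by (auto intro!: walk_flow_avoid simp: edge_ends_def doubleton_eq_iff step_flow_def)
  then have "walk_flow G ps i = step_flow G p q i" using ps qs rs by simp
  also have "\<dots> \<noteq> 0" using i(2) by (auto simp: edge_ends_def doubleton_eq_iff step_flow_def)
  finally show ?thesis using i(1) by blast
qed

text \<open>With a single edge at \<open>q\<close>, nothing else could balance its flow.\<close>

lemma flow_zero_at_exterior:
  assumes "q \<notin> int_verts G" "j \<in> edges_at G q" "(\<Sum>j\<in>edges_at G q. end_sign G q j * s j) = 0"
  shows "s j = 0"
proof -
  have "end_sign G q j * s j = 0" using assms(3) edges_at_not_int[OF assms(1,2)] by simp
  then show ?thesis by (auto simp: end_sign_def split: if_splits)
qed

text \<open>A zero flow would have no source at the first vertex.\<close>

lemma path_flow_nonzero: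
  assumes "graph_path G ps" "hd ps \<noteq> last ps"
  shows "\<exists>j\<in>edges. walk_flow G ps j \<noteq> 0"
proof (rule ccontr)
  assume "\<not> ?thesis"
  then have "(\<Sum>j\<in>edges_at G (hd ps). end_sign G (hd ps) j * walk_flow G ps j) = 0"
    by (intro sum.neutral) (auto simp: edges_at_def)
  then show False using walk_flow_div[OF assms(1), of "hd ps"] assms(2) by simp
qed

text \<open>The flow of a closed walk vanishes on all edges at exterior vertices, so the wave meets
  no damping and any \<open>d\<close> will do. An open walk has flow in or out only at its two ends,
  so the damping has to be small only there.\<close>

lemma not_exp_stable_if_walk:
  fixes \<nu> :: "'d::finite \<Rightarrow> 'v" and D :: "(real ^ 'd) set"
  assumes p: "1 \<le> p" and D0: "D \<subseteq> {x. \<forall>i. 0 \<le> x $ i}"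
    and ps: "graph_path G ps" and nz: "\<exists>j\<in>edges. walk_flow G ps j \<noteq> 0"
    and ends: "hd ps = last ps \<or> hd ps \<notin> int_verts G \<and> last ps \<notin> int_verts G"
    and small: "\<And>e. e > 0 \<Longrightarrow> \<exists>d\<in>D. hd ps = last ps \<or>
        (\<forall>q\<in>{hd ps, last ps} \<inter> damped G. d $ inv \<nu> q \<le> e)"
  shows "\<not> wave_exp_stable G \<nu> (Linf_into D) p"
proof -
  obtain j where j: "j \<in> edges" "walk_flow G ps j \<noteq> 0" using nz by blast
  have div0: "(\<Sum>j\<in>edges_at G q. end_sign G q j * walk_flow G ps j) = 0"
    if "hd ps = last ps \<or> q \<notin> {hd ps, last ps}" for q
    using walk_flow_div[OF ps, of q] that by auto
  show ?thesis
  proof (rule not_exp_stable_if_flow[where s = "walk_flow G ps", OF p D0 j])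
    fix q assume "q \<in> int_verts G"
    then show "(\<Sum>j\<in>edges_at G q. end_sign G q j * walk_flow G ps j) = 0" using ends by (intro div0) auto
  next
    fix e :: real assume "e > 0"
    from small[OF this] obtain d where d: "d \<in> D" "hd ps = last ps \<or> (\<forall>q\<in>{hd ps, last ps} \<inter> damped G. d $ inv \<nu> q \<le> e)"
      by blast
    have "walk_flow G ps j = 0 \<or> d $ inv \<nu> q \<le> e" if q: "q \<in> damped G" "j \<in> edges_at G q" for q j
    proof (cases "hd ps = last ps \<or> q \<notin> {hd ps, last ps}")
      case True
      then show ?thesis using flow_zero_at_exterior[OF damped_not_int[OF q(1)] q(2) div0] by blast
    qed (use d q in auto)
    then show "\<exists>d\<in>D. \<forall>q\<in>damped G. \<forall>j\<in>edges_at G q. walk_flow G ps j = 0 \<or> d $ inv \<nu> q \<le> e"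
      using d(1) by blast
  qed
qed

lemma exp_stable_necessary:
  fixes \<nu> :: "'d::finite \<Rightarrow> 'v" and D :: "(real ^ 'd) set"
  assumes p: "1 \<le> p" and st: "wave_exp_stable G \<nu> (Linf_into D) p"
    and \<nu>: "bij_betw \<nu> UNIV (damped G)" and D: "D \<noteq> {}" and D0: "D \<subseteq> {x. \<forall>i. 0 \<le> x $ i}"
  shows "graph_tree G \<and> card (undamped G) = 1 \<and> closure D \<subseteq> {x. \<forall>i. 0 < x $ i}"
proof (intro conjI)
  have con: "graph_connected G" using network by (simp add: is_network_def)
  have ext: "damped G \<subseteq> verts G" "undamped G \<subseteq> verts G"
    and disj: "damped G \<inter> undamped G = {}" and une: "undamped G \<noteq> {}"
    using network by (auto simp: is_network_def ext_verts_def)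
  have D1: "\<exists>d. d \<in> D" using D by blast
  show "graph_tree G"
    unfolding graph_tree_def
  proof (intro conjI notI con; elim exE)
    fix ps assume c: "graph_cycle G ps"
    have "\<not> wave_exp_stable G \<nu> (Linf_into D) p"
      by (rule not_exp_stable_if_walk[OF p D0 _ cycle_flow_nonzero[OF c]])
        (use c D1 in \<open>auto simp: graph_cycle_def\<close>)
    with st show False by blast
  qed
  have path: "\<exists>ps. graph_path G ps \<and> hd ps = x \<and> last ps = y" if "x \<in> verts G" "y \<in> verts G" for x y
    using con that by (auto simp: graph_connected_def)
  show "card (undamped G) = 1"
  proof (rule ccontr)
    assume "card (undamped G) \<noteq> 1"
    then obtain x y where xy: "x \<in> undamped G" "y \<in> undamped G" "x \<noteq> y"
      using une by (metis is_singletonI' is_singleton_altdef)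
    then obtain ps where ps: "graph_path G ps" "hd ps = x" "last ps = y" using path ext by blast
    have "\<not> wave_exp_stable G \<nu> (Linf_into D) p"
      by (rule not_exp_stable_if_walk[OF p D0 ps(1) path_flow_nonzero[OF ps(1)]])
        (use xy ps D1 undamped_not_int disj in auto)
    with st show False by blast
  qed
  show "closure D \<subseteq> {x. \<forall>i. 0 < x $ i}"
  proof (intro subsetI CollectI allI, rule ccontr)
    fix x i assume x: "x \<in> closure D" and i: "\<not> 0 < x $ i"
    obtain y where y: "y \<in> undamped G" using une by blast
    have qd: "\<nu> i \<in> damped G" using \<nu> by (auto simp: bij_betw_def)
    \<comment> \<open>The other end is undamped, so only one coordinate of \<open>d\<close> has to
      be small; points of \<open>D\<close> near \<open>x\<close> provide this.\<close>
    obtain ps where ps: "graph_path G ps" "hd ps = \<nu> i" "last ps = y" using path ext y qd by blast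
    have inv: "inv \<nu> (\<nu> i) = i" using \<nu> by (simp add: bij_betw_def)
    have "\<not> wave_exp_stable G \<nu> (Linf_into D) p"
    proof (rule not_exp_stable_if_walk[OF p D0 ps(1) path_flow_nonzero[OF ps(1)]])
      show "hd ps \<noteq> last ps" using ps y qd disj by auto
      show "hd ps = last ps \<or> hd ps \<notin> int_verts G \<and> last ps \<notin> int_verts G"
        using ps y qd undamped_not_int damped_not_int by auto
      fix e :: real assume "e > 0"
      then obtain d where d: "d \<in> D" "dist d x < e" using x by (meson closure_approachable)
      have "d $ i - x $ i \<le> dist d x"
        using component_le_norm_cart[of "d - x" i] by (simp add: dist_norm)
      then have "d $ i \<le> e" using d i by simp
      then show "\<exists>d\<in>D. hd ps = last ps \<or> (\<forall>q\<in>{hd ps, last ps} \<inter> damped G. d $ inv \<nu> q \<le> e)"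
        using d(1) inv ps y disj by auto
    qed
    with st show False by blast
  qed
qed

end

section \<open>Trees\<close>

lemma graph_path_append:
  "ps \<noteq> [] \<Longrightarrow> qs \<noteq> [] \<Longrightarrow> graph_path G (ps @ qs) \<longleftrightarrow>
     graph_path G ps \<and> graph_path G qs \<and> {last ps, hd qs} \<in> edge_pairs G"
  by (auto simp: graph_path_def successively_append_iff)

lemma graph_path_rev: "graph_path G (rev ps) \<longleftrightarrow> graph_path G ps"
  by (auto simp: graph_path_def successively_rev insert_commute)

text \<open>The segment between two occurrences of a vertex can be cut out.\<close>

lemma graph_path_distinct:
  assumes "graph_path G ps"
  shows "\<exists>qs. graph_path G qs \<and> hd qs = hd ps \<and> last qs = last ps \<and> set qs \<subseteq> set ps \<and> distinct qs"
  using assms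
proof (induction "length ps" arbitrary: ps rule: less_induct)
  case less
  show ?case
  proof (cases "distinct ps")
    case False
    then obtain xs ys zs y where ps: "ps = xs @ [y] @ ys @ [y] @ zs" using not_distinct_decomp by blast
    let ?qs = "xs @ [y] @ zs"
    have "graph_path G ?qs"
      using less.prems unfolding ps graph_path_def by (cases zs) (auto simp: successively_append_iff successively_Cons)
    moreover have "length ?qs < length ps" using ps by simp
    ultimately obtain qs where "graph_path G qs" "hd qs = hd ?qs" "last qs = last ?qs" "set qs \<subseteq> set ?qs" "distinct qs"
      using less.hyps by blast
    moreover have "hd ?qs = hd ps" "last ?qs = last ps" "set ?qs \<subseteq> set ps" unfolding ps by (auto simp: hd_append)
    ultimately show ?thesis by (metis subset_trans)
  qed (use less.prems in auto)
qed

text \<open>The depth of \<open>q\<close> when the network is rooted at \<open>r\<close>; it orders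
  the induction from the leaves to the root.\<close>

definition hops :: "'v network \<Rightarrow> 'v \<Rightarrow> 'v \<Rightarrow> nat" where
  "hops G r q = (LEAST n. \<exists>ps. graph_path G ps \<and> hd ps = r \<and> last ps = q \<and> length ps = Suc n)"

definition other_end :: "'v network \<Rightarrow> 'v \<Rightarrow> nat \<Rightarrow> 'v" where
  "other_end G q j = (if src G j = q then tgt G j else src G j)"

lemma hops_le:
  assumes "graph_path G ps" "hd ps = r" "last ps = q"
  shows "hops G r q < length ps"
proof -
  obtain n where n: "length ps = Suc n" using assms by (cases ps) (auto simp: graph_path_def)
  then have "hops G r q \<le> n" unfolding hops_def using assms by (intro Least_le) blast
  then show ?thesis using n by simp
qed

context wave_net
begin

lemma other_end:
  assumes "j \<in> edges_at G q"
  shows "j \<in> edges_at G (other_end G q j)" "other_end G q j \<noteq> q" "{q, other_end G q j} \<in> edge_pairs G"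
    "other_end G q j \<in> verts G"
proof -
  note d = edges_atD[OF assms]
  have j: "j \<in> edges" using d by simp
  have e: "edge_ends G j = {q, other_end G q j}" using d(3) by (auto simp: edge_ends_def other_end_def)
  show "j \<in> edges_at G (other_end G q j)" using j e by (simp add: edges_at_def)
  show "other_end G q j \<noteq> q" using d(3,4) by (auto simp: other_end_def)
  show "{q, other_end G q j} \<in> edge_pairs G" unfolding edge_pairs_def e[symmetric] using j by blast
  show "other_end G q j \<in> verts G" using d(5,6) by (simp add: other_end_def)
qed

lemma other_end_inj:
  assumes "i \<in> edges_at G q" "j \<in> edges_at G q" "other_end G q i = other_end G q j"
  shows "i = j"
proof -
  have "edge_ends G k = {q, other_end G q k}" if "k \<in> edges_at G q" for k
    using edges_atD(3)[OF that] by (auto simp: edge_ends_def other_end_def)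
  then have "edge_ends G i = edge_ends G j" using assms by simp
  moreover have "inj_on (edge_ends G) edges" using network by (simp add: is_network_def)
  moreover have "i \<in> edges" "j \<in> edges" using assms by (simp_all add: edges_at_def)
  ultimately show ?thesis using inj_onD by metis
qed

lemma shortest_path:
  assumes "r \<in> verts G" "q \<in> verts G"
  obtains ps where "graph_path G ps" "hd ps = r" "last ps = q" "length ps = Suc (hops G r q)"
proof -
  obtain ps where ps: "graph_path G ps" "hd ps = r" "last ps = q"
    using network assms unfolding is_network_def graph_connected_def by blast
  moreover have "length ps = Suc (length ps - 1)" using ps by (cases ps) (auto simp: graph_path_def)
  ultimately have "\<exists>n ps. graph_path G ps \<and> hd ps = r \<and> last ps = q \<and> length ps = Suc n" by blast
  from LeastI_ex[OF this, folded hops_def] show ?thesis using that by blast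
qed

text \<open>If \<open>q\<close> lay on a shortest path to \<open>a\<close>, it would be strictly
  closer to \<open>r\<close> than \<open>a\<close>.\<close>

lemma shortest_path_avoids:
  assumes r: "r \<in> verts G" and a: "a \<in> verts G" and q: "q \<noteq> a" "hops G r a \<le> hops G r q"
  obtains ps where "graph_path G ps" "hd ps = r" "last ps = a" "q \<notin> set ps"
proof -
  obtain ps where ps: "graph_path G ps" "hd ps = r" "last ps = a" "length ps = Suc (hops G r a)"
    using shortest_path[OF r a] by metis
  have "q \<notin> set ps"
  proof
    assume "q \<in> set ps"
    then obtain xs ys where "ps = xs @ q # ys" using split_list by metis
    then have s: "ps = (xs @ [q]) @ ys" by simp
    have "ys \<noteq> []" using s ps(3) q(1) by auto
    then have "graph_path G (xs @ [q])" using ps(1) s graph_path_append[of "xs @ [q]" ys] by simp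
    moreover have "hd (xs @ [q]) = r" using ps(2) s by (auto simp: hd_append)
    ultimately have "hops G r q < length (xs @ [q])" by (intro hops_le) auto
    moreover have "length (xs @ [q]) < length ps" using s \<open>ys \<noteq> []\<close> by simp
    ultimately show False using ps(4) q(2) by linarith
  qed
  with ps show ?thesis using that by blast
qed

text \<open>Otherwise the two neighbours would be joined through \<open>r\<close> by a path avoiding \<open>q\<close>.\<close>

lemma tree_unique_parent:
  assumes tree: "graph_tree G" and r: "r \<in> verts G"
    and i: "i \<in> edges_at G q" "hops G r (other_end G q i) \<le> hops G r q"
    and j: "j \<in> edges_at G q" "hops G r (other_end G q j) \<le> hops G r q"
  shows "i = j"
proof (rule ccontr)
  assume "i \<noteq> j"
  define a where "a = other_end G q i"
  define b where "b = other_end G q j"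
  have ab: "a \<noteq> b" using other_end_inj[OF i(1) j(1)] \<open>i \<noteq> j\<close> by (auto simp: a_def b_def)
  have aq: "a \<noteq> q" "{q, a} \<in> edge_pairs G" "a \<in> verts G" using other_end[OF i(1)] by (auto simp: a_def)
  have bq: "b \<noteq> q" "{q, b} \<in> edge_pairs G" "b \<in> verts G" using other_end[OF j(1)] by (auto simp: b_def)
  obtain ps where ps: "graph_path G ps" "hd ps = r" "last ps = a" "q \<notin> set ps"
    using shortest_path_avoids[OF r aq(3), of q] aq i by (metis a_def)
  obtain qs where qs: "graph_path G qs" "hd qs = r" "last qs = b" "q \<notin> set qs"
    using shortest_path_avoids[OF r bq(3), of q] bq j by (metis b_def)
  obtain qt where qt: "qs = r # qt" using qs by (cases qs) (auto simp: graph_path_def)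
  obtain pt where pt: "ps = r # pt" using ps by (cases ps) (auto simp: graph_path_def)
  \<comment> \<open>From \<open>a\<close> to \<open>r\<close> and on to \<open>b\<close>;
    \<open>qt\<close> omits the second copy of \<open>r\<close>.\<close>
  let ?w = "rev ps @ qt"
  have gp: "graph_path G (rev ps)" using ps(1) graph_path_rev by blast
  have lr: "last (rev ps) = r" "rev ps \<noteq> []" using ps(2) pt by (auto simp: last_rev)
  have w: "graph_path G ?w \<and> last ?w = b"
  proof (cases "qt = []")
    case True
    moreover have "b = r" using qs(3) qt True by simp
    ultimately show ?thesis using gp lr by simp
  next
    case False
    then have "{r, hd qt} \<in> edge_pairs G" "graph_path G qt"
      using qs(1) graph_path_append[of "[r]" qt] qt by auto
    then have "graph_path G ?w"
      using graph_path_append[of "rev ps" qt G] False gp lr by simp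
    then show ?thesis using False qs(3) qt by simp
  qed
  moreover have "hd ?w = a" using ps(3) pt by (auto simp: hd_append hd_rev split: if_splits)
  moreover have "q \<notin> set ?w" using ps(4) qs(4) qt by auto
  ultimately obtain ws where ws: "graph_path G ws" "hd ws = a" "last ws = b" "q \<notin> set ws" "distinct ws"
    using graph_path_distinct[of G ?w] by blast
  have wne: "ws \<noteq> []" using ws(1) by (simp add: graph_path_def)
  have q: "q \<in> verts G" using edges_atD(7)[OF i(1)] .
  then have q1: "graph_path G [q]" by (simp add: graph_path_def)
  have "graph_path G (ws @ [q])"
    using graph_path_append[of ws "[q]" G] wne ws q1 bq by (simp add: insert_commute)
  then have p: "graph_path G ([q] @ ws @ [q])"
    using graph_path_append[of "[q]" "ws @ [q]" G] wne ws q1 aq by simp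
  have "{q, a, b} \<subseteq> set ([q] @ ws @ [q])" using ws wne hd_in_set[of ws] last_in_set[of ws] by auto
  moreover have "card {q, a, b} = 3" using ab aq bq by auto
  ultimately have "card (set ([q] @ ws @ [q])) \<ge> 3" by (metis card_mono finite_set)
  with p ws have "graph_cycle G ([q] @ ws @ [q])" by (simp add: graph_cycle_def)
  with tree show False by (auto simp: graph_tree_def)
qed

end

section \<open>Observability on trees\<close>

lemma integral_le_AE:
  fixes f g :: "real \<Rightarrow> real"
  assumes f: "f integrable_on S" and g: "g integrable_on S" and le: "AE x in lebesgue. x \<in> S \<longrightarrow> f x \<le> g x"
  shows "integral S f \<le> integral S g"
proof -
  obtain N where N: "{x. \<not> (x \<in> S \<longrightarrow> f x \<le> g x)} \<subseteq> N" "N \<in> null_sets lebesgue"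
    using le by (auto simp: eventually_ae_filter)
  have neg: "negligible N" using N(2) by (simp add: negligible_iff_null_sets)
  have "integral S f = integral S (\<lambda>x. if x \<in> N then 0 else f x)"
    by (rule integral_spike[OF neg]) auto
  also have "\<dots> \<le> integral S (\<lambda>x. if x \<in> N then 0 else g x)"
  proof (rule integral_le)
    show "(\<lambda>x. if x \<in> N then 0 else f x) integrable_on S"
      using f by (rule integrable_spike[OF _ neg]) auto
    show "(\<lambda>x. if x \<in> N then 0 else g x) integrable_on S"
      using g by (rule integrable_spike[OF _ neg]) auto
  qed (use N(1) in auto)
  also have "\<dots> = integral S g"
    by (rule integral_spike[OF neg]) auto
  finally show ?thesis .
qed

lemma integral_shift_minus:
  fixes f :: "real \<Rightarrow> real"
  shows "integral {a..b} (\<lambda>x. f (x - c)) = integral {a - c..b - c} f"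
  using integral_shift_real_ivl[of "a - c" "- c" "b - c" f] by simp

lemma integrable_shift_minus:
  fixes f :: "real \<Rightarrow> real"
  shows "(\<lambda>x. f (x - c)) integrable_on {a..b} \<longleftrightarrow> f integrable_on {a - c..b - c}"
  using integrable_shift_real_ivl_iff[of f "- c" "a - c" "b - c"] by simp

context wave_net
begin

text \<open>Every damped vertex absorbs at least the fraction \<open>\<kappa>\<close> of the energy arriving there.\<close>

definition trajectory :: "real \<Rightarrow> (real \<Rightarrow> 'v \<Rightarrow> real) \<Rightarrow> (nat \<Rightarrow> real \<Rightarrow> complex) \<Rightarrow> bool" where
  "trajectory \<kappa> a g \<longleftrightarrow>
     (\<forall>i\<in>components. \<forall>t. (\<lambda>s. (cmod (g i s))\<^sup>2) integrable_on {- tlen G i..t}) \<and>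
     (\<forall>i\<in>components. AE t in lebesgue. t \<ge> 0 \<longrightarrow> g i t = scatter (a t) i (\<lambda>k. g k (t - tlen G k))) \<and>
     (\<forall>q\<in>damped G. \<forall>t. \<kappa> \<le> 1 - (refl_coeff G (a t) q)\<^sup>2)"

definition arriving :: "(nat \<Rightarrow> real \<Rightarrow> complex) \<Rightarrow> 'v \<Rightarrow> nat \<Rightarrow> real \<Rightarrow> complex" where
  "arriving g q j t = g (in_ix G q j) (t - len G j)"

definition leaving :: "(nat \<Rightarrow> real \<Rightarrow> complex) \<Rightarrow> 'v \<Rightarrow> nat \<Rightarrow> real \<Rightarrow> complex" where
  "leaving g q j t = g (out_ix G q j) t"

definition end_energy :: "(nat \<Rightarrow> real \<Rightarrow> complex) \<Rightarrow> 'v \<Rightarrow> nat \<Rightarrow> real \<Rightarrow> real" where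
  "end_energy g q j t = (cmod (arriving g q j t))\<^sup>2 + (cmod (leaving g q j t))\<^sup>2"

definition damped_energy :: "(nat \<Rightarrow> real \<Rightarrow> complex) \<Rightarrow> real \<Rightarrow> real" where
  "damped_energy g t = (\<Sum>q\<in>damped G. \<Sum>j\<in>edges_at G q. (cmod (arriving g q j t))\<^sup>2)"

lemma finite_damped: "finite (damped G)"
proof -
  have "damped G \<subseteq> verts G" using network by (auto simp: is_network_def ext_verts_def)
  then show ?thesis using finite_verts finite_subset by blast
qed

lemma damped_subset: "damped G \<subseteq> verts G"
  using network by (auto simp: is_network_def ext_verts_def)

lemma trajectory_integrable:
  assumes "trajectory \<kappa> a g" "i \<in> components" "x \<ge> - tlen G i"
  shows "(\<lambda>s. (cmod (g i s))\<^sup>2) integrable_on {x..y}"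
  using assms unfolding trajectory_def by (meson atLeastatMost_subset_iff integrable_subinterval_real order_refl)

lemma trajectory_law:
  assumes "trajectory \<kappa> a g"
  shows "AE t in lebesgue. t \<ge> 0 \<longrightarrow> (\<forall>q. \<forall>j\<in>edges_at G q. leaving g q j t =
    (if q \<in> int_verts G then arriving g q j t -
        (end_sign G q j * (2 / real (vdegree G q))) *\<^sub>R (\<Sum>l\<in>edges_at G q. end_sign G q l *\<^sub>R arriving g q l t)
      else refl_coeff G (a t) q *\<^sub>R arriving g q j t))"
proof -
  have "AE t in lebesgue. \<forall>i\<in>components. t \<ge> 0 \<longrightarrow> g i t = scatter (a t) i (\<lambda>k. g k (t - tlen G k))"
    using assms by (intro AE_finite_allI) (auto simp: trajectory_def)
  then show ?thesis
  proof eventually_elim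
    case (elim t)
    show ?case
    proof (intro impI allI ballI)
      fix q j assume t: "t \<ge> 0" and j: "j \<in> edges_at G q"
      have "(\<Sum>l\<in>edges_at G q. end_sign G q l *\<^sub>R g (in_ix G q l) (t - tlen G (in_ix G q l))) =
         (\<Sum>l\<in>edges_at G q. end_sign G q l *\<^sub>R arriving g q l t)"
        by (intro sum.cong) (auto simp: arriving_def)
      moreover have "leaving g q j t = scatter (a t) (out_ix G q j) (\<lambda>k. g k (t - tlen G k))"
        using elim t ix_range(2)[OF j] unfolding leaving_def by blast
      ultimately show "leaving g q j t =
        (if q \<in> int_verts G then arriving g q j t -
            (end_sign G q j * (2 / real (vdegree G q))) *\<^sub>R (\<Sum>l\<in>edges_at G q. end_sign G q l *\<^sub>R arriving g q l t)
          else refl_coeff G (a t) q *\<^sub>R arriving g q j t)"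
        unfolding scatter_out[OF j] using tlen_ix(1)[OF j] by (simp add: arriving_def)
    qed
  qed
qed

lemma arriving_integrable:
  assumes "trajectory \<kappa> a g" "j \<in> edges_at G q" "x \<ge> 0"
  shows "(\<lambda>t. (cmod (arriving g q j t))\<^sup>2) integrable_on {x..y}"
  unfolding arriving_def integrable_shift_minus[of "\<lambda>t. (cmod (g (in_ix G q j) t))\<^sup>2" "len G j"]
  using assms tlen_ix(1)[OF assms(2)] by (intro trajectory_integrable[OF assms(1) ix_range(1)[OF assms(2)]]) auto

lemma leaving_integrable:
  assumes "trajectory \<kappa> a g" "j \<in> edges_at G q" "x \<ge> - len G j"
  shows "(\<lambda>t. (cmod (leaving g q j t))\<^sup>2) integrable_on {x..y}"
  unfolding leaving_def 
  using assms tlen_ix(2)[OF assms(2)] by (intro trajectory_integrable[OF assms(1) ix_range(2)[OF assms(2)]]) auto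

lemma end_energy_integrable:
  assumes "trajectory \<kappa> a g" "j \<in> edges_at G q" "x \<ge> 0"
  shows "end_energy g q j integrable_on {x..y}"
  unfolding end_energy_def using assms edges_atD(8)[OF assms(2)]
  by (intro integrable_add arriving_integrable leaving_integrable) auto

lemma damped_energy_integrable:
  assumes "trajectory \<kappa> a g" "x \<ge> 0"
  shows "damped_energy g integrable_on {x..y}"
  unfolding damped_energy_def using assms
  by (intro integrable_sum arriving_integrable finite_damped) auto

lemma end_energy_nonneg: "end_energy g q j t \<ge> 0"
  by (simp add: end_energy_def)

lemma damped_energy_nonneg: "damped_energy g t \<ge> 0"
  unfolding damped_energy_def by (intro sum_nonneg) auto

text \<open>One constant serves as factor and as time margin at both ends, the margin accounting for
  travel times to the damped vertices. With a single constant the property is monotone in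
  \<open>C\<close>; on intervals shorter than \<open>2 * C\<close> the left side is an integral over
  the empty set, hence 0.\<close>

definition observable :: "real \<Rightarrow> 'v \<Rightarrow> nat \<Rightarrow> real \<Rightarrow> bool" where
  "observable \<kappa> q j C \<longleftrightarrow> (\<forall>a g \<alpha> \<beta>. trajectory \<kappa> a g \<longrightarrow> 0 \<le> \<alpha> \<longrightarrow>
     integral {\<alpha> + C..\<beta> - C} (end_energy g q j) \<le> C * integral {\<alpha>..\<beta>} (damped_energy g))"

lemma damped_energy_integral_nonneg:
  "trajectory \<kappa> a g \<Longrightarrow> 0 \<le> \<alpha> \<Longrightarrow> integral {\<alpha>..\<beta>} (damped_energy g) \<ge> 0"
  by (intro integral_nonneg damped_energy_integrable) (auto intro: damped_energy_nonneg)

lemma observable_mono: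
  assumes o: "observable \<kappa> q j C" and C: "0 \<le> C" "C \<le> C'" and j: "j \<in> edges_at G q"
  shows "observable \<kappa> q j C'"
  unfolding observable_def
proof (intro allI impI)
  fix a g and \<alpha> \<beta> :: real assume t: "trajectory \<kappa> a g" and \<alpha>: "0 \<le> \<alpha>"
  have "integral {\<alpha> + C'..\<beta> - C'} (end_energy g q j) \<le> integral {\<alpha> + C..\<beta> - C} (end_energy g q j)"
    using C \<alpha> by (intro integral_subset_le end_energy_integrable[OF t j]) (auto intro: end_energy_nonneg)
  also have "\<dots> \<le> C * integral {\<alpha>..\<beta>} (damped_energy g)" using o t \<alpha> by (auto simp: observable_def)
  also have "\<dots> \<le> C' * integral {\<alpha>..\<beta>} (damped_energy g)"
    using C damped_energy_integral_nonneg[OF t \<alpha>] by (intro mult_right_mono)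
  finally show "integral {\<alpha> + C'..\<beta> - C'} (end_energy g q j) \<le> C' * integral {\<alpha>..\<beta>} (damped_energy g)" .
qed

text \<open>What leaves \<open>q\<close> reaches \<open>q'\<close> one travel time later, and what
  arrives at \<open>q\<close> left \<open>q'\<close> one travel time earlier. So the energy at
  \<open>q'\<close> is controlled by that at \<open>q\<close> over an interval longer by
  \<open>len G j\<close> on each side.\<close>

lemma observable_transfer:
  assumes o: "observable \<kappa> q j C" and C: "0 \<le> C" and j: "j \<in> edges_at G q" "j \<in> edges_at G q'" and ne: "q \<noteq> q'"
  shows "observable \<kappa> q' j (C + len G j)"
  unfolding observable_def
proof (intro allI impI)
  fix a g and \<alpha> \<beta> :: real assume t: "trajectory \<kappa> a g" and \<alpha>: "0 \<le> \<alpha>"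
  let ?L = "len G j" and ?x = "\<alpha> + C" and ?y = "\<beta> - C"
  have L: "?L > 0" using edges_atD(8)[OF j(1)] .
  have ix: "in_ix G q' j = out_ix G q j" "out_ix G q' j = in_ix G q j"
    using edges_atD(3,4)[OF j(1)] edges_atD(3)[OF j(2)] ne by (auto simp: in_ix_def out_ix_def)
  have E: "end_energy g q' j s = (cmod (leaving g q j (s - ?L)))\<^sup>2 + (cmod (arriving g q j (s - (- ?L))))\<^sup>2" for s
    by (simp add: end_energy_def arriving_def leaving_def ix)
  have i1: "(\<lambda>s. (cmod (leaving g q j (s - ?L)))\<^sup>2) integrable_on {?x + ?L..?y - ?L}"
    unfolding integrable_shift_minus[of "\<lambda>s. (cmod (leaving g q j s))\<^sup>2"]
    using \<alpha> C L by (intro leaving_integrable[OF t j(1)]) auto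
  have i2: "(\<lambda>s. (cmod (arriving g q j (s - (- ?L))))\<^sup>2) integrable_on {?x + ?L..?y - ?L}"
    unfolding integrable_shift_minus[of "\<lambda>s. (cmod (arriving g q j s))\<^sup>2"]
    using \<alpha> C L by (intro arriving_integrable[OF t j(1)]) auto
  have "integral {\<alpha> + (C + ?L)..\<beta> - (C + ?L)} (end_energy g q' j) = integral {?x + ?L..?y - ?L} (end_energy g q' j)"
    by (simp add: algebra_simps)
  also have "\<dots> = integral {?x + ?L..?y - ?L} (\<lambda>s. (cmod (leaving g q j (s - ?L)))\<^sup>2) +
      integral {?x + ?L..?y - ?L} (\<lambda>s. (cmod (arriving g q j (s - (- ?L))))\<^sup>2)"
    unfolding E[abs_def] by (rule integral_add[OF i1 i2])
  also have "\<dots> = integral {?x + ?L - ?L..?y - ?L - ?L} (\<lambda>s. (cmod (leaving g q j s))\<^sup>2) +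
      integral {?x + ?L - (- ?L)..?y - ?L - (- ?L)} (\<lambda>s. (cmod (arriving g q j s))\<^sup>2)"
    by (simp only: integral_shift_minus[of _ _ "\<lambda>s. (cmod (leaving g q j s))\<^sup>2"] integral_shift_minus[of _ _ "\<lambda>s. (cmod (arriving g q j s))\<^sup>2"])
  also have "\<dots> \<le> integral {?x..?y} (\<lambda>s. (cmod (leaving g q j s))\<^sup>2) + integral {?x..?y} (\<lambda>s. (cmod (arriving g q j s))\<^sup>2)"
    using \<alpha> C L by (intro add_mono integral_subset_le leaving_integrable[OF t j(1)] arriving_integrable[OF t j(1)]) auto
  also have "\<dots> = integral {?x..?y} (end_energy g q j)"
    unfolding end_energy_def using \<alpha> C L
    by (subst integral_add) (auto intro!: leaving_integrable[OF t j(1)] arriving_integrable[OF t j(1)])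
  also have "\<dots> \<le> C * integral {\<alpha>..\<beta>} (damped_energy g)" using o t \<alpha> by (auto simp: observable_def)
  also have "\<dots> \<le> (C + ?L) * integral {\<alpha>..\<beta>} (damped_energy g)"
    using L damped_energy_integral_nonneg[OF t \<alpha>] by (intro mult_right_mono) auto
  finally show "integral {\<alpha> + (C + ?L)..\<beta> - (C + ?L)} (end_energy g q' j) \<le> (C + ?L) * integral {\<alpha>..\<beta>} (damped_energy g)" .
qed

text \<open>Reflection does not enlarge the wave, so arriving and leaving energy together are at
  most twice the arriving one.\<close>

lemma observable_damped:
  assumes \<kappa>: "\<kappa> \<ge> 0" and q: "q \<in> damped G" and j: "j \<in> edges_at G q"
  shows "observable \<kappa> q j 2"
  unfolding observable_def
proof (intro allI impI)
  fix a g and \<alpha> \<beta> :: real assume t: "trajectory \<kappa> a g" and \<alpha>: "0 \<le> \<alpha>"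
  have "integral {\<alpha> + 2..\<beta> - 2} (end_energy g q j) \<le> integral {\<alpha> + 2..\<beta> - 2} (\<lambda>s. 2 * damped_energy g s)"
  proof (rule integral_le_AE)
    show "end_energy g q j integrable_on {\<alpha> + 2..\<beta> - 2}" using \<alpha> by (intro end_energy_integrable[OF t j]) auto
    show "(\<lambda>s. 2 * damped_energy g s) integrable_on {\<alpha> + 2..\<beta> - 2}"
      using \<alpha> by (intro integrable_on_mult_right damped_energy_integrable[OF t]) auto
    from trajectory_law[OF t] show "AE s in lebesgue. s \<in> {\<alpha> + 2..\<beta> - 2} \<longrightarrow> end_energy g q j s \<le> 2 * damped_energy g s"
    proof eventually_elim
      case (elim s)
      show ?case
      proof
        assume s: "s \<in> {\<alpha> + 2..\<beta> - 2}"
        let ?c = "refl_coeff G (a s) q"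
        have "leaving g q j s = ?c *\<^sub>R arriving g q j s"
          using elim s \<alpha> j damped_not_int[OF q] by auto
        then have "(cmod (leaving g q j s))\<^sup>2 = ?c\<^sup>2 * (cmod (arriving g q j s))\<^sup>2"
          by (simp add: power_mult_distrib)
        moreover have "?c\<^sup>2 \<le> 1" using t q \<kappa> unfolding trajectory_def by (smt (verit, best))
        then have "?c\<^sup>2 * (cmod (arriving g q j s))\<^sup>2 \<le> 1 * (cmod (arriving g q j s))\<^sup>2"
          by (intro mult_right_mono) auto
        ultimately have "end_energy g q j s \<le> 2 * (cmod (arriving g q j s))\<^sup>2"
          by (simp add: end_energy_def)
        also have "(cmod (arriving g q j s))\<^sup>2 = (\<Sum>j\<in>edges_at G q. (cmod (arriving g q j s))\<^sup>2)"
          using edges_at_not_int[OF damped_not_int[OF q] j] by simp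
        also have "\<dots> \<le> damped_energy g s"
          unfolding damped_energy_def
          by (rule member_le_sum[OF q, of "\<lambda>q. \<Sum>j\<in>edges_at G q. (cmod (arriving g q j s))\<^sup>2"])
            (auto intro!: sum_nonneg finite_damped)
        finally show "end_energy g q j s \<le> 2 * damped_energy g s" by simp
      qed
    qed
  qed
  also have "\<dots> = 2 * integral {\<alpha> + 2..\<beta> - 2} (damped_energy g)" by simp
  also have "\<dots> \<le> 2 * integral {\<alpha>..\<beta>} (damped_energy g)"
    using \<alpha> by (intro mult_left_mono integral_subset_le damped_energy_integrable[OF t]) (auto intro: damped_energy_nonneg)
  finally show "integral {\<alpha> + 2..\<beta> - 2} (end_energy g q j) \<le> 2 * integral {\<alpha>..\<beta>} (damped_energy g)" .
qed

text \<open>Continuity and Kirchhoff's law determine the traces on one edge from those on all others.\<close>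

lemma vertex_law_other_edges:
  fixes In Out :: "nat \<Rightarrow> complex" and \<sigma> :: "nat \<Rightarrow> real"
  assumes E: "finite E" "card E \<ge> 2" and j: "j \<in> E" and \<sigma>: "\<And>l. \<sigma> l * \<sigma> l = 1"
    and law: "\<And>l. l \<in> E \<Longrightarrow> Out l = In l - (\<sigma> l * (2 / real (card E))) *\<^sub>R (\<Sum>l\<in>E. \<sigma> l *\<^sub>R In l)"
  shows "(cmod (In j))\<^sup>2 + (cmod (Out j))\<^sup>2 \<le> (1 + real (card E)) * (\<Sum>l\<in>E - {j}. (cmod (In l))\<^sup>2 + (cmod (Out l))\<^sup>2)"
proof -
  let ?n = "real (card E)" and ?S = "\<Sum>l\<in>E. \<sigma> l *\<^sub>R In l"
  let ?e = "\<lambda>l. (cmod (In l))\<^sup>2 + (cmod (Out l))\<^sup>2"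
  let ?R = "\<Sum>l\<in>E - {j}. ?e l"
  have as: "\<bar>\<sigma> l\<bar> = 1" for l using \<sigma>[of l] by (metis abs_mult abs_one abs_mult_self_eq power2_eq_square real_sqrt_abs real_sqrt_one)
  have par: "(cmod (x - y))\<^sup>2 + (cmod (x + y))\<^sup>2 = 2 * ((cmod x)\<^sup>2 + (cmod y)\<^sup>2)" for x y :: complex
    unfolding cmod_power2 by (simp add: power2_eq_square algebra_simps)
  have par': "(cmod (x - y))\<^sup>2 \<le> 2 * ((cmod x)\<^sup>2 + (cmod y)\<^sup>2)" "(cmod (x + y))\<^sup>2 \<le> 2 * ((cmod x)\<^sup>2 + (cmod y)\<^sup>2)" for x y :: complex
    using par[of x y] zero_le_power2[of "cmod (x + y)"] zero_le_power2[of "cmod (x - y)"] by linarith+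
  \<comment> \<open>Continuity: up to a factor common to all edges, this is the velocity at the
    vertex.\<close>
  have diff: "\<sigma> l *\<^sub>R (In l - Out l) = (2 / ?n) *\<^sub>R ?S" if "l \<in> E" for l
    using law[OF that] \<sigma>[of l] by (simp add: mult.assoc[symmetric])
  have "E - {j} \<noteq> {}"
  proof
    assume "E - {j} = {}"
    then have "E = {j}" using j by auto
    then show False using E by simp
  qed
  then obtain k where k: "k \<in> E - {j}" by blast
  have "cmod (In j - Out j) = cmod (\<sigma> j *\<^sub>R (In j - Out j))" using as by simp
  also have "\<dots> = cmod (\<sigma> k *\<^sub>R (In k - Out k))" using diff j k by simp
  also have "\<dots> = cmod (In k - Out k)" using as by simp
  finally have "(cmod (In j - Out j))\<^sup>2 \<le> 2 * ?e k"
    using par'(1)[of "In k" "Out k"] by simp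
  also have "?e k \<le> ?R" by (rule member_le_sum[OF k]) (use E in auto)
  finally have d: "(cmod (In j - Out j))\<^sup>2 \<le> 2 * ?R" by simp
  \<comment> \<open>Kirchhoff's law, since \<open>In + Out\<close> is twice the slope. Bounds for
    the difference and the sum on edge \<open>j\<close> then combine by the parallelogram
    law.\<close>
  have "(\<Sum>l\<in>E. \<sigma> l *\<^sub>R (In l + Out l)) = (\<Sum>l\<in>E. 2 *\<^sub>R (\<sigma> l *\<^sub>R In l) - \<sigma> l *\<^sub>R (In l - Out l))"
    by (intro sum.cong) (simp_all add: scaleR_conv_of_real algebra_simps)
  also have "\<dots> = 2 *\<^sub>R ?S - (\<Sum>l\<in>E. (2 / ?n) *\<^sub>R ?S)"
    by (simp add: sum_subtractf diff scaleR_sum_right del: sum_constant)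
  also have "\<dots> = 0" using E by (simp add: scaleR_conv_of_real)
  finally have "\<sigma> j *\<^sub>R (In j + Out j) = - (\<Sum>l\<in>E - {j}. \<sigma> l *\<^sub>R (In l + Out l))"
    using E j by (simp add: sum.remove[of E j] eq_neg_iff_add_eq_0)
  then have "cmod (In j + Out j) = cmod (\<Sum>l\<in>E - {j}. \<sigma> l *\<^sub>R (In l + Out l))"
    using as by (metis norm_minus_cancel norm_scaleR mult_1)
  also have "\<dots> \<le> (\<Sum>l\<in>E - {j}. cmod (In l + Out l))"
    by (rule sum_norm_le) (use as in simp)
  finally have "(cmod (In j + Out j))\<^sup>2 \<le> (\<Sum>l\<in>E - {j}. 1 * cmod (In l + Out l))\<^sup>2"
    by (intro power_mono) auto
  also have "\<dots> \<le> (\<Sum>l\<in>E - {j}. 1\<^sup>2) * (\<Sum>l\<in>E - {j}. (cmod (In l + Out l))\<^sup>2)"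
    by (rule Cauchy_Schwarz_ineq_sum)
  also have "\<dots> \<le> ?n * (\<Sum>l\<in>E - {j}. 2 * ?e l)"
  proof (intro mult_mono sum_mono)
    show "(\<Sum>l\<in>E - {j}. 1\<^sup>2) \<le> ?n" using E by (simp add: card_mono)
    show "(cmod (In l + Out l))\<^sup>2 \<le> 2 * ?e l" for l
      by (rule par'(2))
  qed (auto intro!: sum_nonneg)
  also have "\<dots> = 2 * (?n * ?R)" by (simp only: sum_distrib_left[symmetric] mult.left_commute)
  finally have "(cmod (In j + Out j))\<^sup>2 \<le> 2 * (?n * ?R)" .
  then have "2 * ?e j \<le> 2 * ?R + 2 * (?n * ?R)" using d par[of "In j" "Out j"] by linarith
  then show ?thesis by (simp add: distrib_right)
qed

text \<open>The vertex law is integrated in time, each of at most n other edges costing a factor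
  \<open>C\<close>. The summand \<open>C\<close> in the new constant keeps the time margin at least
  as large as before.\<close>

lemma observable_vertex:
  assumes q: "q \<in> int_verts G" and j: "j \<in> edges_at G q" and C: "C \<ge> 0"
    and o: "\<And>l. l \<in> edges_at G q - {j} \<Longrightarrow> observable \<kappa> q l C"
  shows "observable \<kappa> q j (C + (1 + real (vdegree G q)) * (real (vdegree G q) * C))"
proof -
  let ?E = "edges_at G q" and ?n = "real (vdegree G q)"
  let ?C = "C + (1 + ?n) * (?n * C)"
  have CC: "C \<le> ?C" using C by simp
  show ?thesis
    unfolding observable_def
  proof (intro allI impI)
    fix a g and \<alpha> \<beta> :: real assume t: "trajectory \<kappa> a g" and \<alpha>: "0 \<le> \<alpha>"
    let ?D = "integral {\<alpha>..\<beta>} (damped_energy g)"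
    let ?J = "{\<alpha> + C..\<beta> - C}"
    have D: "?D \<ge> 0" using damped_energy_integral_nonneg[OF t \<alpha>] .
    have "integral {\<alpha> + ?C..\<beta> - ?C} (end_energy g q j) \<le> integral ?J (end_energy g q j)"
    proof (intro integral_subset_le end_energy_integrable[OF t j])
      show "{\<alpha> + ?C..\<beta> - ?C} \<subseteq> ?J" using CC by (intro atLeastatMost_subset_iff[THEN iffD2] disjI2 conjI) linarith+
      show "0 \<le> \<alpha> + ?C" "0 \<le> \<alpha> + C" using \<alpha> C CC by linarith+
    qed (auto intro: end_energy_nonneg)
    also have "\<dots> \<le> integral ?J (\<lambda>s. (1 + ?n) * (\<Sum>l\<in>?E - {j}. end_energy g q l s))"
    proof (rule integral_le_AE)
      show "end_energy g q j integrable_on ?J" using \<alpha> C by (intro end_energy_integrable[OF t j]) auto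
      show "(\<lambda>s. (1 + ?n) * (\<Sum>l\<in>?E - {j}. end_energy g q l s)) integrable_on ?J"
        using \<alpha> C by (intro integrable_on_mult_right integrable_sum end_energy_integrable[OF t]) auto
      from trajectory_law[OF t] show "AE s in lebesgue. s \<in> ?J \<longrightarrow> end_energy g q j s \<le> (1 + ?n) * (\<Sum>l\<in>?E - {j}. end_energy g q l s)"
      proof eventually_elim
        case (elim s)
        show ?case
        proof
          assume s: "s \<in> ?J"
          show "end_energy g q j s \<le> (1 + ?n) * (\<Sum>l\<in>?E - {j}. end_energy g q l s)"
            unfolding end_energy_def vdegree_def
          proof (rule vertex_law_other_edges[where \<sigma> = "end_sign G q"])
            show "card ?E \<ge> 2" using vdegree_int[OF q] by (simp add: vdegree_def)
            show "leaving g q l s = arriving g q l s - (end_sign G q l * (2 / real (card ?E))) *\<^sub>R (\<Sum>l\<in>?E. end_sign G q l *\<^sub>R arriving g q l s)"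
              if "l \<in> ?E" for l
              using elim s \<alpha> C q that by (auto simp: vdegree_def)
          qed (use j in auto)
        qed
      qed
    qed
    also have "\<dots> = (1 + ?n) * (\<Sum>l\<in>?E - {j}. integral ?J (end_energy g q l))"
      using \<alpha> C by (subst integral_mult_right, subst integral_sum) (auto intro!: end_energy_integrable[OF t])
    also have "\<dots> \<le> (1 + ?n) * (\<Sum>l\<in>?E - {j}. C * ?D)"
      using o t \<alpha> by (intro mult_left_mono sum_mono) (auto simp: observable_def)
    also have "\<dots> \<le> (1 + ?n) * (?n * (C * ?D))"
    proof (rule mult_left_mono)
      have "real (card (?E - {j})) \<le> ?n" by (simp add: vdegree_def card_mono)
      then have "real (card (?E - {j})) * (C * ?D) \<le> ?n * (C * ?D)" using C D by (intro mult_right_mono) auto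
      then show "(\<Sum>l\<in>?E - {j}. C * ?D) \<le> ?n * (C * ?D)" by simp
    qed simp
    also have "\<dots> \<le> ?C * ?D" using C D by (simp add: algebra_simps)
    finally show "integral {\<alpha> + ?C..\<beta> - ?C} (end_energy g q j) \<le> ?C * ?D" .
  qed
qed


lemma observable_uniform:
  assumes F: "finite F" "F \<subseteq> edges_at G q" and ex: "\<And>l. l \<in> F \<Longrightarrow> \<exists>C\<ge>0. observable \<kappa> q l C"
  shows "\<exists>C\<ge>0. \<forall>l\<in>F. observable \<kappa> q l C"
proof -
  obtain f where f: "\<And>l. l \<in> F \<Longrightarrow> f l \<ge> 0 \<and> observable \<kappa> q l (f l)" using ex by metis
  have "observable \<kappa> q l (sum f F)" if l: "l \<in> F" for l
  proof (rule observable_mono)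
    show "f l \<le> sum f F" using f F l by (intro member_le_sum) auto
  qed (use f l F in auto)
  moreover have "sum f F \<ge> 0" using f by (intro sum_nonneg) auto
  ultimately show ?thesis by blast
qed

text \<open>Induction from the deepest vertices upwards. An exterior vertex other than the root is
  damped. At an interior vertex all edges but at most one lead away from the root and are observed
  from their far ends; the vertex law supplies the remaining one.\<close>

lemma tree_observable_non_root:
  assumes tree: "graph_tree G" and r: "undamped G = {r}" "r \<in> verts G" and \<kappa>: "\<kappa> \<ge> 0"
    and q: "q \<in> verts G" "q \<noteq> r"
  shows "\<exists>C\<ge>0. \<forall>j\<in>edges_at G q. observable \<kappa> q j C"
  using q
proof (induction "Max (hops G r ` verts G) - hops G r q" arbitrary: q rule: less_induct)
  case less
  let ?M = "Max (hops G r ` verts G)"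
  have hM: "hops G r x \<le> ?M" if "x \<in> verts G" for x using that finite_verts by (intro Max_ge) auto
  show ?case
  proof (cases "q \<in> int_verts G")
    case False
    then have "q \<in> damped G" using not_int_cases[OF less.prems(1)] less.prems(2) r by auto
    then show ?thesis using observable_damped[OF \<kappa>] by (intro exI[where x = 2]) auto
  next
    case True
    define F where "F = {l \<in> edges_at G q. hops G r (other_end G q l) > hops G r q}"
    have "\<exists>C\<ge>0. observable \<kappa> q l C" if "l \<in> F" for l
    proof -
      let ?o = "other_end G q l"
      have l: "l \<in> edges_at G q" and gt: "hops G r ?o > hops G r q" using that by (auto simp: F_def)
      note oe = other_end[OF l]
      have "hops G r r < length [r]" using r(2) by (intro hops_le) (auto simp: graph_path_def)
      then have "?o \<noteq> r" using gt by auto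
      moreover have "?M - hops G r ?o < ?M - hops G r q" using gt hM[OF oe(4)] by linarith
      ultimately obtain C where "C \<ge> 0" "\<forall>j\<in>edges_at G ?o. observable \<kappa> ?o j C" using less.hyps oe(4) by blast
      then have "observable \<kappa> q l (C + len G l)" using oe l by (intro observable_transfer) auto
      then show ?thesis using \<open>C \<ge> 0\<close> edges_atD(8)[OF l] by (intro exI[where x = "C + len G l"]) auto
    qed
    then obtain C where C: "C \<ge> 0" "\<And>l. l \<in> F \<Longrightarrow> observable \<kappa> q l C"
      using observable_uniform[of F q \<kappa>] by (auto simp: F_def)
    let ?C = "C + (1 + real (vdegree G q)) * (real (vdegree G q) * C)"
    have CC: "C \<le> ?C" using C(1) by simp
    have "observable \<kappa> q j ?C" if j: "j \<in> edges_at G q" for j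
    proof (cases "j \<in> F")
      case True
      then show ?thesis using observable_mono[OF C(2)[OF True] C(1) CC j] by simp
    next
      case False
      have "l \<in> F" if "l \<in> edges_at G q - {j}" for l
      proof (rule ccontr)
        assume "l \<notin> F"
        then have "hops G r (other_end G q l) \<le> hops G r q" "hops G r (other_end G q j) \<le> hops G r q"
          using that j False by (simp_all add: F_def)
        then show False using tree_unique_parent[OF tree r(2) _ _ j] that by auto
      qed
      then show ?thesis using C by (intro observable_vertex[OF True j]) auto
    qed
    moreover have "?C \<ge> 0" using C(1) CC by linarith
    ultimately show ?thesis by blast
  qed
qed

text \<open>Only the root is left, and its edges are observed from their other ends.\<close>

lemma tree_observable:
  assumes tree: "graph_tree G" and r: "undamped G = {r}" and \<kappa>: "\<kappa> \<ge> 0"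
  shows "\<exists>C\<ge>1. \<forall>q\<in>verts G. \<forall>j\<in>edges_at G q. observable \<kappa> q j C"
proof -
  have rv: "r \<in> verts G" using network r by (auto simp: is_network_def ext_verts_def)
  have "\<exists>C\<ge>0. \<forall>j\<in>edges_at G q. observable \<kappa> q j C" if q: "q \<in> verts G" for q
  proof (cases "q = r")
    case False
    then show ?thesis using tree_observable_non_root[OF tree r rv \<kappa> q] by simp
  next
    case True
    show ?thesis
    proof (intro observable_uniform[OF finite_edges_at])
      fix j assume j: "j \<in> edges_at G q"
      note oe = other_end[OF j]
      obtain C where "C \<ge> 0" "\<forall>l\<in>edges_at G (other_end G q j). observable \<kappa> (other_end G q j) l C"
        using tree_observable_non_root[OF tree r rv \<kappa> oe(4)] oe(2) True by auto
      then have "observable \<kappa> q j (C + len G j)" using oe j by (intro observable_transfer) auto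
      then show "\<exists>C\<ge>0. observable \<kappa> q j C" using \<open>C \<ge> 0\<close> edges_atD(8)[OF j] by (intro exI[where x = "C + len G j"]) auto
    qed simp
  qed
  then obtain f where f: "\<And>q. q \<in> verts G \<Longrightarrow> f q \<ge> 0 \<and> (\<forall>j\<in>edges_at G q. observable \<kappa> q j (f q))" by metis
  have "observable \<kappa> q j (1 + sum f (verts G))" if "q \<in> verts G" "j \<in> edges_at G q" for q j
  proof (rule observable_mono)
    have "f q \<le> sum f (verts G)" using f that finite_verts by (intro member_le_sum) auto
    then show "f q \<le> 1 + sum f (verts G)" by simp
  qed (use f that in auto)
  moreover have "sum f (verts G) \<ge> 0" using f by (intro sum_nonneg) auto
  ultimately show ?thesis by (intro exI[where x = "1 + sum f (verts G)"]) auto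
qed

section \<open>Energy balance and exponential decay along trajectories\<close>

definition energy :: "(nat \<Rightarrow> real \<Rightarrow> complex) \<Rightarrow> real \<Rightarrow> real" where
  "energy g t = (\<Sum>i\<in>components. integral {t - tlen G i..t} (\<lambda>s. (cmod (g i s))\<^sup>2))"

lemma norm_minus_signed_square:
  fixes x S :: complex
  assumes "\<sigma> * \<sigma> = (1::real)"
  shows "(cmod (x - (\<sigma> * c) *\<^sub>R S))\<^sup>2 = (cmod x)\<^sup>2 - 2 * c * ((\<sigma> *\<^sub>R x) \<bullet> S) + c * c * (S \<bullet> S)"
proof -
  have "(\<sigma> * c) * (\<sigma> * c) = c * c" using assms by (metis mult.assoc mult.commute mult_1)
  then show ?thesis
    unfolding power2_norm_eq_inner inner_diff_left inner_diff_right inner_scaleR_left inner_scaleR_right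
    using assms by (simp add: inner_commute[of S x] algebra_simps)
qed

text \<open>The map is a Householder reflection: with n unit signs and c = 2/n, the quadratic term n
  c^2 equals the cross term 2 c.\<close>

lemma reflection_isometry:
  fixes In :: "nat \<Rightarrow> complex" and \<sigma> :: "nat \<Rightarrow> real"
  assumes E: "finite E" "E \<noteq> {}" and \<sigma>: "\<And>l. \<sigma> l * \<sigma> l = 1"
  shows "(\<Sum>j\<in>E. (cmod (In j - (\<sigma> j * (2 / real (card E))) *\<^sub>R (\<Sum>l\<in>E. \<sigma> l *\<^sub>R In l)))\<^sup>2) = (\<Sum>j\<in>E. (cmod (In j))\<^sup>2)"
proof -
  let ?S = "\<Sum>l\<in>E. \<sigma> l *\<^sub>R In l" and ?c = "2 / real (card E)"
  have n: "real (card E) > 0" using E by (simp add: card_gt_0_iff)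
  have "(\<Sum>j\<in>E. (cmod (In j - (\<sigma> j * ?c) *\<^sub>R ?S))\<^sup>2) =
      (\<Sum>j\<in>E. (cmod (In j))\<^sup>2) - 2 * ?c * (\<Sum>j\<in>E. (\<sigma> j *\<^sub>R In j) \<bullet> ?S) + real (card E) * (?c * ?c * (?S \<bullet> ?S))"
    unfolding norm_minus_signed_square[OF \<sigma>] sum.distrib sum_subtractf
    by (simp only: sum_distrib_left[symmetric] sum_constant mult.left_commute)
  also have "(\<Sum>j\<in>E. (\<sigma> j *\<^sub>R In j) \<bullet> ?S) = ?S \<bullet> ?S" by (rule inner_sum_left[symmetric])
  also have "real (card E) * (?c * ?c * (?S \<bullet> ?S)) = 2 * ?c * (?S \<bullet> ?S)" using n by (simp add: field_simps)
  finally show ?thesis by simp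
qed

text \<open>As time advances, the waves leaving the vertices enter the windows of
  \<open>energy\<close> and those arriving drop out. At each vertex the two square sums agree,
  except at damped vertices, where at least the fraction \<kappa> is lost.\<close>

lemma energy_balance:
  assumes t: "trajectory \<kappa> a g" and t0: "0 \<le> t" and T: "0 \<le> T"
  shows "energy g (t + T) + \<kappa> * integral {t..t + T} (damped_energy g) \<le> energy g t"
proof -
  let ?R = "components" and ?\<phi> = "\<lambda>i s. (cmod (g i s))\<^sup>2" and ?J = "{t..t + T}"
  have tp: "tlen G i > 0" if "i \<in> ?R" for i using tlen_pos[OF that] .
  have int: "?\<phi> i integrable_on {x..y}" if "i \<in> ?R" "x \<ge> - tlen G i" for i x y
    using trajectory_integrable[OF t that] .
  have int0: "?\<phi> i integrable_on ?J" if "i \<in> ?R" for i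
    using int[OF that, of t "t + T"] tp[OF that] t0 by simp
  have ints: "(\<lambda>s. ?\<phi> i (s - tlen G i)) integrable_on ?J" if "i \<in> ?R" for i
    unfolding integrable_shift_minus[of "?\<phi> i"] using that t0 by (intro int) auto
  have "integral ?J (\<lambda>s. (\<Sum>i\<in>?R. ?\<phi> i s) + \<kappa> * damped_energy g s) \<le> integral ?J (\<lambda>s. \<Sum>i\<in>?R. ?\<phi> i (s - tlen G i))"
  proof (rule integral_le_AE)
    show "(\<lambda>s. (\<Sum>i\<in>?R. ?\<phi> i s) + \<kappa> * damped_energy g s) integrable_on ?J"
      using t0 by (intro integrable_add integrable_sum integrable_on_mult_right damped_energy_integrable[OF t] int0) auto
    show "(\<lambda>s. \<Sum>i\<in>?R. ?\<phi> i (s - tlen G i)) integrable_on ?J"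
      by (intro integrable_sum ints) auto
    from trajectory_law[OF t] show "AE s in lebesgue. s \<in> ?J \<longrightarrow>
        (\<Sum>i\<in>?R. ?\<phi> i s) + \<kappa> * damped_energy g s \<le> (\<Sum>i\<in>?R. ?\<phi> i (s - tlen G i))"
    proof eventually_elim
      case (elim s)
      show ?case
      proof
        assume "s \<in> ?J"
        then have s0: "s \<ge> 0" using t0 by simp
        have out: "(\<Sum>i\<in>?R. ?\<phi> i s) = (\<Sum>q\<in>verts G. \<Sum>j\<in>edges_at G q. (cmod (leaving g q j s))\<^sup>2)"
          unfolding sum_out_ix leaving_def ..
        have "(\<Sum>i\<in>?R. ?\<phi> i (s - tlen G i)) = (\<Sum>q\<in>verts G. \<Sum>j\<in>edges_at G q. ?\<phi> (in_ix G q j) (s - tlen G (in_ix G q j)))"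
          by (rule sum_in_ix)
        also have "\<dots> = (\<Sum>q\<in>verts G. \<Sum>j\<in>edges_at G q. (cmod (arriving g q j s))\<^sup>2)"
          by (intro sum.cong) (auto simp: arriving_def)
        finally have inn: "(\<Sum>i\<in>?R. ?\<phi> i (s - tlen G i)) = (\<Sum>q\<in>verts G. \<Sum>j\<in>edges_at G q. (cmod (arriving g q j s))\<^sup>2)" .
        have vx: "(\<Sum>j\<in>edges_at G q. (cmod (leaving g q j s))\<^sup>2) +
            (if q \<in> damped G then \<kappa> * (\<Sum>j\<in>edges_at G q. (cmod (arriving g q j s))\<^sup>2) else 0)
            \<le> (\<Sum>j\<in>edges_at G q. (cmod (arriving g q j s))\<^sup>2)" if q: "q \<in> verts G" for q
        proof (cases "q \<in> int_verts G")
          case True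
          have "edges_at G q \<noteq> {}" using vdegree_int[OF True] by (auto simp: vdegree_def)
          from reflection_isometry[OF finite_edges_at this, of "end_sign G q" "\<lambda>j. arriving g q j s"]
          have "(\<Sum>j\<in>edges_at G q. (cmod (leaving g q j s))\<^sup>2) = (\<Sum>j\<in>edges_at G q. (cmod (arriving g q j s))\<^sup>2)"
            using elim s0 True by (simp add: vdegree_def)
          then show ?thesis using True damped_not_int by auto
        next
          case False
          have "(\<Sum>j\<in>edges_at G q. (cmod (leaving g q j s))\<^sup>2) = (\<Sum>j\<in>edges_at G q. (refl_coeff G (a s) q)\<^sup>2 * (cmod (arriving g q j s))\<^sup>2)"
            using elim s0 False by (intro sum.cong) (auto simp: power_mult_distrib)
          also have "\<dots> = (refl_coeff G (a s) q)\<^sup>2 * (\<Sum>j\<in>edges_at G q. (cmod (arriving g q j s))\<^sup>2)"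
            by (rule sum_distrib_left[symmetric])
          finally have l: "(\<Sum>j\<in>edges_at G q. (cmod (leaving g q j s))\<^sup>2) = (refl_coeff G (a s) q)\<^sup>2 * (\<Sum>j\<in>edges_at G q. (cmod (arriving g q j s))\<^sup>2)" .
          show ?thesis
          proof (cases "q \<in> damped G")
            case True
            then have "(refl_coeff G (a s) q)\<^sup>2 + \<kappa> \<le> 1" using t unfolding trajectory_def by (auto simp: algebra_simps)
            then have "((refl_coeff G (a s) q)\<^sup>2 + \<kappa>) * (\<Sum>j\<in>edges_at G q. (cmod (arriving g q j s))\<^sup>2) \<le> 1 * (\<Sum>j\<in>edges_at G q. (cmod (arriving g q j s))\<^sup>2)"
              by (intro mult_right_mono sum_nonneg) auto
            then show ?thesis using True l by (simp add: distrib_right)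
          next
            case False
            then have "q \<in> undamped G" using not_int_cases[OF q \<open>q \<notin> int_verts G\<close>] by simp
            then show ?thesis using False l by (simp add: refl_coeff_def)
          qed
        qed
        have "damped_energy g s = (\<Sum>q\<in>verts G. if q \<in> damped G then (\<Sum>j\<in>edges_at G q. (cmod (arriving g q j s))\<^sup>2) else 0)"
          unfolding damped_energy_def using damped_subset finite_verts
          by (simp add: sum.If_cases inf_absorb2)
        then have "\<kappa> * damped_energy g s = (\<Sum>q\<in>verts G. if q \<in> damped G then \<kappa> * (\<Sum>j\<in>edges_at G q. (cmod (arriving g q j s))\<^sup>2) else 0)"
          by (auto simp: sum_distrib_left intro!: sum.cong)
        then show "(\<Sum>i\<in>?R. ?\<phi> i s) + \<kappa> * damped_energy g s \<le> (\<Sum>i\<in>?R. ?\<phi> i (s - tlen G i))"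
          unfolding out inn using vx by (simp add: sum.distrib[symmetric] sum_mono)
      qed
    qed
  qed
  moreover have "integral ?J (\<lambda>s. (\<Sum>i\<in>?R. ?\<phi> i s) + \<kappa> * damped_energy g s) =
      (\<Sum>i\<in>?R. integral ?J (?\<phi> i)) + \<kappa> * integral ?J (damped_energy g)"
  proof -
    have "integral ?J (\<lambda>s. \<Sum>i\<in>?R. ?\<phi> i s) = (\<Sum>i\<in>?R. integral ?J (?\<phi> i))"
      by (rule integral_sum) (use int0 in auto)
    moreover have "integral ?J (\<lambda>s. (\<Sum>i\<in>?R. ?\<phi> i s) + \<kappa> * damped_energy g s) =
        integral ?J (\<lambda>s. \<Sum>i\<in>?R. ?\<phi> i s) + integral ?J (\<lambda>s. \<kappa> * damped_energy g s)"
      using t0 by (intro integral_add integrable_sum integrable_on_mult_right damped_energy_integrable[OF t] int0) auto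
    ultimately show ?thesis by simp
  qed
  moreover have "integral ?J (\<lambda>s. \<Sum>i\<in>?R. ?\<phi> i (s - tlen G i)) = (\<Sum>i\<in>?R. integral {t - tlen G i..t + T - tlen G i} (?\<phi> i))"
  proof -
    have "integral ?J (\<lambda>s. \<Sum>i\<in>?R. ?\<phi> i (s - tlen G i)) = (\<Sum>i\<in>?R. integral ?J (\<lambda>s. ?\<phi> i (s - tlen G i)))"
      by (rule integral_sum) (use ints in auto)
    then show ?thesis by (simp only: integral_shift_minus[of _ _ "?\<phi> _"])
  qed
  \<comment> \<open>The old and the new window may overlap; splitting
    \<open>{t - tlen G i..t + T}\<close> once at \<open>t\<close> and once at
    \<open>t + T - tlen G i\<close> handles both cases.\<close>
  moreover have "energy g (t + T) - energy g t = (\<Sum>i\<in>?R. integral ?J (?\<phi> i)) - (\<Sum>i\<in>?R. integral {t - tlen G i..t + T - tlen G i} (?\<phi> i))"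
    unfolding energy_def sum_subtractf[symmetric]
  proof (intro sum.cong refl)
    fix i assume i: "i \<in> ?R"
    have "?\<phi> i integrable_on {t - tlen G i..t + T}" using int[OF i] t0 by simp
    then have "integral {t - tlen G i..t} (?\<phi> i) + integral ?J (?\<phi> i) = integral {t - tlen G i..t + T} (?\<phi> i)"
      "integral {t - tlen G i..t + T - tlen G i} (?\<phi> i) + integral {t + T - tlen G i..t + T} (?\<phi> i) = integral {t - tlen G i..t + T} (?\<phi> i)"
      using tp[OF i] T by (intro Henstock_Kurzweil_Integration.integral_combine; simp)+
    then show "integral {t + T - tlen G i..t + T} (?\<phi> i) - integral {t - tlen G i..t} (?\<phi> i) =
        integral ?J (?\<phi> i) - integral {t - tlen G i..t + T - tlen G i} (?\<phi> i)" by simp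
  qed
  ultimately show ?thesis by linarith
qed

lemma energy_nonneg: "trajectory \<kappa> a g \<Longrightarrow> t \<ge> 0 \<Longrightarrow> energy g t \<ge> 0"
  unfolding energy_def by (intro sum_nonneg integral_nonneg trajectory_integrable) auto

lemma energy_antimono:
  assumes "trajectory \<kappa> a g" "\<kappa> \<ge> 0" "0 \<le> s" "s \<le> t"
  shows "energy g t \<le> energy g s"
proof -
  have "0 \<le> \<kappa> * integral {s..t} (damped_energy g)"
    using damped_energy_integral_nonneg[OF assms(1,3)] assms(2) by simp
  then show ?thesis using energy_balance[OF assms(1,3), of "t - s"] assms(4) by simp
qed

text \<open>At time \<open>t + C + \<Lambda>\<close> every window lies in the part of
  \<open>{t..t + T}\<close> covered by observability, so the energy there is at most
  \<open>M * ?D\<close>. The loss over the whole interval is at least \<open>\<kappa> * ?D\<close>;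
  eliminating \<open>?D\<close> gives the ratio \<open>M / (M + \<kappa>)\<close>.\<close>

lemma energy_contraction:
  assumes tree: "graph_tree G" and r: "undamped G = {r}" and \<kappa>: "\<kappa> > 0" and n: "nedges G \<ge> 1"
  obtains c T where "0 < c" "c < 1" "0 < T"
    "\<And>a g t. trajectory \<kappa> a g \<Longrightarrow> 0 \<le> t \<Longrightarrow> energy g (t + T) \<le> c * energy g t"
proof -
  obtain C where C: "C \<ge> 1" and ob: "\<And>q j. q \<in> verts G \<Longrightarrow> j \<in> edges_at G q \<Longrightarrow> observable \<kappa> q j C"
    using tree_observable[OF tree r] \<kappa> by (meson less_imp_le)
  define \<Lambda> where "\<Lambda> = (\<Sum>j\<in>edges. len G j)"
  have \<Lambda>: "len G j \<le> \<Lambda>" if "j \<in> edges" for j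
    unfolding \<Lambda>_def using that len_pos by (intro member_le_sum) (auto intro: less_imp_le)
  have \<Lambda>0: "\<Lambda> > 0" using \<Lambda>[of 1] len_pos[of 1] n by simp
  define M where "M = C * real (2 * nedges G)"
  have M: "M > 0" using C n by (simp add: M_def)
  define T where "T = 2 * C + \<Lambda>"
  show ?thesis
  proof (rule that[of "M / (M + \<kappa>)" T])
    show "0 < M / (M + \<kappa>)" "M / (M + \<kappa>) < 1" "0 < T" using M \<kappa> C \<Lambda>0 by (auto simp: T_def)
    fix a g and t :: real assume tr: "trajectory \<kappa> a g" and t: "0 \<le> t"
    let ?D = "integral {t..t + T} (damped_energy g)" and ?t = "t + C + \<Lambda>"
    have "energy g ?t = (\<Sum>q\<in>verts G. \<Sum>j\<in>edges_at G q. integral {?t - tlen G (out_ix G q j)..?t} (\<lambda>s. (cmod (g (out_ix G q j) s))\<^sup>2))"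
      unfolding energy_def by (rule sum_out_ix)
    also have "\<dots> \<le> (\<Sum>q\<in>verts G. \<Sum>j\<in>edges_at G q. C * ?D)"
    proof (intro sum_mono)
      fix q j assume q: "q \<in> verts G" and j: "j \<in> edges_at G q"
      have jj: "j \<in> edges" using j by (simp add: edges_at_def)
      have L: "len G j \<le> \<Lambda>" "len G j > 0" using \<Lambda>[OF jj] len_pos[OF jj] by auto
      have i1: "(\<lambda>s. (cmod (leaving g q j s))\<^sup>2) integrable_on {x..y}" if "x \<ge> 0" for x y
        using L that by (intro leaving_integrable[OF tr j]) auto
      have "integral {?t - len G j..?t} (\<lambda>s. (cmod (leaving g q j s))\<^sup>2) \<le> integral {t + C..t + T - C} (\<lambda>s. (cmod (leaving g q j s))\<^sup>2)"
        using L t C by (intro integral_subset_le i1) (auto simp: T_def)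
      also have "\<dots> \<le> integral {t + C..t + T - C} (end_energy g q j)"
        using t C by (intro integral_le i1 end_energy_integrable[OF tr j]) (auto simp: end_energy_def)
      also have "\<dots> \<le> C * ?D" using ob[OF q j] tr t unfolding observable_def by blast
      finally show "integral {?t - tlen G (out_ix G q j)..?t} (\<lambda>s. (cmod (g (out_ix G q j) s))\<^sup>2) \<le> C * ?D"
        using tlen_ix(2)[OF j] by (simp add: leaving_def)
    qed
    also have "\<dots> = (\<Sum>i\<in>components. C * ?D)" by (rule sum_out_ix[symmetric])
    also have "\<dots> = M * ?D" by (simp add: M_def)
    finally have "energy g ?t \<le> M * ?D" .
    moreover have "energy g (t + T) \<le> energy g ?t"
      using \<kappa> t C \<Lambda>0 by (intro energy_antimono[OF tr]) (auto simp: T_def)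
    ultimately have "energy g (t + T) \<le> M * ?D" by simp
    then have "\<kappa> * energy g (t + T) \<le> M * (\<kappa> * ?D)" using \<kappa> by (simp add: mult.left_commute)
    also have "\<dots> \<le> M * (energy g t - energy g (t + T))"
      using energy_balance[OF tr t, of T] M C \<Lambda>0 by (intro mult_left_mono) (auto simp: T_def)
    finally have "(M + \<kappa>) * energy g (t + T) \<le> M * energy g t" by (simp add: algebra_simps)
    then show "energy g (t + T) \<le> M / (M + \<kappa>) * energy g t" using M \<kappa> by (simp add: field_simps)
  qed
qed

text \<open>The factor \<open>1 / c\<close> pays for the incomplete last period of length
  \<open>T\<close>.\<close>

lemma energy_exponential_decay:
  assumes tree: "graph_tree G" and r: "undamped G = {r}" and \<kappa>: "\<kappa> > 0" and n: "nedges G \<ge> 1"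
  obtains K \<mu> where "K > 0" "\<mu> < 0"
    "\<And>a g t. trajectory \<kappa> a g \<Longrightarrow> 0 \<le> t \<Longrightarrow> energy g t \<le> K * exp (\<mu> * t) * energy g 0"
proof -
  obtain c T where c: "0 < c" "c < 1" and T: "0 < T"
    and con: "\<And>a g t. trajectory \<kappa> a g \<Longrightarrow> 0 \<le> t \<Longrightarrow> energy g (t + T) \<le> c * energy g t"
    using energy_contraction[OF assms] by metis
  show ?thesis
  proof (rule that[of "1 / c" "ln c / T"])
    show "1 / c > 0" "ln c / T < 0" using c T by (auto simp: divide_neg_pos)
    fix a g and t :: real assume tr: "trajectory \<kappa> a g" and t: "0 \<le> t"
    have it: "energy g (real m * T) \<le> c ^ m * energy g 0" for m
    proof (induction m)
      case (Suc m)
      have "energy g (real (Suc m) * T) \<le> c * energy g (real m * T)"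
        using con[OF tr, of "real m * T"] T by (simp add: algebra_simps)
      also have "\<dots> \<le> c * (c ^ m * energy g 0)" using Suc c by (intro mult_left_mono) auto
      finally show ?case by simp
    qed simp
    define m where "m = nat \<lfloor>t / T\<rfloor>"
    have m: "real m \<le> t / T" "t / T - 1 \<le> real m" using t T by (auto simp: m_def)
    have "energy g t \<le> energy g (real m * T)"
      using \<kappa> T m(1) by (intro energy_antimono[OF tr]) (auto simp: field_simps)
    also have "\<dots> \<le> c ^ m * energy g 0" by (rule it)
    also have "\<dots> \<le> (1 / c * exp (ln c / T * t)) * energy g 0"
    proof (rule mult_right_mono)
      have "c ^ m = exp (real m * ln c)" using c by (simp add: exp_of_nat_mult)
      also have "\<dots> \<le> exp ((t / T - 1) * ln c)" using m(2) c by (simp add: mult_right_mono_neg)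
      also have "(t / T - 1) * ln c = ln c / T * t - ln c" by (simp add: algebra_simps)
      also have "exp \<dots> = 1 / c * exp (ln c / T * t)" using c by (simp add: exp_diff)
      finally show "c ^ m \<le> 1 / c * exp (ln c / T * t)" .
    qed (use energy_nonneg[OF tr] in auto)
    finally show "energy g t \<le> 1 / c * exp (ln c / T * t) * energy g 0" .
  qed
qed

end

section \<open>Exponential decay of the energy\<close>

lemma has_integral_reflect_shift:
  fixes f :: "real \<Rightarrow> real"
  assumes "(f has_integral I) {a..b}"
  shows "((\<lambda>x. f (c - x)) has_integral I) {c - b..c - a}"
proof -
  have "((\<lambda>x. f (- x)) has_integral I) {- b..- a}" using assms by simp
  from has_integral_shift_real_ivl[OF this, of "- c"] show ?thesis by (simp add: add.commute)
qed

lemma has_integral_AE_cong: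
  fixes f g :: "real \<Rightarrow> real"
  assumes "(f has_integral I) S" "AE x in lebesgue. x \<in> S \<longrightarrow> f x = g x"
  shows "(g has_integral I) S"
proof -
  obtain N where N: "{x. \<not> (x \<in> S \<longrightarrow> f x = g x)} \<subseteq> N" "N \<in> null_sets lebesgue"
    using assms(2) by (auto simp: eventually_ae_filter)
  then have "negligible N" by (simp add: negligible_iff_null_sets)
  then show ?thesis by (rule has_integral_spike[OF _ _ assms(1)]) (use N(1) in auto)
qed

section \<open>Square-integrable states and their energy\<close>

lemma Lp_space_2_iff:
  "f \<in> Lp_space l 2 \<longleftrightarrow> f \<in> borel_measurable (leb l) \<and>
     integrable (leb l) (\<lambda>x. (cmod (f x))\<^sup>2)"
proof -
  have "real_of_ereal 2 = 2" using real_of_ereal.simps(1)[of 2] by (simp only: numeral_eq_ereal)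
  moreover have "(2::ereal) \<noteq> \<infinity>" by simp
  ultimately show ?thesis by (simp add: Lp_space_def)
qed

lemma L2_has_integral:
  assumes "f \<in> Lp_space l 2"
  shows "((\<lambda>x. (cmod (f x))\<^sup>2) has_integral (Lp_norm l 2 f)\<^sup>2) {0..l}"
proof -
  have r: "real_of_ereal 2 = 2" using real_of_ereal.simps(1)[of 2] by (simp only: numeral_eq_ereal)
  have int: "integrable (leb l) (\<lambda>x. (cmod (f x))\<^sup>2)" using assms Lp_space_2_iff by blast
  have "(2::ereal) \<noteq> \<infinity>" by simp
  then have "Lp_norm l 2 f = (LINT x|leb l. (cmod (f x))\<^sup>2) powr (1 / 2)"
    by (simp add: Lp_norm_def r)
  also have "\<dots> = sqrt (LINT x|leb l. (cmod (f x))\<^sup>2)"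
    by (rule powr_half_sqrt) simp
  finally have "(Lp_norm l 2 f)\<^sup>2 = (LINT x|leb l. (cmod (f x))\<^sup>2)" by simp
  also have "\<dots> = integral {0..l} (\<lambda>x. (cmod (f x))\<^sup>2)"
    by (rule lebesgue_integral_eq_integral[OF int]) simp
  finally show ?thesis
    using integrable_integral[OF integrable_on_lebesgue_on[OF int]] by simp
qed

lemma L2_add_diff:
  assumes f: "f \<in> Lp_space l 2" and h: "h \<in> Lp_space l 2"
  shows "(\<lambda>x. (cmod (f x + h x))\<^sup>2) integrable_on {0..l}"
    "(\<lambda>x. (cmod (f x - h x))\<^sup>2) integrable_on {0..l}"
    "integral {0..l} (\<lambda>x. (cmod (f x + h x))\<^sup>2) + integral {0..l} (\<lambda>x. (cmod (f x - h x))\<^sup>2) =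
       2 * ((Lp_norm l 2 f)\<^sup>2 + (Lp_norm l 2 h)\<^sup>2)"
proof -
  have par: "(cmod (x + y))\<^sup>2 + (cmod (x - y))\<^sup>2 = 2 * ((cmod x)\<^sup>2 + (cmod y)\<^sup>2)" for x y :: complex
    unfolding cmod_power2 by (simp add: power2_eq_square algebra_simps)
  have m: "f \<in> borel_measurable (leb l)" "h \<in> borel_measurable (leb l)"
    and i: "integrable (leb l) (\<lambda>x. (cmod (f x))\<^sup>2)" "integrable (leb l) (\<lambda>x. (cmod (h x))\<^sup>2)"
    using f h Lp_space_2_iff by blast+
  have ib: "integrable (leb l) (\<lambda>x. 2 * ((cmod (f x))\<^sup>2 + (cmod (h x))\<^sup>2))" using i by simp
  have "integrable (leb l) (\<lambda>x. (cmod (f x + h x))\<^sup>2)"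
  proof (rule Bochner_Integration.integrable_bound[OF ib])
    show "(\<lambda>x. (cmod (f x + h x))\<^sup>2) \<in> borel_measurable (leb l)" using m by measurable
    have "(cmod (f x + h x))\<^sup>2 \<le> 2 * ((cmod (f x))\<^sup>2 + (cmod (h x))\<^sup>2)" for x
      using par[of "f x" "h x"] zero_le_power2[of "cmod (f x - h x)"] by linarith
    then show "AE x in leb l. norm ((cmod (f x + h x))\<^sup>2) \<le> norm (2 * ((cmod (f x))\<^sup>2 + (cmod (h x))\<^sup>2))"
      by (intro AE_I2) simp
  qed
  then show 1: "(\<lambda>x. (cmod (f x + h x))\<^sup>2) integrable_on {0..l}" by (rule integrable_on_lebesgue_on) simp
  have t: "((\<lambda>x. 2 * ((cmod (f x))\<^sup>2 + (cmod (h x))\<^sup>2)) has_integral 2 * ((Lp_norm l 2 f)\<^sup>2 + (Lp_norm l 2 h)\<^sup>2)) {0..l}"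
    by (intro has_integral_mult_right has_integral_add L2_has_integral f h)
  have d: "2 * ((cmod (f x))\<^sup>2 + (cmod (h x))\<^sup>2) - (cmod (f x + h x))\<^sup>2 = (cmod (f x - h x))\<^sup>2" for x
    using par[of "f x" "h x"] by simp
  from has_integral_diff[OF t integrable_integral[OF 1]]
  have 2: "((\<lambda>x. (cmod (f x - h x))\<^sup>2) has_integral (2 * ((Lp_norm l 2 f)\<^sup>2 + (Lp_norm l 2 h)\<^sup>2) - integral {0..l} (\<lambda>x. (cmod (f x + h x))\<^sup>2))) {0..l}"
    unfolding d .
  from 2 show "(\<lambda>x. (cmod (f x - h x))\<^sup>2) integrable_on {0..l}" by (rule has_integral_integrable)
  show "integral {0..l} (\<lambda>x. (cmod (f x + h x))\<^sup>2) + integral {0..l} (\<lambda>x. (cmod (f x - h x))\<^sup>2) =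
       2 * ((Lp_norm l 2 f)\<^sup>2 + (Lp_norm l 2 h)\<^sup>2)"
    using integral_unique[OF 2] by simp
qed

lemma sum_pairs:
  fixes F :: "nat \<Rightarrow> real"
  shows "(\<Sum>i\<in>{1..2 * n}. F i) = (\<Sum>j\<in>{1..n}. F (2 * j - 1) + F (2 * j))"
  by (induction n) simp_all

lemma one_minus_square_reflection:
  fixes x :: real
  assumes "x > 0"
  shows "1 - ((1 - x) / (1 + x))\<^sup>2 = 4 * x / (1 + x)\<^sup>2"
proof -
  have "1 - ((1 - x) / (1 + x))\<^sup>2 = ((1 + x)\<^sup>2 - (1 - x)\<^sup>2) / (1 + x)\<^sup>2"
    unfolding power_divide using assms by (simp add: diff_divide_distrib)
  also have "(1 + x)\<^sup>2 - (1 - x)\<^sup>2 = 4 * x" by (simp add: power2_eq_square algebra_simps)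
  finally show ?thesis .
qed

context wave_net
begin

text \<open>By the parallelogram law the two waves on an edge together carry twice the squared norms
  of slope and velocity, hence the division by 2.\<close>

lemma dAlembert_isometry:
  assumes U: "U \<in> wave_space G 2"
  shows "\<And>i. i \<in> components \<Longrightarrow> (\<lambda>x. (cmod (dAlembert G U i x))\<^sup>2) integrable_on {0..tlen G i}"
    "wave_norm G 2 U = sqrt ((\<Sum>i\<in>components. integral {0..tlen G i} (\<lambda>x. (cmod (dAlembert G U i x))\<^sup>2)) / 2)"
proof -
  obtain u v where uv: "U = (u, v)" by (cases U)
  let ?du = "\<lambda>j. weak_deriv (len G j) (u j)"
  let ?X = "\<lambda>j. Lp_norm (len G j) 2 (?du j)" and ?Y = "\<lambda>j. Lp_norm (len G j) 2 (v j)"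
  define I where "I = (\<lambda>i. integral {0..tlen G i} (\<lambda>x. (cmod (dAlembert G U i x))\<^sup>2))"
  have L2: "?du j \<in> Lp_space (len G j) 2" "v j \<in> Lp_space (len G j) 2" if "j \<in> edges" for j
    using U that unfolding uv wave_space_def W1p0_def Lp_net_def by (blast intro: weak_deriv_in_Lp)+
  have odd: "((\<lambda>x. (cmod (dAlembert G U (2 * j - 1) x))\<^sup>2) has_integral
      integral {0..len G j} (\<lambda>x. (cmod (?du j x + v j x))\<^sup>2)) {0..tlen G (2 * j - 1)}" if j: "j \<in> edges" for j
  proof -
    have "odd (2 * j - 1)" "(2 * j - 1 + 1) div 2 = j" using j by auto
    then show ?thesis
      using has_integral_reflect_shift[OF integrable_integral[OF L2_add_diff(1)[OF L2[OF j]]], of "len G j"]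
      by (simp add: dAlembert_def uv Let_def tlen_def)
  qed
  have even: "((\<lambda>x. (cmod (dAlembert G U (2 * j) x))\<^sup>2) has_integral
      integral {0..len G j} (\<lambda>x. (cmod (?du j x - v j x))\<^sup>2)) {0..tlen G (2 * j)}" if j: "j \<in> edges" for j
    using integrable_integral[OF L2_add_diff(2)[OF L2[OF j]]]
    by (simp add: dAlembert_def uv Let_def tlen_def)
  show "(\<lambda>x. (cmod (dAlembert G U i x))\<^sup>2) integrable_on {0..tlen G i}" if i: "i \<in> components" for i
  proof -
    define j where "j = (i + 1) div 2"
    have j: "j \<in> edges" using i by (auto simp: j_def)
    have "i = 2 * j - 1 \<or> i = 2 * j" unfolding j_def by presburger
    then show ?thesis
      using has_integral_integrable[OF odd[OF j]] has_integral_integrable[OF even[OF j]] by blast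
  qed
  have "(\<Sum>i\<in>components. I i) = (\<Sum>j\<in>edges. I (2 * j - 1) + I (2 * j))" by (rule sum_pairs)
  also have "\<dots> = (\<Sum>j\<in>edges. 2 * ((?X j)\<^sup>2 + (?Y j)\<^sup>2))"
  proof (rule sum.cong)
    fix j assume j: "j \<in> edges"
    show "I (2 * j - 1) + I (2 * j) = 2 * ((?X j)\<^sup>2 + (?Y j)\<^sup>2)"
      unfolding I_def integral_unique[OF odd[OF j]] integral_unique[OF even[OF j]]
      by (rule L2_add_diff(3)[OF L2[OF j]])
  qed simp
  finally have s: "(\<Sum>i\<in>components. I i) / 2 = (\<Sum>j\<in>edges. (?X j)\<^sup>2) + (\<Sum>j\<in>edges. (?Y j)\<^sup>2)"
    by (simp only: sum_distrib_left[symmetric] sum.distrib) simp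
  have r: "real_of_ereal 2 = 2" using real_of_ereal.simps(1)[of 2] by (simp only: numeral_eq_ereal)
  have "(2::ereal) \<noteq> \<infinity>" by simp
  then have "wave_norm G 2 U = ((\<Sum>j\<in>edges. ?X j powr 2) + (\<Sum>j\<in>edges. ?Y j powr 2)) powr (1 / 2)"
    by (simp add: wave_norm_def uv r)
  also have "\<dots> = ((\<Sum>j\<in>edges. (?X j)\<^sup>2) + (\<Sum>j\<in>edges. (?Y j)\<^sup>2)) powr (1 / 2)"
  proof -
    have "Lp_norm (len G j) 2 f powr 2 = (Lp_norm (len G j) 2 f)\<^sup>2" if "j \<in> edges" for j f
      by (rule powr_numeral[OF Lp_norm_nonneg[OF len_pos[OF that]]])
    then have "(\<Sum>j\<in>edges. ?X j powr 2) = (\<Sum>j\<in>edges. (?X j)\<^sup>2)"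
      "(\<Sum>j\<in>edges. ?Y j powr 2) = (\<Sum>j\<in>edges. (?Y j)\<^sup>2)"
      by (intro sum.cong refl; blast)+
    then show ?thesis by (simp only:)
  qed
  also have "\<dots> = sqrt ((\<Sum>j\<in>edges. (?X j)\<^sup>2) + (\<Sum>j\<in>edges. (?Y j)\<^sup>2))"
    by (rule powr_half_sqrt) (auto intro!: add_nonneg_nonneg sum_nonneg)
  finally show "wave_norm G 2 U = sqrt ((\<Sum>i\<in>components. integral {0..tlen G i} (\<lambda>x. (cmod (dAlembert G U i x))\<^sup>2)) / 2)"
    unfolding s[unfolded I_def] .
qed

text \<open>On the window \<open>{t - tlen G i..t}\<close>, \<open>g i\<close> is the d'Alembert
  transform of \<open>U t\<close> read backwards. This turns the wave norm into
  \<open>energy\<close> and gives square integrability.\<close>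

lemma wave_solution_trajectory:
  assumes sol: "wave_solution G 2 a U0 U" and U0: "U0 \<in> wave_space G 2"
    and \<kappa>: "\<And>q t. q \<in> damped G \<Longrightarrow> \<kappa> \<le> 1 - (refl_coeff G (a t) q)\<^sup>2"
  obtains g where "trajectory \<kappa> a g" "\<And>t. t \<ge> 0 \<Longrightarrow> wave_norm G 2 (U t) = sqrt (energy g t / 2)"
    "wave_norm G 2 U0 = sqrt (energy g 0 / 2)"
proof -
  let ?R = "components"
  have sp: "U t \<in> wave_space G 2" if "t \<ge> 0" for t using sol that by (auto simp: wave_solution_def)
  obtain g where g: "\<And>i. i \<in> ?R \<Longrightarrow> AE s in lebesgue. - tlen G i \<le> s \<and> s < 0 \<longrightarrow> g i s = dAlembert G U0 i (- s)"
    and law: "\<And>i. i \<in> ?R \<Longrightarrow> AE t in lebesgue. t \<ge> 0 \<longrightarrow>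
           g i t = (\<Sum>k\<in>?R. of_real (trans_mat G (a t) i k) * g k (t - tlen G k))"
    and gU: "\<And>i t. i \<in> ?R \<Longrightarrow> t \<ge> 0 \<Longrightarrow> AE x in lebesgue. 0 \<le> x \<and> x \<le> tlen G i \<longrightarrow> dAlembert G (U t) i x = g i (t - x)"
    using sol unfolding wave_solution_def transport_solution_def by blast
  let ?\<phi> = "\<lambda>i s. (cmod (g i s))\<^sup>2"
  have win: "(?\<phi> i has_integral J) {t - tlen G i..t}"
    if i: "i \<in> ?R" and t: "t \<ge> 0" and J: "((\<lambda>x. (cmod (dAlembert G (U t) i x))\<^sup>2) has_integral J) {0..tlen G i}" for i t J
  proof -
    have "((\<lambda>x. ?\<phi> i (t - x)) has_integral J) {0..tlen G i}"
      using J by (rule has_integral_AE_cong) (use gU[OF i t] in \<open>auto elim!: eventually_mono\<close>)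
    from has_integral_reflect_shift[OF this, of t] show ?thesis by simp
  qed
  have wini: "?\<phi> i integrable_on {t - tlen G i..t}" if i: "i \<in> ?R" and t: "t \<ge> 0" for i t
    using win[OF i t integrable_integral[OF dAlembert_isometry(1)[OF sp[OF t] i]]] by (rule has_integral_integrable)
  have en: "wave_norm G 2 (U t) = sqrt (energy g t / 2)" if t: "t \<ge> 0" for t
  proof -
    have "energy g t = (\<Sum>i\<in>?R. integral {0..tlen G i} (\<lambda>x. (cmod (dAlembert G (U t) i x))\<^sup>2))"
      unfolding energy_def
      by (intro sum.cong refl integral_unique win[OF _ t] integrable_integral dAlembert_isometry(1)[OF sp[OF t]])
    then show ?thesis using dAlembert_isometry(2)[OF sp[OF t]] by simp
  qed
  have en0: "wave_norm G 2 U0 = sqrt (energy g 0 / 2)"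
  proof -
    let ?I = "\<lambda>i. integral {0..tlen G i} (\<lambda>x. (cmod (dAlembert G U0 i x))\<^sup>2)"
    have "energy g 0 = (\<Sum>i\<in>?R. ?I i)"
      unfolding energy_def
    proof (intro sum.cong refl integral_unique)
      fix i assume i: "i \<in> ?R"
      have "((\<lambda>s. (cmod (dAlembert G U0 i (0 - s)))\<^sup>2) has_integral ?I i) {0 - tlen G i..0 - 0}"
        by (rule has_integral_reflect_shift[OF integrable_integral[OF dAlembert_isometry(1)[OF U0 i]]])
      then have "((\<lambda>s. (cmod (dAlembert G U0 i (- s)))\<^sup>2) has_integral ?I i) {0 - tlen G i..0}" by simp
      moreover have "AE s in lebesgue. s \<in> {0 - tlen G i..0} \<longrightarrow> (cmod (dAlembert G U0 i (- s)))\<^sup>2 = ?\<phi> i s"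
      proof -
        \<comment> \<open>The initial condition covers \<open>s < 0\<close> only, so the endpoint 0
          of the window is removed as a null set.\<close>
        have "AE s in lebesgue. s \<notin> {0::real}"
          by (intro AE_not_in) (simp only: negligible_iff_null_sets[symmetric] negligible_sing)
        with g[OF i] show ?thesis by eventually_elim auto
      qed
      ultimately show "(?\<phi> i has_integral ?I i) {0 - tlen G i..0}" by (rule has_integral_AE_cong)
    qed
    then show ?thesis using dAlembert_isometry(2)[OF U0] by simp
  qed
  have "trajectory \<kappa> a g"
    unfolding trajectory_def
  proof (intro conjI ballI allI \<kappa>)
    fix i assume i: "i \<in> ?R"
    let ?L = "tlen G i"
    have L: "?L > 0" using tlen_pos[OF i] .
    show "AE t in lebesgue. t \<ge> 0 \<longrightarrow> g i t = scatter (a t) i (\<lambda>k. g k (t - tlen G k))"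
      using law[OF i] by (simp add: scatter_def scaleR_conv_of_real)
    \<comment> \<open>The windows ending at multiples of \<open>?L\<close> adjoin without
      gaps.\<close>
    have st: "?\<phi> i integrable_on {- ?L..real n * ?L}" for n
    proof (induction n)
      case 0
      then show ?case using wini[OF i, of 0] by simp
    next
      case (Suc n)
      have "?\<phi> i integrable_on {real n * ?L..real (Suc n) * ?L}"
        using wini[OF i, of "real (Suc n) * ?L"] L by (simp add: algebra_simps)
      moreover have "- ?L \<le> real n * ?L" using L mult_right_mono[of "-1" "real n" ?L] by simp
      ultimately show ?case
        using L by (intro Henstock_Kurzweil_Integration.integrable_combine[OF _ _ Suc]) (auto simp: algebra_simps)
    qed
    fix t
    obtain n where "t / ?L < real n" using reals_Archimedean2 by blast
    then have "t \<le> real n * ?L" using L by (simp add: field_simps)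
    then show "?\<phi> i integrable_on {- ?L..t}"
      by (intro integrable_subinterval_real[OF st[of n]]) auto
  qed auto
  then show ?thesis using en en0 by (rule that)
qed

lemma exp_stable_sufficient:
  fixes \<nu> :: "'d::finite \<Rightarrow> 'v" and D :: "(real ^ 'd) set"
  assumes tree: "graph_tree G" and u1: "card (undamped G) = 1" and pos: "closure D \<subseteq> {x. \<forall>i. 0 < x $ i}"
    and \<nu>: "bij_betw \<nu> UNIV (damped G)" and D: "D \<noteq> {}" and bd: "bounded D"
  shows "wave_exp_stable G \<nu> (Linf_into D) 2"
proof -
  obtain r where r: "undamped G = {r}" using u1 by (auto simp: card_1_singleton_iff)
  have disj: "damped G \<inter> undamped G = {}" using network by (simp add: is_network_def)
  \<comment> \<open>A path from a damped vertex to the root has nonzero flow, so some edge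
    exists.\<close>
  have n1: "nedges G \<ge> 1"
  proof -
    obtain q where q: "q \<in> damped G" using network by (auto simp: is_network_def)
    have "q \<in> verts G" "r \<in> verts G" using network q r by (auto simp: is_network_def ext_verts_def)
    then obtain ps where ps: "graph_path G ps" "hd ps = q" "last ps = r"
      using network unfolding is_network_def graph_connected_def by blast
    moreover have "q \<noteq> r" using q r disj by auto
    ultimately show ?thesis using path_flow_nonzero[of ps] by auto
  qed
  \<comment> \<open>The coordinate attains its minimum on the compact set \<open>closure D\<close>,
    where it is positive.\<close>
  have "\<exists>m>0. \<forall>x\<in>D. m \<le> x $ i" for i
  proof -
    have "compact (closure D)" using bd by (simp add: compact_closure)
    moreover have "closure D \<noteq> {}" using D by simp
    ultimately obtain y where y: "y \<in> closure D" "\<And>x. x \<in> closure D \<Longrightarrow> y $ i \<le> x $ i"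
      using continuous_attains_inf[of "closure D" "\<lambda>x. x $ i"] continuous_on_component[OF continuous_on_id] by blast
    then show ?thesis using pos closure_subset[of D] by (intro exI[where x = "y $ i"]) auto
  qed
  then obtain m where m: "\<And>i. m i > 0" "\<And>i x. x \<in> D \<Longrightarrow> m i \<le> x $ i" by metis
  define \<mu> where "\<mu> = Min (range m)"
  have \<mu>: "\<mu> > 0" "\<And>x i. x \<in> D \<Longrightarrow> \<mu> \<le> x $ i"
  proof -
    show "\<mu> > 0" unfolding \<mu>_def using m(1) by (subst Min_gr_iff) auto
    fix x i assume "x \<in> D"
    then have "m i \<le> x $ i" by (rule m(2))
    moreover have "\<mu> \<le> m i" unfolding \<mu>_def by (rule Min_le) auto
    ultimately show "\<mu> \<le> x $ i" by simp
  qed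
  obtain B where B: "B > 0" "\<And>x. x \<in> D \<Longrightarrow> norm x \<le> B" using bd by (auto simp: bounded_pos)
  have B': "x $ i \<le> B" if "x \<in> D" for x i
    using component_le_norm_cart[of x i] B(2)[OF that] by linarith
  \<comment> \<open>The absorbed fraction is 4x/(1 + x)^2; numerator and denominator are estimated
    separately for x between \<mu> and \<open>B\<close>.\<close>
  define \<kappa> where "\<kappa> = 4 * \<mu> / (1 + B)\<^sup>2"
  have \<kappa>0: "\<kappa> > 0" using \<mu>(1) B(1) by (simp add: \<kappa>_def)
  have \<kappa>: "\<kappa> \<le> 1 - (refl_coeff G (\<lambda>q. \<eta> t $ inv \<nu> q) q)\<^sup>2"
    if \<eta>: "\<eta> \<in> Linf_into D" and q: "q \<in> damped G" for \<eta> t q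
  proof -
    let ?x = "\<eta> t $ inv \<nu> q"
    have x: "\<mu> \<le> ?x" "?x \<le> B" using \<eta> \<mu>(2) B' by (auto simp: Linf_into_def)
    have x0: "?x > 0" using x(1) \<mu>(1) by linarith
    have "q \<notin> undamped G" using q disj by auto
    then have "1 - (refl_coeff G (\<lambda>q. \<eta> t $ inv \<nu> q) q)\<^sup>2 = 4 * ?x / (1 + ?x)\<^sup>2"
      using one_minus_square_reflection[of ?x] x0 by (simp add: refl_coeff_def)
    also have "\<dots> \<ge> 4 * \<mu> / (1 + B)\<^sup>2"
      using x x0 \<mu>(1) by (intro frac_le power_mono) auto
    finally show ?thesis by (simp add: \<kappa>_def)
  qed
  obtain K \<theta> where K: "K > 0" and l: "\<theta> < 0"
    and dec: "\<And>a g t. trajectory \<kappa> a g \<Longrightarrow> 0 \<le> t \<Longrightarrow> energy g t \<le> K * exp (\<theta> * t) * energy g 0"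
    using energy_exponential_decay[OF tree r \<kappa>0 n1] by blast
  show ?thesis
    unfolding wave_exp_stable_def wave_exp_type_def
  \<comment> \<open>The norm is the square root of half the energy, hence half the decay
    rate.\<close>
  proof (rule exI[where x = "\<theta> / 2"], intro conjI allI impI)
    show "\<theta> / 2 < 0" using l by simp
    fix \<epsilon> :: real assume \<epsilon>: "\<epsilon> > 0"
    show "\<exists>K>0. \<forall>\<eta>\<in>Linf_into D. \<forall>U0\<in>wave_space G 2. \<forall>U.
        wave_solution G 2 (\<lambda>t q. \<eta> t $ inv \<nu> q) U0 U \<longrightarrow>
        (\<forall>t\<ge>0. wave_norm G 2 (U t) \<le> K * exp ((\<theta> / 2 + \<epsilon>) * t) * wave_norm G 2 U0)"
    proof (rule exI[where x = "sqrt K"], intro conjI ballI allI impI)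
      show "sqrt K > 0" using K by simp
      fix \<eta> U0 U and t :: real
      assume \<eta>: "\<eta> \<in> Linf_into D" and U0: "U0 \<in> wave_space G 2"
        and sol: "wave_solution G 2 (\<lambda>t q. \<eta> t $ inv \<nu> q) U0 U" and t: "0 \<le> t"
      obtain g where g: "trajectory \<kappa> (\<lambda>t q. \<eta> t $ inv \<nu> q) g"
        and n: "\<And>t. t \<ge> 0 \<Longrightarrow> wave_norm G 2 (U t) = sqrt (energy g t / 2)"
        and n0: "wave_norm G 2 U0 = sqrt (energy g 0 / 2)"
        using wave_solution_trajectory[OF sol U0 \<kappa>[OF \<eta>]] by blast
      have e0: "energy g 0 \<ge> 0" using energy_nonneg[OF g] by simp
      have "wave_norm G 2 (U t) \<le> sqrt (K * exp (\<theta> * t) * energy g 0 / 2)"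
        using n[OF t] dec[OF g t] by simp
      also have "\<dots> = sqrt K * sqrt (exp (\<theta> * t)) * sqrt (energy g 0 / 2)"
        by (simp add: real_sqrt_mult[symmetric])
      also have "sqrt (exp (\<theta> * t)) = exp (\<theta> / 2 * t)"
        by (rule real_sqrt_unique) (simp_all add: power2_eq_square mult_exp_exp)
      also have "sqrt K * exp (\<theta> / 2 * t) * sqrt (energy g 0 / 2) \<le> sqrt K * exp ((\<theta> / 2 + \<epsilon>) * t) * sqrt (energy g 0 / 2)"
      proof (intro mult_right_mono mult_left_mono)
        have "\<theta> / 2 * t \<le> (\<theta> / 2 + \<epsilon>) * t" using t \<epsilon> by (intro mult_right_mono) auto
        then show "exp (\<theta> / 2 * t) \<le> exp ((\<theta> / 2 + \<epsilon>) * t)" by (simp only: exp_le_cancel_iff)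
      qed (use e0 K in auto)
      finally show "wave_norm G 2 (U t) \<le> sqrt K * exp ((\<theta> / 2 + \<epsilon>) * t) * wave_norm G 2 U0"
        using n0 by simp
    qed
  qed
qed

end

theorem theorem5p16:
  fixes G :: "'v network" and \<nu> :: "'d::finite \<Rightarrow> 'v" and D :: "(real ^ 'd) set"
  assumes "is_network G"
    and "bij_betw \<nu> UNIV (damped G)"
    and "D \<noteq> {}" and "bounded D" and "D \<subseteq> {x. \<forall>i. 0 \<le> x $ i}"
  shows "(\<exists>p::ereal. 1 \<le> p \<and> wave_exp_stable G \<nu> (Linf_into D) p) \<longleftrightarrow>
         graph_tree G \<and> card (undamped G) = 1 \<and> closure D \<subseteq> {x. \<forall>i. 0 < x $ i}"
proof -
  interpret wave_net G by (rule wave_net.intro) (rule assms)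
  show ?thesis
  proof
    assume "\<exists>p::ereal. 1 \<le> p \<and> wave_exp_stable G \<nu> (Linf_into D) p"
    then obtain p :: ereal where "1 \<le> p" "wave_exp_stable G \<nu> (Linf_into D) p" by blast
    then show "graph_tree G \<and> card (undamped G) = 1 \<and> closure D \<subseteq> {x. \<forall>i. 0 < x $ i}"
      by (rule exp_stable_necessary) (use assms in auto)
  next
    assume "graph_tree G \<and> card (undamped G) = 1 \<and> closure D \<subseteq> {x. \<forall>i. 0 < x $ i}"
    then have "wave_exp_stable G \<nu> (Linf_into D) 2"
      using exp_stable_sufficient[OF _ _ _ assms(2-4)] by blast
    moreover have "(1::ereal) \<le> 2" by simp
    ultimately show "\<exists>p::ereal. 1 \<le> p \<and> wave_exp_stable G \<nu> (Linf_into D) p" by blast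
  qed
qed

end
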